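(* Let $d\ge 3$ and let $G_1,\dots,G_d$ be isoperimetric graphs, each with a fixed optimal order $\mathcal O_{G_i}$ and an isoperimetric partition $\mathfrak P_{G_i}$, and let $G=G_1\square\cdots\square G_d$. Suppose that (1) for $i=1,\dots,d-1$ the partition $\mathfrak P_{G_i}$ is non-decreasing, and (2) the partitions $\mathfrak P_{G_1},\dots,\mathfrak P_{G_d}$, together with the chosen domination orders, form a regular domination collection. If for all $i,j\in\{1,\dots,d\}$ with $i<j$ the block-lexicographic order $\mathcal{BL}^2_{G_i\square G_j}$ is optimal for $G_i\square G_j$, then the block-lexicographic order $\mathcal{BL}^d_G$ is optimal for $G$.
   Context: All graphs are finite and simple. For a graph $G=(V,E)$ and $A,B\subseteq V$, $I_G(A,B)$ is the set of edges $\{u,v\}\in E$ with $u\in A$, $v\in B$; $I_G(A)=I_G(A,A)$; $I_G(m)=\max_{S\subseteq V,|S|=m}|I_G(S)|$. A total order on $G$ is a bijection $\mathcal O:V\to\{1,\dots,|V|\}$; $u<_{\mathcal O}v$ iff $\mathcal O(u)<\mathcal O(v)$; $\mathcal O[k,l]=\mathcal O^{-1}(\{k,\dots,l\})$ and $\mathcal O[k]=\mathcal O[1,k]$ (the initial segment of size $k$). The order is optimal if $|I_G(\mathcal O[k])|=I_G(k)$ for every $k$; $G$ is isoperimetric if it has an optimal order. Put $\delta_G(1)=0$ and $\delta_G(m)=I_G(m)-I_G(m-1)$ for $m\ge 2$. Cartesian product $G_1\square\cdots\square G_d$: vertex set $V_1\times\cdots\times V_d$, two vertices adjacent iff they differ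 in exactly one coordinate $i$ and their $i$-th coordinates are adjacent in $G_i$. The lexicographic order on $\mathbb R^k$: $x<y$ iff there is $i\in\{0,\dots,k-1\}$ with $x_1=y_1,\dots,x_i=y_i$ and $x_{i+1}<y_{i+1}$. For $\pi$ in the symmetric group $\mathfrak S_k$, the domination order $\mathcal D^{\pi,k}$ on $\mathbb R^k$: $x<y$ iff $(x_{\pi(1)},\dots,x_{\pi(k)})$ is lexicographically smaller than $(y_{\pi(1)},\dots,y_{\pi(k)})$. If the vertex sets $W_1,\dots,W_k$ of graphs carry total orders $\eta_1,\dots,\eta_k$, an order on $\mathbb R^k$ induces an order on $W_1\times\cdots\times W_k$ by comparing $(\eta_1(v_1),\dots,\eta_k(v_k))$. Isoperimetric partition: for $G$ isoperimetric with optimal order $\mathcal O_G$, a partition $\mathfrak P_G=\{\mathcal O_G[a_1,b_1],\dots,\mathcal O_G[a_k,b_k]\}$ of $V$ into consecutive intervals ($a_1=1$, $a_{i+1}=b_i+1$, $b_k=|V|$) such that (i) each induced subgraph $(\mathcal O_G[a_i,b_i],I_G(\mathcal O_G[a_i,b_i]))$ is isoperimetric with the restriction of $\mathcal O_G$ as an optimal order, and (ii) for every $v\in\mathcal O_G[a_i,b_i]$, $|I_G(\mathcal O_G[a_1,b_{i-1}],\{v\})|=\delta_G(a_i)$. The first vertex of a part is its start. $\mathfrak P_G$ is non-decreasing if the $\delta$-sequence of every part's induced subgraph is non-decreasing; it is regular if the $\delta$-sequence of the induced subgraph on the first part equals that on the last part. Product setup: for nonempty $S=\{i_1<\dots<i_k\}\subseteq\{1,\dots,d\}$,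 $G_S=G_{i_1}\square\cdots\square G_{i_k}$. A block of $G_S$ is a set $Z_{i_1}\times\cdots\times Z_{i_k}$ with $Z_{i_j}\in\mathfrak P_{G_{i_j}}$; its start is the tuple of the starts of the $Z_{i_j}$. A total order $\mathcal O$ on a product is consistent with a total order $\mathcal O'$ on the subproduct over $S$ if $x<_{\mathcal O}y$ and $x_j=y_j$ for all $j\notin S$ imply $(x_{i_1},\dots,x_{i_k})<_{\mathcal O'}(y_{i_1},\dots,y_{i_k})$. The partitions form a domination collection if for every nonempty $S$ and every block $B=Z_{i_1}\times\cdots\times Z_{i_k}$ of $G_S$ a permutation $\pi_B\in\mathfrak S_k$ is given such that the order $\mathcal D_B$ induced by $\mathcal D^{\pi_B,k}$ on $B$ (coordinate $j$ ordered by the restriction of $\mathcal O_{G_{i_j}}$) is optimal for the subgraph of $G_S$ induced by $B$, and whenever $S_1\subset S_2$ and $B_1$ is the block of $G_{S_1}$ obtained from a block $B_2$ of $G_{S_2}$ by keeping the factors indexed by $S_1$, $\mathcal D_{B_2}$ is consistent with $\mathcal D_{B_1}$. The block-lexicographic order $\mathcal{BL}^k_{G_S}$: two vertices in the same block $B$ are compared by $\mathcal D_B$; vertices in different blocks are compared by comparing the starts of their blocks in the lexicographic order (coordinate $j$ ordered by $\mathcal O_{G_{i_j}}$). $\mathcal{BL}^d_G=\mathcal{BL}^d_{G_{\{1,\dots,d\}}}$. A domination collection is regular if $\mathfrak P_{G_i}$ is regular for $i=2,\dots,d-1$ and, for the blocks $B_1$ (product of the first parts of $\mathfrak P_{G_2},\dots,\mathfrak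 P_{G_{d-1}}$) and $B_2$ (product of their last parts) of $G_{\{2,\dots,d-1\}}$, $\pi_{B_1}=\pi_{B_2}$. *)

theory Defs
  imports "HOL-Library.FuncSet" "HOL-Combinatorics.Permutations"
begin

record 'a ugraph =
  verts :: "'a set"
  edges :: "'a set set"

definition simple_graph :: "'a ugraph \<Rightarrow> bool" where
  "simple_graph G \<longleftrightarrow>
     finite (verts G) \<and> edges G \<subseteq> {{u, v} | u v. u \<in> verts G \<and> v \<in> verts G \<and> u \<noteq> v}"

definition edges_between :: "'a ugraph \<Rightarrow> 'a set \<Rightarrow> 'a set \<Rightarrow> 'a set set" where
  "edges_between G A B = {e \<in> edges G. \<exists>u\<in>A. \<exists>v\<in>B. e = {u, v}}"

definition induced_edges :: "'a ugraph \<Rightarrow> 'a set \<Rightarrow> 'a set set" where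
  "induced_edges G A = edges_between G A A"

definition induced_subgraph :: "'a ugraph \<Rightarrow> 'a set \<Rightarrow> 'a ugraph" where
  "induced_subgraph G A = \<lparr>verts = A, edges = induced_edges G A\<rparr>"

text \<open>Only meaningful for \<open>m \<le> card (verts G)\<close>; all uses below stay in this range.\<close>

definition max_edges :: "'a ugraph \<Rightarrow> nat \<Rightarrow> nat" where
  "max_edges G m = Max {card (induced_edges G S) | S. S \<subseteq> verts G \<and> card S = m}"

definition delta :: "'a ugraph \<Rightarrow> nat \<Rightarrow> int" where
  "delta G m = (if m \<le> 1 then 0 else int (max_edges G m) - int (max_edges G (m - 1)))"

definition delta_seq :: "'a ugraph \<Rightarrow> int list" where
  "delta_seq G = map (delta G) [1..<Suc (card (verts G))]"

definition total_order :: "'a ugraph \<Rightarrow> ('a \<Rightarrow> nat) \<Rightarrow> bool" where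
  "total_order G ord \<longleftrightarrow> bij_betw ord (verts G) {1..card (verts G)}"

definition segment :: "'a ugraph \<Rightarrow> ('a \<Rightarrow> nat) \<Rightarrow> nat \<Rightarrow> nat \<Rightarrow> 'a set" where
  "segment G ord k l = {v \<in> verts G. ord v \<in> {k..l}}"

definition optimal_order :: "'a ugraph \<Rightarrow> ('a \<Rightarrow> nat) \<Rightarrow> bool" where
  "optimal_order G ord \<longleftrightarrow>
     total_order G ord \<and>
     (\<forall>k\<le>card (verts G). card (induced_edges G (segment G ord 1 k)) = max_edges G k)"

definition isoperimetric :: "'a ugraph \<Rightarrow> bool" where
  "isoperimetric G \<longleftrightarrow> (\<exists>ord. optimal_order G ord)"

text \<open>A strict total order \<open>r\<close> on a finite set \<open>W\<close>, seen as a bijection onto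
  \<open>{1..card W}\<close>: each element is sent to its position.\<close>

definition order_map :: "'a set \<Rightarrow> ('a \<Rightarrow> 'a \<Rightarrow> bool) \<Rightarrow> 'a \<Rightarrow> nat" where
  "order_map W r v = card {u \<in> W. r u v} + 1"

definition optimal_rel :: "'a ugraph \<Rightarrow> ('a \<Rightarrow> 'a \<Rightarrow> bool) \<Rightarrow> bool" where
  "optimal_rel G r \<longleftrightarrow> optimal_order G (order_map (verts G) r)"

text \<open>Since \<open>a (Suc i) = b i + 1\<close>, the vertices preceding the \<open>i\<close>-th part form the segment
  from \<open>a 1\<close> to \<open>a i - 1\<close>, which is empty for \<open>i = 1\<close>.\<close>

definition isoperimetric_partition :: "'a ugraph \<Rightarrow> ('a \<Rightarrow> nat) \<Rightarrow> 'a set set \<Rightarrow> bool" where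
  "isoperimetric_partition G ord P \<longleftrightarrow>
     (\<exists>k a b. 1 \<le> k \<and> P = (\<lambda>i. segment G ord (a i) (b i)) ` {1..k} \<and>
        a 1 = 1 \<and> (\<forall>i\<in>{1..<k}. a (Suc i) = b i + 1) \<and> b k = card (verts G) \<and>
        (\<forall>i\<in>{1..k}. a i \<le> b i) \<and>
        (\<forall>i\<in>{1..k}.
           optimal_rel (induced_subgraph G (segment G ord (a i) (b i))) (\<lambda>u v. ord u < ord v)) \<and>
        (\<forall>i\<in>{1..k}. \<forall>v\<in>segment G ord (a i) (b i).
           int (card (edges_between G (segment G ord (a 1) (a i - 1)) {v})) = delta G (a i)))"

definition start :: "('a \<Rightarrow> nat) \<Rightarrow> 'a set \<Rightarrow> 'a" where
  "start ord Z = arg_min_on ord Z"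

definition first_part :: "('a \<Rightarrow> nat) \<Rightarrow> 'a set set \<Rightarrow> 'a set" where
  "first_part ord P = (THE Z. Z \<in> P \<and> (\<exists>v\<in>Z. ord v = 1))"

definition last_part :: "'a ugraph \<Rightarrow> ('a \<Rightarrow> nat) \<Rightarrow> 'a set set \<Rightarrow> 'a set" where
  "last_part G ord P = (THE Z. Z \<in> P \<and> (\<exists>v\<in>Z. ord v = card (verts G)))"

definition nondecreasing_partition :: "'a ugraph \<Rightarrow> 'a set set \<Rightarrow> bool" where
  "nondecreasing_partition G P \<longleftrightarrow> (\<forall>Z\<in>P. sorted (delta_seq (induced_subgraph G Z)))"

definition regular_partition :: "'a ugraph \<Rightarrow> ('a \<Rightarrow> nat) \<Rightarrow> 'a set set \<Rightarrow> bool" where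
  "regular_partition G ord P \<longleftrightarrow>
     delta_seq (induced_subgraph G (first_part ord P)) =
     delta_seq (induced_subgraph G (last_part G ord P))"

text \<open>A tuple indexed by \<open>S\<close> is an
  extensional function on \<open>S\<close>.\<close>

definition prod_graph :: "nat set \<Rightarrow> (nat \<Rightarrow> 'a ugraph) \<Rightarrow> (nat \<Rightarrow> 'a) ugraph" where
  "prod_graph S G =
     \<lparr>verts = (\<Pi>\<^sub>E i\<in>S. verts (G i)),
      edges = {{x, y} | x y. x \<in> (\<Pi>\<^sub>E i\<in>S. verts (G i)) \<and> y \<in> (\<Pi>\<^sub>E i\<in>S. verts (G i)) \<and>
                 (\<exists>i\<in>S. x i \<noteq> y i \<and> {x i, y i} \<in> edges (G i) \<and> (\<forall>j\<in>S - {i}. x j = y j))}\<rparr>"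

text \<open>Orders on \<open>k\<close>-tuples; a \<open>k\<close>-tuple is a function used on the positions \<open>1, \<dots>, k\<close>.\<close>

definition lex_less :: "nat \<Rightarrow> (nat \<Rightarrow> 'b::linorder) \<Rightarrow> (nat \<Rightarrow> 'b) \<Rightarrow> bool" where
  "lex_less k x y \<longleftrightarrow> (\<exists>i<k. (\<forall>j\<in>{1..i}. x j = y j) \<and> x (i + 1) < y (i + 1))"

definition dom_less ::
    "(nat \<Rightarrow> nat) \<Rightarrow> nat \<Rightarrow> (nat \<Rightarrow> 'b::linorder) \<Rightarrow> (nat \<Rightarrow> 'b) \<Rightarrow> bool" where
  "dom_less \<pi> k x y \<longleftrightarrow> lex_less k (\<lambda>j. x (\<pi> j)) (\<lambda>j. y (\<pi> j))"

text \<open>The \<open>j\<close>-th smallest element of \<open>S\<close>, counted from 1.\<close>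

definition nth_index :: "nat set \<Rightarrow> nat \<Rightarrow> nat" where
  "nth_index S j = sorted_list_of_set S ! (j - 1)"

definition positions :: "nat set \<Rightarrow> (nat \<Rightarrow> 'a \<Rightarrow> nat) \<Rightarrow> (nat \<Rightarrow> 'a) \<Rightarrow> nat \<Rightarrow> nat" where
  "positions S ord x j = ord (nth_index S j) (x (nth_index S j))"

definition consistent ::
    "nat set \<Rightarrow> (nat \<Rightarrow> 'a) set \<Rightarrow> ((nat \<Rightarrow> 'a) \<Rightarrow> (nat \<Rightarrow> 'a) \<Rightarrow> bool) \<Rightarrow>
     nat set \<Rightarrow> ((nat \<Rightarrow> 'a) \<Rightarrow> (nat \<Rightarrow> 'a) \<Rightarrow> bool) \<Rightarrow> bool" where
  "consistent T W r S r' \<longleftrightarrow>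
     (\<forall>x\<in>W. \<forall>y\<in>W. r x y \<and> (\<forall>j\<in>T - S. x j = y j) \<longrightarrow> r' (restrict x S) (restrict y S))"

text \<open>A block over \<open>S\<close> is encoded by its family of factors \<open>Z \<in> (\<Pi>\<^sub>E i\<in>S. P i)\<close>; as a vertex set
  it is \<open>\<Pi>\<^sub>E i\<in>S. Z i\<close>. The index set is passed separately, because the underlying set of an
  extensional function space need not determine it. Thus \<open>\<pi> S Z\<close> is the permutation chosen for
  the block with factors \<open>Z\<close>. The position of a vertex in the restriction of \<open>ord i\<close> to \<open>Z i\<close>
  differs from its position in \<open>ord i\<close> by a constant, so the latter is compared directly.\<close>

definition block_dom_less ::
    "nat set \<Rightarrow> (nat \<Rightarrow> 'a \<Rightarrow> nat) \<Rightarrow> (nat set \<Rightarrow> (nat \<Rightarrow> 'a set) \<Rightarrow> nat \<Rightarrow> nat) \<Rightarrow>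
     (nat \<Rightarrow> 'a set) \<Rightarrow> (nat \<Rightarrow> 'a) \<Rightarrow> (nat \<Rightarrow> 'a) \<Rightarrow> bool" where
  "block_dom_less S ord \<pi> Z x y \<longleftrightarrow>
     dom_less (\<pi> S Z) (card S) (positions S ord x) (positions S ord y)"

definition domination_collection ::
    "nat \<Rightarrow> (nat \<Rightarrow> 'a ugraph) \<Rightarrow> (nat \<Rightarrow> 'a \<Rightarrow> nat) \<Rightarrow> (nat \<Rightarrow> 'a set set) \<Rightarrow>
     (nat set \<Rightarrow> (nat \<Rightarrow> 'a set) \<Rightarrow> nat \<Rightarrow> nat) \<Rightarrow> bool" where
  "domination_collection d G ord P \<pi> \<longleftrightarrow>
     (\<forall>S. S \<subseteq> {1..d} \<and> S \<noteq> {} \<longrightarrow>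
        (\<forall>Z\<in>(\<Pi>\<^sub>E i\<in>S. P i).
           \<pi> S Z permutes {1..card S} \<and>
           optimal_rel (induced_subgraph (prod_graph S G) (\<Pi>\<^sub>E i\<in>S. Z i))
             (block_dom_less S ord \<pi> Z))) \<and>
     (\<forall>S T. S \<subset> T \<and> T \<subseteq> {1..d} \<and> S \<noteq> {} \<longrightarrow>
        (\<forall>Z\<in>(\<Pi>\<^sub>E i\<in>T. P i).
           consistent T (\<Pi>\<^sub>E i\<in>T. Z i) (block_dom_less T ord \<pi> Z)
             S (block_dom_less S ord \<pi> (restrict Z S))))"

definition regular_domination_collection ::
    "nat \<Rightarrow> (nat \<Rightarrow> 'a ugraph) \<Rightarrow> (nat \<Rightarrow> 'a \<Rightarrow> nat) \<Rightarrow> (nat \<Rightarrow> 'a set set) \<Rightarrow>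
     (nat set \<Rightarrow> (nat \<Rightarrow> 'a set) \<Rightarrow> nat \<Rightarrow> nat) \<Rightarrow> bool" where
  "regular_domination_collection d G ord P \<pi> \<longleftrightarrow>
     domination_collection d G ord P \<pi> \<and>
     (\<forall>i\<in>{2..d - 1}. regular_partition (G i) (ord i) (P i)) \<and>
     \<pi> {2..d - 1} (\<lambda>i\<in>{2..d - 1}. first_part (ord i) (P i)) =
     \<pi> {2..d - 1} (\<lambda>i\<in>{2..d - 1}. last_part (G i) (ord i) (P i))"

definition block_of :: "nat set \<Rightarrow> (nat \<Rightarrow> 'a set set) \<Rightarrow> (nat \<Rightarrow> 'a) \<Rightarrow> nat \<Rightarrow> 'a set" where
  "block_of S P x = (\<lambda>i\<in>S. THE Z. Z \<in> P i \<and> x i \<in> Z)"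

definition block_start :: "nat set \<Rightarrow> (nat \<Rightarrow> 'a \<Rightarrow> nat) \<Rightarrow> (nat \<Rightarrow> 'a set) \<Rightarrow> nat \<Rightarrow> 'a" where
  "block_start S ord Z = (\<lambda>i\<in>S. start (ord i) (Z i))"

definition block_lex_less ::
    "nat set \<Rightarrow> (nat \<Rightarrow> 'a \<Rightarrow> nat) \<Rightarrow> (nat \<Rightarrow> 'a set set) \<Rightarrow>
     (nat set \<Rightarrow> (nat \<Rightarrow> 'a set) \<Rightarrow> nat \<Rightarrow> nat) \<Rightarrow> (nat \<Rightarrow> 'a) \<Rightarrow> (nat \<Rightarrow> 'a) \<Rightarrow> bool" where
  "block_lex_less S ord P \<pi> x y \<longleftrightarrow>
     (if block_of S P x = block_of S P y
      then block_dom_less S ord \<pi> (block_of S P x) x y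
      else lex_less (card S) (positions S ord (block_start S ord (block_of S P x)))
                             (positions S ord (block_start S ord (block_of S P y))))"

end

theory Submission
  imports Defs
begin

text \<open>
  Replace every vertex by its position, so that a product of graphs becomes a box of tuples of
  positions. By compression along single coordinates only down-sets of the box matter, and the number of
  edges induced by a down-set is the sum over its elements \<open>x\<close> of \<open>\<Sum>i. w i (x i)\<close>, where \<open>w i t\<close>
  counts the neighbours below the \<open>t\<close>-th vertex of \<open>G i\<close>.

  Optimality of the block-lexicographic order then follows by induction on the number of coordinates.
  Among the down-sets of given size and at least given weight take one, \<open>A\<close>, with minimal sum of
  ranks. By induction all its slices \<open>x i = v\<close> are initial segments, of sizes \<open>s v\<close>. If \<open>A\<close> is not an
  initial segment, choose \<open>b \<notin> A\<close> before \<open>a \<in> A\<close>. No element strictly between them can share one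
  coordinate with \<open>a\<close> and another with \<open>b\<close>; hence \<open>a i < b i\<close> in all coordinates but one. For a
  suitable \<open>i\<close> and a suitable initial segment \<open>K\<close> of the remaining coordinates, the slice at \<open>b i\<close> is
  a proper subset of \<open>K\<close> and the slice at \<open>a i\<close> a proper superset. The excess over \<open>K\<close> of a slice \<open>\<alpha>\<close>,
  added to a slice \<open>\<beta>\<close>, is again a down-set, so by induction moving the excess to where \<open>\<beta>\<close> ends does
  not lose weight as long as \<open>w i \<alpha> \<le> w i \<beta>\<close>, and it lowers the ranks. The comparison of \<open>w i\<close>
  comes from monotonicity inside a part; when the excess sits in the first part of \<open>G i\<close> and the
  deficit in the last one, regularity allows all the slices of the two parts to be paired instead.
\<close>

section \<open>Down-sets in boxes of positions\<close>

text \<open>The excess can be moved along coordinate \<open>i\<close> only where values of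
  \<open>w i\<close> can be compared, that is, inside one part and for \<open>i\<close> below
  \<open>d\<close>. So \<open>i\<close> has to avoid the largest index of \<open>S\<close> and the
  coordinate \<open>c\<close> that puts \<open>b\<close> before \<open>a\<close>, which takes three
  coordinates; a third coordinate is also what makes the moved excess a down-set. If
  \<open>c\<close> is the smallest index, the parts of \<open>a\<close> and \<open>b\<close> in
  coordinate \<open>i\<close> are unrelated; then \<open>i\<close> is taken strictly between the
  extreme indices, hence from 2 to \<open>d - 1\<close>, the range of the regularity assumption. A
  move may leave the weight unchanged, so progress is measured by the sum of ranks, which falls
  strictly. Slicing removes an arbitrary coordinate, so the induction ranges over all index sets
  \<open>S\<close>, with the pairs of factors as its base; consistency of the domination orders is
  what makes the order on a slice agree with that of the smaller product.\<close>

definition box :: "(nat \<Rightarrow> nat) \<Rightarrow> nat set \<Rightarrow> (nat \<Rightarrow> nat) set" where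
  "box n S = (\<Pi>\<^sub>E i\<in>S. {1..n i})"

definition down_set :: "(nat \<Rightarrow> nat) \<Rightarrow> nat set \<Rightarrow> (nat \<Rightarrow> nat) set \<Rightarrow> bool" where
  "down_set n S A \<longleftrightarrow> A \<subseteq> box n S \<and> (\<forall>x\<in>A. \<forall>y\<in>box n S. (\<forall>i\<in>S. y i \<le> x i) \<longrightarrow> y \<in> A)"

definition weight :: "(nat \<Rightarrow> nat \<Rightarrow> nat) \<Rightarrow> nat set \<Rightarrow> (nat \<Rightarrow> nat) \<Rightarrow> nat" where
  "weight w S x = (\<Sum>i\<in>S. w i (x i))"

text \<open>The fixed coordinate is dropped, so that the slices at different heights live in one box
  and can be compared as sets.\<close>

definition slice :: "(nat \<Rightarrow> nat) \<Rightarrow> nat set \<Rightarrow> nat \<Rightarrow> nat \<Rightarrow> (nat \<Rightarrow> nat) set \<Rightarrow> (nat \<Rightarrow> nat) set" where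
  "slice n S i v A = {z \<in> box n (S - {i}). z(i := v) \<in> A}"

lemma finite_box: "finite S \<Longrightarrow> finite (box n S)"
  unfolding box_def by (rule finite_PiE) auto

lemma box_upd: "z \<in> box n (S - {i}) \<Longrightarrow> i \<in> S \<Longrightarrow> v \<in> {1..n i} \<Longrightarrow> z(i := v) \<in> box n S"
  unfolding box_def PiE_iff extensional_def by auto

lemma box_upd_same: "x \<in> box n S \<Longrightarrow> i \<in> S \<Longrightarrow> v \<in> {1..n i} \<Longrightarrow> x(i := v) \<in> box n S"
  unfolding box_def PiE_iff extensional_def by auto

lemma box_restrict: "x \<in> box n S \<Longrightarrow> restrict x (S - {i}) \<in> box n (S - {i})"
  unfolding box_def PiE_iff by auto

lemma restrict_upd_box: "z \<in> box n (S - {i}) \<Longrightarrow> restrict (z(i := v)) (S - {i}) = z"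
  unfolding box_def PiE_iff extensional_def restrict_def by (auto simp: fun_eq_iff)

lemma restrict_box: "z \<in> box n S \<Longrightarrow> restrict z S = z"
  unfolding box_def by (rule PiE_restrict)

lemma upd_restrict_box: "x \<in> box n S \<Longrightarrow> i \<in> S \<Longrightarrow> (restrict x (S - {i}))(i := x i) = x"
  unfolding box_def PiE_iff extensional_def restrict_def by (auto simp: fun_eq_iff)

lemma box_coord: "x \<in> box n S \<Longrightarrow> i \<in> S \<Longrightarrow> x i \<in> {1..n i}"
  unfolding box_def by auto

lemma box_ext: "x \<in> box n S \<Longrightarrow> y \<in> box n S \<Longrightarrow> (\<And>i. i \<in> S \<Longrightarrow> x i = y i) \<Longrightarrow> x = y"
  unfolding box_def by (rule PiE_ext)

lemma down_setD: "down_set n S A \<Longrightarrow> x \<in> A \<Longrightarrow> y \<in> box n S \<Longrightarrow> (\<And>i. i \<in> S \<Longrightarrow> y i \<le> x i) \<Longrightarrow> y \<in> A"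
  unfolding down_set_def by blast

lemma down_set_subset: "down_set n S A \<Longrightarrow> A \<subseteq> box n S"
  unfolding down_set_def by blast

lemma slice_subset: "slice n S i v A \<subseteq> box n (S - {i})"
  unfolding slice_def by blast

lemma upd_inj_on_box: "inj_on (\<lambda>z. z(i := v)) (box n (S - {i}))"
  by (rule inj_on_inverseI[where g = "\<lambda>x. restrict x (S - {i})"]) (rule restrict_upd_box)

lemma down_set_slice:
  assumes "down_set n S A" "i \<in> S" "v \<in> {1..n i}"
  shows "down_set n (S - {i}) (slice n S i v A)"
  unfolding down_set_def
proof (intro conjI ballI impI)
  fix x y assume x: "x \<in> slice n S i v A" and y: "y \<in> box n (S - {i})" and le: "\<forall>j\<in>S - {i}. y j \<le> x j"
  have "x(i := v) \<in> A" using x by (simp add: slice_def)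
  moreover have "y(i := v) \<in> box n S" using box_upd[OF y assms(2,3)] .
  moreover have "(y(i := v)) j \<le> (x(i := v)) j" if "j \<in> S" for j using that le by auto
  ultimately have "y(i := v) \<in> A" by (rule down_setD[OF assms(1)])
  then show "y \<in> slice n S i v A" using y by (simp add: slice_def)
qed (rule slice_subset)

lemma slice_antimono:
  assumes "down_set n S A" "i \<in> S" "1 \<le> u" "u \<le> v" "v \<le> n i"
  shows "slice n S i v A \<subseteq> slice n S i u A"
proof
  fix z assume z: "z \<in> slice n S i v A"
  have "z(i := v) \<in> A" using z by (simp add: slice_def)
  moreover have "z(i := u) \<in> box n S" using z assms by (intro box_upd) (auto simp: slice_def)
  moreover have "(z(i := u)) j \<le> (z(i := v)) j" for j using assms by auto
  ultimately have "z(i := u) \<in> A" by (rule down_setD[OF assms(1)])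
  then show "z \<in> slice n S i u A" using z by (simp add: slice_def)
qed

lemma sum_slices:
  assumes "finite S" "A \<subseteq> box n S" "i \<in> S"
  shows "sum g A = (\<Sum>v\<in>{1..n i}. \<Sum>z\<in>slice n S i v A. g (z(i := v)))"
proof -
  have fA: "finite A" using assms finite_box finite_subset by blast
  have "sum g A = (\<Sum>v\<in>{1..n i}. sum g {x \<in> A. x i = v})"
    using sum.group[OF fA, of "{1..n i}" "\<lambda>x. x i" g] assms box_coord by fastforce
  also have "\<dots> = (\<Sum>v\<in>{1..n i}. \<Sum>z\<in>slice n S i v A. g (z(i := v)))"
  proof (rule sum.cong[OF refl])
    fix v assume v: "v \<in> {1..n i}"
    have "{x \<in> A. x i = v} = (\<lambda>z. z(i := v)) ` slice n S i v A"
    proof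
      show "{x \<in> A. x i = v} \<subseteq> (\<lambda>z. z(i := v)) ` slice n S i v A"
      proof
        fix x assume x: "x \<in> {x \<in> A. x i = v}"
        then have xb: "x \<in> box n S" using assms by auto
        have "(restrict x (S - {i}))(i := v) = x" using x upd_restrict_box[OF xb assms(3)] by auto
        moreover from this have "restrict x (S - {i}) \<in> slice n S i v A"
          using x box_restrict[OF xb] by (simp add: slice_def)
        ultimately show "x \<in> (\<lambda>z. z(i := v)) ` slice n S i v A"
          by (metis (no_types, lifting) image_eqI)
      qed
    qed (auto simp: slice_def)
    moreover have "inj_on (\<lambda>z. z(i := v)) (slice n S i v A)"
      by (rule inj_on_subset[OF upd_inj_on_box slice_subset])
    ultimately show "sum g {x \<in> A. x i = v} = (\<Sum>z\<in>slice n S i v A. g (z(i := v)))"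
      by (simp add: sum.reindex)
  qed
  finally show ?thesis .
qed

lemma card_slices:
  assumes "finite S" "A \<subseteq> box n S" "i \<in> S"
  shows "card A = (\<Sum>v\<in>{1..n i}. card (slice n S i v A))"
  using sum_slices[OF assms, of "\<lambda>_. 1::nat"] by simp

lemma slice_eqI:
  assumes "A \<subseteq> box n S" "B \<subseteq> box n S" "i \<in> S"
    and "\<And>v. v \<in> {1..n i} \<Longrightarrow> slice n S i v A = slice n S i v B"
  shows "A = B"
proof -
  have "x \<in> B" if "A \<subseteq> box n S" "x \<in> A" "\<And>v. v \<in> {1..n i} \<Longrightarrow> slice n S i v A = slice n S i v B" for A B x
  proof -
    have xb: "x \<in> box n S" using that by auto
    have "restrict x (S - {i}) \<in> slice n S i (x i) A"
      using that box_restrict[OF xb] upd_restrict_box[OF xb assms(3)] by (simp add: slice_def)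
    then have "restrict x (S - {i}) \<in> slice n S i (x i) B"
      using that(3) box_coord[OF xb assms(3)] by auto
    then show ?thesis using upd_restrict_box[OF xb assms(3)] by (simp add: slice_def)
  qed
  from this[of A _ B] this[of B _ A] show ?thesis using assms by blast
qed

lemma weight_upd:
  assumes "finite S" "i \<in> S"
  shows "weight w S (z(i := v)) = w i v + weight w (S - {i}) z"
  unfolding weight_def using assms by (subst sum.remove[of S i]) (auto intro!: sum.cong)

lemma sum_weight_slices:
  assumes "finite S" "A \<subseteq> box n S" "i \<in> S"
  shows "sum (weight w S) A =
    (\<Sum>v\<in>{1..n i}. w i v * card (slice n S i v A) + sum (weight w (S - {i})) (slice n S i v A))"
  by (simp add: sum_slices[OF assms] weight_upd[OF assms(1,3)] sum.distrib mult.commute)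

text \<open>The two differences have equal size, and the minimum of \<open>g\<close> on
  \<open>Y - X\<close> exceeds every value on \<open>X - Y\<close>. With ranks or coordinate sums
  for \<open>g\<close> this yields the strictly falling potential of each rearrangement
  below.\<close>

lemma sum_exchange:
  fixes g :: "'a \<Rightarrow> nat"
  assumes "finite X" "finite Y" "card X = card Y"
    and less: "\<And>x y. x \<in> X - Y \<Longrightarrow> y \<in> Y - X \<Longrightarrow> g x < g y"
  shows "sum g X \<le> sum g Y" "X \<noteq> Y \<Longrightarrow> sum g X < sum g Y"
proof -
  have X: "sum g X = sum g (X - Y) + sum g (X \<inter> Y)"
    using assms by (metis Int_Diff_disjoint Int_Diff_Un add.commute finite_Diff finite_Int sum.union_disjoint)
  have Y: "sum g Y = sum g (Y - X) + sum g (X \<inter> Y)"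
    using assms by (metis Int_Diff_disjoint Int_Diff_Un Int_commute add.commute finite_Diff finite_Int sum.union_disjoint)
  have c: "card (X - Y) = card (Y - X)"
    using assms by (metis Int_commute card_Diff_subset_Int finite_Int)
  have strict: "sum g (X - Y) < sum g (Y - X)" if "X \<noteq> Y"
  proof -
    have ne: "X - Y \<noteq> {}" "Y - X \<noteq> {}"
      using that c assms by (metis Diff_eq_empty_iff card_0_eq finite_Diff subset_antisym)+
    define m where "m = Min (g ` (Y - X))"
    have m: "m \<le> g y" if "y \<in> Y - X" for y using that assms by (simp add: m_def)
    have "m \<in> g ` (Y - X)" unfolding m_def using ne assms by (intro Min_in) auto
    then have lt: "g x < m" if "x \<in> X - Y" for x using less that by auto
    have "sum g (X - Y) < (\<Sum>x\<in>X - Y. m)" using ne lt assms by (intro sum_strict_mono) auto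
    also have "\<dots> = (\<Sum>y\<in>Y - X. m)" using c by simp
    also have "\<dots> \<le> sum g (Y - X)" using m by (intro sum_mono) auto
    finally show ?thesis .
  qed
  show "X \<noteq> Y \<Longrightarrow> sum g X < sum g Y" using X Y strict by simp
  then show "sum g X \<le> sum g Y" by (cases "X = Y") auto
qed

text \<open>\<open>p i t\<close> is the position of the first vertex of the part containing position \<open>t\<close> of \<open>G i\<close>, and
  \<open>rk S\<close> is the rank in the block-lexicographic order on the coordinates \<open>S\<close>. In \<open>w_regular\<close>, \<open>N\<close> is the
  common size of the first and the last part, which may coincide.\<close>

locale block_order =
  fixes d :: nat and n :: "nat \<Rightarrow> nat" and p w :: "nat \<Rightarrow> nat \<Rightarrow> nat"
    and rk :: "nat set \<Rightarrow> (nat \<Rightarrow> nat) \<Rightarrow> nat"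
  assumes p_mono: "\<And>i u v. i \<in> {1..d} \<Longrightarrow> 1 \<le> u \<Longrightarrow> u \<le> v \<Longrightarrow> v \<le> n i \<Longrightarrow> p i u \<le> p i v"
    and p_start: "\<And>i u. i \<in> {1..d} \<Longrightarrow> u \<in> {1..n i} \<Longrightarrow> p i u \<in> {1..u} \<and> p i (p i u) = p i u"
    and rk_bij: "\<And>S. S \<subseteq> {1..d} \<Longrightarrow> S \<noteq> {} \<Longrightarrow> bij_betw (rk S) (box n S) {1..card (box n S)}"
    and rk_mono: "\<And>S x y. S \<subseteq> {1..d} \<Longrightarrow> S \<noteq> {} \<Longrightarrow> x \<in> box n S \<Longrightarrow> y \<in> box n S \<Longrightarrow>
      (\<And>i. i \<in> S \<Longrightarrow> x i \<le> y i) \<Longrightarrow> rk S x \<le> rk S y"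
    and rk_restrict: "\<And>S i x y. S \<subseteq> {1..d} \<Longrightarrow> i \<in> S \<Longrightarrow> S - {i} \<noteq> {} \<Longrightarrow> x \<in> box n S \<Longrightarrow> y \<in> box n S \<Longrightarrow>
      x i = y i \<Longrightarrow> rk S x < rk S y \<Longrightarrow>
      rk (S - {i}) (restrict x (S - {i})) < rk (S - {i}) (restrict y (S - {i}))"
    and rk_lex: "\<And>S x y c. S \<subseteq> {1..d} \<Longrightarrow> x \<in> box n S \<Longrightarrow> y \<in> box n S \<Longrightarrow> c \<in> S \<Longrightarrow>
      p c (x c) < p c (y c) \<Longrightarrow> (\<And>i. i \<in> S \<Longrightarrow> i < c \<Longrightarrow> p i (x i) = p i (y i)) \<Longrightarrow> rk S x < rk S y"
    and rk_dom: "\<And>S x. S \<subseteq> {1..d} \<Longrightarrow> S \<noteq> {} \<Longrightarrow> x \<in> box n S \<Longrightarrow>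
      \<exists>c\<in>S. \<forall>y\<in>box n S. \<forall>z\<in>box n S.
        (\<forall>i\<in>S. p i (y i) = p i (x i) \<and> p i (z i) = p i (x i)) \<longrightarrow> y c < z c \<longrightarrow> rk S y < rk S z"
    and w_mono: "\<And>i u v. i \<in> {1..d - 1} \<Longrightarrow> 1 \<le> u \<Longrightarrow> u \<le> v \<Longrightarrow> v \<le> n i \<Longrightarrow> p i u = p i v \<Longrightarrow>
      w i u \<le> w i v"
    and w_regular: "\<And>i. i \<in> {2..d - 1} \<Longrightarrow> \<exists>N\<le>n i.
      (\<forall>v\<in>{1..n i}. (p i v = p i 1 \<longleftrightarrow> v \<le> N) \<and> (p i v = p i (n i) \<longleftrightarrow> n i - N < v)) \<and>
      (\<forall>l\<in>{1..N}. w i l \<le> w i (n i - N + l))"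
begin

section \<open>Initial segments, stacks of them, and compression of slices\<close>

definition seg :: "nat set \<Rightarrow> nat \<Rightarrow> (nat \<Rightarrow> nat) set" where
  "seg S k = {x \<in> box n S. rk S x \<le> k}"

text \<open>Optimality in the form carried through the induction: only down-sets compete, and edges
  are replaced by weights. \<open>optimal_rel_iff_opt\<close> relates it to the graphs.\<close>

definition opt :: "nat set \<Rightarrow> bool" where
  "opt S \<longleftrightarrow> (\<forall>A. down_set n S A \<longrightarrow> sum (weight w S) A \<le> sum (weight w S) (seg S (card A)))"

text \<open>A set all of whose slices along \<open>i\<close> are initial segments is determined by
  their sizes. \<open>stack\<close> rebuilds it from the sizes, so modifying such a set becomes
  arithmetic on \<open>s\<close>.\<close>

definition stack :: "nat set \<Rightarrow> nat \<Rightarrow> (nat \<Rightarrow> nat) \<Rightarrow> (nat \<Rightarrow> nat) set" where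
  "stack S i s = {x \<in> box n S. rk (S - {i}) (restrict x (S - {i})) \<le> s (x i)}"

lemma finite_index: "S \<subseteq> {1..d} \<Longrightarrow> finite S"
  using finite_subset by blast

lemma rk_inj: "S \<subseteq> {1..d} \<Longrightarrow> S \<noteq> {} \<Longrightarrow> x \<in> box n S \<Longrightarrow> y \<in> box n S \<Longrightarrow> rk S x = rk S y \<Longrightarrow> x = y"
  using rk_bij bij_betw_imp_inj_on inj_on_def by metis

text \<open>The converse of \<open>rk_restrict\<close> comes for free, because ranks are injective
  and therefore any two distinct tuples are comparable.\<close>

lemma rk_restrict_iff:
  assumes "S \<subseteq> {1..d}" "i \<in> S" "S - {i} \<noteq> {}" "x \<in> box n S" "y \<in> box n S" "x i = y i"
  shows "rk S x < rk S y \<longleftrightarrow>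
    rk (S - {i}) (restrict x (S - {i})) < rk (S - {i}) (restrict y (S - {i}))"
proof
  assume r: "rk (S - {i}) (restrict x (S - {i})) < rk (S - {i}) (restrict y (S - {i}))"
  show "rk S x < rk S y"
  proof (rule ccontr)
    assume "\<not> rk S x < rk S y"
    then consider "rk S y < rk S x" | "rk S x = rk S y" by linarith
    then show False
    proof cases
      case 1
      then show ?thesis using rk_restrict[of S i y x] assms r by auto
    next
      case 2
      then show ?thesis using rk_inj[of S x y] assms r by auto
    qed
  qed
qed (use rk_restrict assms in blast)

lemma rk_upd_iff:
  assumes "S \<subseteq> {1..d}" "i \<in> S" "S - {i} \<noteq> {}" "y \<in> box n (S - {i})" "z \<in> box n (S - {i})" "v \<in> {1..n i}"
  shows "rk S (y(i := v)) < rk S (z(i := v)) \<longleftrightarrow> rk (S - {i}) y < rk (S - {i}) z"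
  using rk_restrict_iff[of S i "y(i := v)" "z(i := v)"] assms
  by (simp add: box_upd restrict_upd_box restrict_box)

lemma rk_range: "S \<subseteq> {1..d} \<Longrightarrow> S \<noteq> {} \<Longrightarrow> x \<in> box n S \<Longrightarrow> rk S x \<in> {1..card (box n S)}"
  using rk_bij bij_betwE by blast

lemma seg_subset: "seg S k \<subseteq> box n S"
  unfolding seg_def by blast

lemma seg_card_le: "S \<subseteq> {1..d} \<Longrightarrow> S \<noteq> {} \<Longrightarrow> k \<le> card (box n S) \<Longrightarrow> card (seg S k) = k"
proof -
  assume S: "S \<subseteq> {1..d}" "S \<noteq> {}" "k \<le> card (box n S)"
  have "bij_betw (rk S) (seg S k) {1..k}"
    unfolding bij_betw_def
  proof
    show "inj_on (rk S) (seg S k)" using rk_inj[OF S(1,2)] by (auto simp: inj_on_def seg_def)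
    show "rk S ` seg S k = {1..k}"
    proof
      show "rk S ` seg S k \<subseteq> {1..k}" using rk_range[OF S(1,2)] by (auto simp: seg_def)
      show "{1..k} \<subseteq> rk S ` seg S k"
      proof
        fix j assume j: "j \<in> {1..k}"
        then have "j \<in> rk S ` box n S" using rk_bij[OF S(1,2)] S(3) by (auto simp: bij_betw_def)
        then show "j \<in> rk S ` seg S k" using j by (auto simp: seg_def)
      qed
    qed
  qed
  then show ?thesis using bij_betw_same_card by fastforce
qed

lemma seg_mono: "k \<le> l \<Longrightarrow> seg S k \<subseteq> seg S l"
  unfolding seg_def by auto

lemma down_set_seg: "S \<subseteq> {1..d} \<Longrightarrow> S \<noteq> {} \<Longrightarrow> down_set n S (seg S k)"
  unfolding down_set_def seg_def using rk_mono order_trans by blast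

lemma stack_subset: "stack S i s \<subseteq> box n S"
  unfolding stack_def by blast

lemma slice_stack:
  assumes "i \<in> S" "v \<in> {1..n i}"
  shows "slice n S i v (stack S i s) = seg (S - {i}) (s v)"
  using assms unfolding slice_def stack_def seg_def
  by (auto simp: box_upd restrict_upd_box restrict_box)

lemma down_set_stack:
  assumes S: "S \<subseteq> {1..d}" "i \<in> S" "S - {i} \<noteq> {}"
    and s: "\<And>u v. 1 \<le> u \<Longrightarrow> u \<le> v \<Longrightarrow> v \<le> n i \<Longrightarrow> s v \<le> s u"
  shows "down_set n S (stack S i s)"
  unfolding down_set_def
proof (intro conjI ballI impI)
  fix x y assume x: "x \<in> stack S i s" and y: "y \<in> box n S" and le: "\<forall>j\<in>S. y j \<le> x j"
  have xb: "x \<in> box n S" using x by (simp add: stack_def)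
  have "rk (S - {i}) (restrict y (S - {i})) \<le> rk (S - {i}) (restrict x (S - {i}))"
    using S le by (intro rk_mono) (auto intro: box_restrict xb y)
  also have "\<dots> \<le> s (x i)" using x by (simp add: stack_def)
  also have "\<dots> \<le> s (y i)" using box_coord[OF y S(2)] box_coord[OF xb S(2)] le S(2) by (intro s) auto
  finally show "y \<in> stack S i s" using y by (simp add: stack_def)
qed (rule stack_subset)

lemma card_stack:
  assumes S: "S \<subseteq> {1..d}" "i \<in> S" "S - {i} \<noteq> {}"
    and s: "\<And>v. v \<in> {1..n i} \<Longrightarrow> s v \<le> card (box n (S - {i}))"
  shows "card (stack S i s) = (\<Sum>v\<in>{1..n i}. s v)"
proof -
  have "card (stack S i s) = (\<Sum>v\<in>{1..n i}. card (slice n S i v (stack S i s)))"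
    using S finite_index stack_subset by (intro card_slices) auto
  also have "\<dots> = (\<Sum>v\<in>{1..n i}. s v)"
    using S s by (intro sum.cong) (auto simp: slice_stack intro!: seg_card_le)
  finally show ?thesis .
qed

lemma sum_weight_stack:
  assumes S: "S \<subseteq> {1..d}" "i \<in> S" "S - {i} \<noteq> {}"
    and s: "\<And>v. v \<in> {1..n i} \<Longrightarrow> s v \<le> card (box n (S - {i}))"
  shows "sum (weight w S) (stack S i s) =
    (\<Sum>v\<in>{1..n i}. w i v * s v + sum (weight w (S - {i})) (seg (S - {i}) (s v)))"
proof -
  have "sum (weight w S) (stack S i s) = (\<Sum>v\<in>{1..n i}. w i v * card (slice n S i v (stack S i s))
      + sum (weight w (S - {i})) (slice n S i v (stack S i s)))"
    using S finite_index stack_subset by (intro sum_weight_slices) auto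
  also have "\<dots> = (\<Sum>v\<in>{1..n i}. w i v * s v + sum (weight w (S - {i})) (seg (S - {i}) (s v)))"
  proof (rule sum.cong[OF refl])
    fix v assume v: "v \<in> {1..n i}"
    have "card (seg (S - {i}) (s v)) = s v" using S s v by (intro seg_card_le) auto
    then show "w i v * card (slice n S i v (stack S i s))
      + sum (weight w (S - {i})) (slice n S i v (stack S i s))
      = w i v * s v + sum (weight w (S - {i})) (seg (S - {i}) (s v))"
      using v S by (simp add: slice_stack)
  qed
  finally show ?thesis .
qed

text \<open>Slices of a down-set shrink as the height grows, so the initial segments of the same
  sizes are nested and stack to a down-set. Each slice is itself a down-set and loses no weight by
  \<open>opt (S - {i})\<close>. Inside a slice elements are replaced by earlier ones, and
  \<open>rk_upd_iff\<close> carries this over to the ranks in \<open>S\<close>.\<close>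

lemma compression:
  assumes S: "S \<subseteq> {1..d}" "i \<in> S" "S - {i} \<noteq> {}"
    and o: "opt (S - {i})" and A: "down_set n S A"
  defines "B \<equiv> stack S i (\<lambda>v. card (slice n S i v A))"
  shows "down_set n S B" "card B = card A" "sum (weight w S) A \<le> sum (weight w S) B"
    "B \<noteq> A \<Longrightarrow> sum (rk S) B < sum (rk S) A"
proof -
  have fin: "finite S" "finite (S - {i})" using S finite_index by auto
  have fb: "finite (box n (S - {i}))" using fin finite_box by auto
  have AS: "A \<subseteq> box n S" using A down_set_subset by auto
  have BS: "B \<subseteq> box n S" using B_def stack_subset by auto
  have sl_le: "card (slice n S i v A) \<le> card (box n (S - {i}))" for v
    by (rule card_mono[OF fb slice_subset])
  have slB: "slice n S i v B = seg (S - {i}) (card (slice n S i v A))" if "v \<in> {1..n i}" for v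
    using that S slice_stack by (simp add: B_def)
  have cB: "card (slice n S i v B) = card (slice n S i v A)" if "v \<in> {1..n i}" for v
    using that S sl_le by (simp only: slB) (intro seg_card_le, auto)
  have fsl: "finite (slice n S i v X)" for v X by (rule finite_subset[OF slice_subset fb])
  show "down_set n S B" unfolding B_def
    using S slice_antimono[OF A S(2)] fsl by (intro down_set_stack) (auto intro!: card_mono simp: subset_iff)
  show "card B = card A"
    using card_slices[OF fin(1) AS S(2)] card_slices[OF fin(1) BS S(2)] cB by simp
  have "sum (weight w S) A = (\<Sum>v\<in>{1..n i}. w i v * card (slice n S i v A)
      + sum (weight w (S - {i})) (slice n S i v A))"
    by (rule sum_weight_slices[OF fin(1) AS S(2)])
  also have "\<dots> \<le> (\<Sum>v\<in>{1..n i}. w i v * card (slice n S i v B)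
      + sum (weight w (S - {i})) (slice n S i v B))"
  proof (rule sum_mono)
    fix v assume v: "v \<in> {1..n i}"
    have "down_set n (S - {i}) (slice n S i v A)" using down_set_slice[OF A S(2) v] .
    then have "sum (weight w (S - {i})) (slice n S i v A) \<le> sum (weight w (S - {i})) (slice n S i v B)"
      using o v slB unfolding opt_def by simp
    then show "w i v * card (slice n S i v A) + sum (weight w (S - {i})) (slice n S i v A)
      \<le> w i v * card (slice n S i v B) + sum (weight w (S - {i})) (slice n S i v B)"
      using cB v by simp
  qed
  also have "\<dots> = sum (weight w S) B" by (rule sum_weight_slices[OF fin(1) BS S(2), symmetric])
  finally show "sum (weight w S) A \<le> sum (weight w S) B" .
  let ?r = "\<lambda>v X. \<Sum>z\<in>slice n S i v X. rk S (z(i := v))"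
  have ex: "?r v B \<le> ?r v A" "slice n S i v B \<noteq> slice n S i v A \<Longrightarrow> ?r v B < ?r v A"
    if v: "v \<in> {1..n i}" for v
  proof -
    have lt: "rk S (x(i := v)) < rk S (y(i := v))"
      if x: "x \<in> slice n S i v B - slice n S i v A" and y: "y \<in> slice n S i v A - slice n S i v B" for x y
    proof -
      have "x \<in> box n (S - {i})" "y \<in> box n (S - {i})" using x y by (auto simp: slice_def)
      moreover have "rk (S - {i}) x < rk (S - {i}) y"
        using x y calculation by (auto simp: slB[OF v] seg_def)
      ultimately show ?thesis using rk_upd_iff S v by blast
    qed
    show "?r v B \<le> ?r v A"
      using sum_exchange(1)[of "slice n S i v B" "slice n S i v A" "\<lambda>z. rk S (z(i := v))"] fsl cB[OF v] lt by blast
    show "slice n S i v B \<noteq> slice n S i v A \<Longrightarrow> ?r v B < ?r v A"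
      using sum_exchange(2)[of "slice n S i v B" "slice n S i v A" "\<lambda>z. rk S (z(i := v))"] fsl cB[OF v] lt by blast
  qed
  show "sum (rk S) B < sum (rk S) A" if "B \<noteq> A"
  proof -
    have "\<not> (\<forall>v\<in>{1..n i}. slice n S i v B = slice n S i v A)"
      using that slice_eqI[OF BS AS S(2)] by auto
    then obtain v where v: "v \<in> {1..n i}" "slice n S i v B \<noteq> slice n S i v A"
      by blast
    show ?thesis
      unfolding sum_slices[OF fin(1) AS S(2)] sum_slices[OF fin(1) BS S(2)]
      by (rule sum_strict_mono_ex1) (use ex(1) ex(2)[OF v] v(1) in auto)
  qed
qed

text \<open>Slice \<open>\<alpha> + l\<close> contains and slice \<open>\<beta> + l\<close> is contained in the initial segment of size \<open>k\<close>. With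
  \<open>m = s (\<alpha> + l) + s (\<beta> + l) - k\<close> their sizes become \<open>max k m\<close> and \<open>min k m\<close>. The premise \<open>closed\<close> says
  that slice \<open>\<beta> + l\<close> together with the excess of slice \<open>\<alpha> + l\<close> is a down-set.\<close>

lemma exchange:
  assumes S: "S \<subseteq> {1..d}" "i \<in> S" "S - {i} \<noteq> {}"
    and o: "opt (S - {i})"
    and s: "\<And>u v. 1 \<le> u \<Longrightarrow> u \<le> v \<Longrightarrow> v \<le> n i \<Longrightarrow> s v \<le> s u"
    and s_le: "\<And>v. v \<in> {1..n i} \<Longrightarrow> s v \<le> card (box n (S - {i}))"
    and ranges: "\<alpha> + N \<le> \<beta>" "\<beta> + N \<le> n i"
    and high: "\<And>v. v \<in> {1..\<beta>} \<Longrightarrow> k \<le> s v"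
    and low: "\<And>v. v \<in> {\<alpha> + N + 1..n i} \<Longrightarrow> s v \<le> k"
    and ww: "\<And>l. l \<in> {1..N} \<Longrightarrow> w i (\<alpha> + l) \<le> w i (\<beta> + l)"
    and closed: "\<And>l x z. l \<in> {1..N} \<Longrightarrow> x \<in> box n (S - {i}) \<Longrightarrow> z \<in> box n (S - {i}) \<Longrightarrow>
       rk (S - {i}) x \<le> k \<Longrightarrow> k < rk (S - {i}) z \<Longrightarrow> rk (S - {i}) z \<le> s (\<alpha> + l) \<Longrightarrow>
       (\<And>j. j \<in> S - {i} \<Longrightarrow> x j \<le> z j) \<Longrightarrow> rk (S - {i}) x \<le> s (\<beta> + l)"
    and less: "\<And>l m x z. l \<in> {1..N} \<Longrightarrow> m \<in> {1..N} \<Longrightarrow> x \<in> box n (S - {i}) \<Longrightarrow> z \<in> box n (S - {i}) \<Longrightarrow>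
       rk (S - {i}) x \<le> k \<Longrightarrow> k < rk (S - {i}) z \<Longrightarrow> rk S (x(i := \<beta> + l)) < rk S (z(i := \<alpha> + m))"
    and strict: "e \<in> {1..N}" "s (\<beta> + e) < k" "k < s (\<alpha> + e)"
  shows "\<exists>B. down_set n S B \<and> card B = card (stack S i s) \<and>
    sum (weight w S) (stack S i s) \<le> sum (weight w S) B \<and> sum (rk S) B < sum (rk S) (stack S i s)"
proof -
  let ?T = "S - {i}"
  let ?F = "\<lambda>m. sum (weight w ?T) (seg ?T m)"
  have T: "?T \<subseteq> {1..d}" "finite ?T" "?T \<noteq> {}" "finite S" using S finite_index by auto
  have fb: "finite (box n ?T)" using T finite_box by auto
  have fseg: "finite (seg ?T m)" for m by (rule finite_subset[OF seg_subset fb])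
  define c where "c = \<beta> - \<alpha>"
  have c: "\<alpha> + l + c = \<beta> + l" "\<beta> + l - c = \<alpha> + l" for l using ranges by (auto simp: c_def)
  \<comment> \<open>Moving the excess would leave the sizes \<open>k\<close> and \<open>m\<close>.
    If \<open>m\<close> exceeds \<open>k\<close>, the two sizes are swapped as well: the sum over
    the pair is the same, and the lower slice remains the larger one.\<close>
  define s' where "s' v = (if v \<in> {\<alpha> + 1..\<alpha> + N} then max k (s v + s (v + c) - k)
     else if v \<in> {\<beta> + 1..\<beta> + N} then min k (s (v - c) + s v - k) else s v)" for v
  have sa: "k \<le> s (\<alpha> + l)" "s (\<beta> + l) \<le> k" if "l \<in> {1..N}" for l
    using that ranges high[of "\<alpha> + l"] low[of "\<beta> + l"] by auto
  have s'_a: "s' (\<alpha> + l) = max k (s (\<alpha> + l) + s (\<beta> + l) - k)" if "l \<in> {1..N}" for l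
    using that by (simp add: s'_def c(1))
  have s'_b: "s' (\<beta> + l) = min k (s (\<alpha> + l) + s (\<beta> + l) - k)" if "l \<in> {1..N}" for l
    using that ranges by (simp add: s'_def c(2))
  have s'_rest: "s' v = s v" if "v \<notin> {\<alpha> + 1..\<alpha> + N}" "v \<notin> {\<beta> + 1..\<beta> + N}" for v
    using that by (auto simp: s'_def)
  have rng_a: "\<exists>l\<in>{1..N}. v = \<alpha> + l" if "v \<in> {\<alpha> + 1..\<alpha> + N}" for v
    using that by (intro bexI[of _ "v - \<alpha>"]) auto
  have rng_b: "\<exists>l\<in>{1..N}. v = \<beta> + l" if "v \<in> {\<beta> + 1..\<beta> + N}" for v
    using that by (intro bexI[of _ "v - \<beta>"]) auto
  have bd_a: "k \<le> s' v \<and> s' v \<le> s v" if "v \<in> {\<alpha> + 1..\<alpha> + N}" for v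
    using rng_a[OF that] s'_a sa by fastforce
  have bd_b: "s v \<le> s' v \<and> s' v \<le> k" if "v \<in> {\<beta> + 1..\<beta> + N}" for v
    using rng_b[OF that] s'_b sa by fastforce
  have k_le: "k \<le> card (box n ?T)"
    using strict(1,3) s_le[of "\<alpha> + e"] ranges by auto
  \<comment> \<open>With both heights in one range, both terms defining \<open>s'\<close> are
    antimonotone. Otherwise it is enough that \<open>s'\<close> lies between \<open>k\<close> and
    \<open>s\<close> on the \<alpha> range, between \<open>s\<close> and \<open>k\<close> on the
    \<beta> range, and equals \<open>s\<close> elsewhere.\<close>
  have s'_anti: "s' v \<le> s' u" if uv: "1 \<le> u" "u \<le> v" "v \<le> n i" for u v
  proof (cases "u \<in> {\<alpha> + 1..\<alpha> + N}")
    case ua: True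
    show ?thesis
    proof (cases "v \<in> {\<alpha> + 1..\<alpha> + N}")
      case True
      have "s v \<le> s u" "s (v + c) \<le> s (u + c)"
        using uv s[of u v] s[of "u + c" "v + c"] True ranges by (auto simp: c_def)
      then show ?thesis using ua True by (auto simp: s'_def)
    next
      case False
      then have "s' v \<le> k"
        using bd_b[of v] low[of v] s'_rest[of v] ua uv by (cases "v \<in> {\<beta> + 1..\<beta> + N}") auto
      then show ?thesis using bd_a[OF ua] by simp
    qed
  next
    case ua: False
    show ?thesis
    proof (cases "v \<in> {\<alpha> + 1..\<alpha> + N}")
      case True
      then have "s' u = s u" using ua uv ranges by (intro s'_rest) auto
      then show ?thesis using bd_a[OF True] s[of u v] uv by simp
    next
      case va: False
      show ?thesis
      proof (cases "v \<in> {\<beta> + 1..\<beta> + N}")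
        case vb: True
        show ?thesis
        proof (cases "u \<in> {\<beta> + 1..\<beta> + N}")
          case True
          have "s v \<le> s u" "s (v - c) \<le> s (u - c)"
            using uv s[of u v] s[of "u - c" "v - c"] True vb ranges by (auto simp: c_def)
          then show ?thesis using ua va True vb by (auto simp: s'_def)
        next
          case False
          then have "s' u = s u" "k \<le> s u"
            using ua uv vb by (auto intro!: s'_rest high)
          then show ?thesis using bd_b[OF vb] by simp
        qed
      next
        case False
        then have "s' v = s v" using va by (intro s'_rest)
        moreover have "s u \<le> s' u" using bd_b[of u] s'_rest[OF ua] by (cases "u \<in> {\<beta> + 1..\<beta> + N}") auto
        ultimately show ?thesis using s[of u v] uv by simp
      qed
    qed
  qed
  have s'_le: "s' v \<le> card (box n ?T)" if "v \<in> {1..n i}" for v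
    using bd_a[of v] bd_b[of v] s'_rest[of v] s_le[OF that] k_le
    by (cases "v \<in> {\<alpha> + 1..\<alpha> + N}"; cases "v \<in> {\<beta> + 1..\<beta> + N}") auto
  have pair_sum: "(\<Sum>v\<in>{1..n i}. g v) =
      (\<Sum>v\<in>{1..n i} - ({\<alpha> + 1..\<alpha> + N} \<union> {\<beta> + 1..\<beta> + N}). g v) + (\<Sum>l\<in>{1..N}. g (\<alpha> + l) + g (\<beta> + l))"
    for g :: "nat \<Rightarrow> nat"
  proof -
    have sub: "{\<alpha> + 1..\<alpha> + N} \<union> {\<beta> + 1..\<beta> + N} \<subseteq> {1..n i}" using ranges by auto
    have "(\<Sum>v\<in>{\<alpha> + 1..\<alpha> + N} \<union> {\<beta> + 1..\<beta> + N}. g v) =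
        (\<Sum>v\<in>{\<alpha> + 1..\<alpha> + N}. g v) + (\<Sum>v\<in>{\<beta> + 1..\<beta> + N}. g v)"
      using ranges by (intro sum.union_disjoint) auto
    also have "(\<Sum>v\<in>{\<alpha> + 1..\<alpha> + N}. g v) = (\<Sum>l\<in>{1..N}. g (\<alpha> + l))"
      using sum.shift_bounds_cl_nat_ivl[of g 1 \<alpha> N] by (simp add: add.commute)
    also have "(\<Sum>v\<in>{\<beta> + 1..\<beta> + N}. g v) = (\<Sum>l\<in>{1..N}. g (\<beta> + l))"
      using sum.shift_bounds_cl_nat_ivl[of g 1 \<beta> N] by (simp add: add.commute)
    finally show ?thesis using sum.subset_diff[OF sub, of g] by (simp add: sum.distrib)
  qed
  have F_ineq: "?F (s (\<alpha> + l)) + ?F (s (\<beta> + l)) \<le> ?F k + ?F (s (\<alpha> + l) + s (\<beta> + l) - k)"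
    if l: "l \<in> {1..N}" for l
  proof -
    \<comment> \<open>Slice \<open>\<beta> + l\<close> with the excess of slice
      \<open>\<alpha> + l\<close> added. The union is disjoint and has \<open>m\<close> elements.
      Below an element of the excess, tuples of rank above \<open>k\<close> are again in the excess,
      and those of rank at most \<open>k\<close> are caught by \<open>closed\<close>.\<close>
    let ?D = "seg ?T (s (\<beta> + l)) \<union> (seg ?T (s (\<alpha> + l)) - seg ?T k)"
    have disj: "seg ?T (s (\<beta> + l)) \<inter> (seg ?T (s (\<alpha> + l)) - seg ?T k) = {}"
      using seg_mono[OF sa(2)[OF l]] by auto
    have sub: "seg ?T k \<subseteq> seg ?T (s (\<alpha> + l))" using seg_mono[OF sa(1)[OF l]] .
    have ab: "\<alpha> + l \<in> {1..n i}" "\<beta> + l \<in> {1..n i}" using l ranges by auto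
    have cseg: "card (seg ?T m) = m" if "m \<le> card (box n ?T)" for m
      using seg_card_le T that by blast
    have "card ?D = s (\<beta> + l) + (s (\<alpha> + l) - k)"
      using disj sub fseg cseg s_le[OF ab(1)] s_le[OF ab(2)] k_le
      by (simp add: card_Un_disjoint card_Diff_subset)
    then have cD: "card ?D = s (\<alpha> + l) + s (\<beta> + l) - k" using sa[OF l] by simp
    have dD: "down_set n ?T ?D"
      unfolding down_set_def
    proof (intro conjI ballI impI)
      show "?D \<subseteq> box n ?T" using seg_subset by blast
      fix z x assume z: "z \<in> ?D" and x: "x \<in> box n ?T" and le: "\<forall>j\<in>?T. x j \<le> z j"
      have zb: "z \<in> box n ?T" using z by (auto simp: seg_def)
      have r: "rk ?T x \<le> rk ?T z" using rk_mono[OF T(1,3) x zb] le by auto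
      show "x \<in> ?D"
      proof (cases "z \<in> seg ?T (s (\<beta> + l))")
        case True
        then show ?thesis using x r by (auto simp: seg_def)
      next
        case False
        then have z': "k < rk ?T z" "rk ?T z \<le> s (\<alpha> + l)" using z by (auto simp: seg_def)
        show ?thesis
        proof (cases "rk ?T x \<le> k")
          case True
          then have "rk ?T x \<le> s (\<beta> + l)" using closed[OF l x zb True z'] le by auto
          then show ?thesis using x by (simp add: seg_def)
        next
          case False
          then show ?thesis using x r z' by (auto simp: seg_def)
        qed
      qed
    qed
    have "sum (weight w ?T) ?D \<le> ?F (card ?D)" using o dD unfolding opt_def by blast
    moreover have "sum (weight w ?T) ?D = ?F (s (\<beta> + l)) + sum (weight w ?T) (seg ?T (s (\<alpha> + l)) - seg ?T k)"
      using disj fseg by (intro sum.union_disjoint) auto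
    moreover have "?F (s (\<alpha> + l)) = sum (weight w ?T) (seg ?T (s (\<alpha> + l)) - seg ?T k) + ?F k"
      using sum.subset_diff[OF sub fseg] .
    ultimately show ?thesis using cD by simp
  qed
  let ?A = "stack S i s" and ?B = "stack S i s'"
  have fA: "finite ?A" "finite ?B"
    using finite_subset[OF stack_subset finite_box[OF T(4)]] by auto
  have sums: "s' (\<alpha> + l) + s' (\<beta> + l) = s (\<alpha> + l) + s (\<beta> + l)" if "l \<in> {1..N}" for l
    using s'_a[OF that] s'_b[OF that] sa[OF that] by (simp add: max_def min_def)
  have rest: "(\<Sum>v\<in>{1..n i} - ({\<alpha> + 1..\<alpha> + N} \<union> {\<beta> + 1..\<beta> + N}). g v (s' v)) =
     (\<Sum>v\<in>{1..n i} - ({\<alpha> + 1..\<alpha> + N} \<union> {\<beta> + 1..\<beta> + N}). g v (s v))" for g :: "nat \<Rightarrow> nat \<Rightarrow> nat"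
    using s'_rest by (intro sum.cong) auto
  have dB: "down_set n S ?B" using down_set_stack[OF S s'_anti] .
  have cB: "card ?B = card ?A"
  proof -
    have "card ?B = (\<Sum>v\<in>{1..n i}. s' v)" by (rule card_stack[OF S]) (rule s'_le)
    also have "\<dots> = (\<Sum>v\<in>{1..n i}. s v)"
      unfolding pair_sum[of s] pair_sum[of s'] using sums rest[of "\<lambda>_ m. m"] by simp
    also have "\<dots> = card ?A" by (rule card_stack[OF S, symmetric]) (rule s_le)
    finally show ?thesis .
  qed
  have wst: "sum (weight w S) ?A = (\<Sum>v\<in>{1..n i}. w i v * s v + ?F (s v))"
    "sum (weight w S) ?B = (\<Sum>v\<in>{1..n i}. w i v * s' v + ?F (s' v))"
    by (rule sum_weight_stack[OF S], erule s_le) (rule sum_weight_stack[OF S], erule s'_le)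
  have wB: "sum (weight w S) ?A \<le> sum (weight w S) ?B"
    unfolding wst pair_sum[of "\<lambda>v. w i v * s v + ?F (s v)"] pair_sum[of "\<lambda>v. w i v * s' v + ?F (s' v)"]
  proof (rule add_mono)
    show "(\<Sum>v\<in>{1..n i} - ({\<alpha> + 1..\<alpha> + N} \<union> {\<beta> + 1..\<beta> + N}). w i v * s v + ?F (s v)) \<le>
      (\<Sum>v\<in>{1..n i} - ({\<alpha> + 1..\<alpha> + N} \<union> {\<beta> + 1..\<beta> + N}). w i v * s' v + ?F (s' v))"
      using rest[of "\<lambda>v m. w i v * m + ?F m"] by simp
    show "(\<Sum>l\<in>{1..N}. w i (\<alpha> + l) * s (\<alpha> + l) + ?F (s (\<alpha> + l)) + (w i (\<beta> + l) * s (\<beta> + l) + ?F (s (\<beta> + l)))) \<le>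
      (\<Sum>l\<in>{1..N}. w i (\<alpha> + l) * s' (\<alpha> + l) + ?F (s' (\<alpha> + l)) + (w i (\<beta> + l) * s' (\<beta> + l) + ?F (s' (\<beta> + l))))"
    proof (rule sum_mono)
      fix l assume l: "l \<in> {1..N}"
      have "?F (s' (\<alpha> + l)) + ?F (s' (\<beta> + l)) = ?F k + ?F (s (\<alpha> + l) + s (\<beta> + l) - k)"
        using s'_a[OF l] s'_b[OF l] by (cases "k \<le> s (\<alpha> + l) + s (\<beta> + l) - k") (auto simp: max_def min_def)
      then have F: "?F (s (\<alpha> + l)) + ?F (s (\<beta> + l)) \<le> ?F (s' (\<alpha> + l)) + ?F (s' (\<beta> + l))"
        using F_ineq[OF l] by simp
      \<comment> \<open>Let \<open>q\<close> be the decrease at \<open>\<alpha> + l\<close>, which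
        is the increase at \<open>\<beta> + l\<close>. The contribution of coordinate
        \<open>i\<close> changes by \<open>q\<close> times the difference of the two values of
        \<open>w i\<close>, which \<open>ww\<close> makes nonnegative.\<close>
      have "s' (\<alpha> + l) \<le> s (\<alpha> + l)" using bd_a[of "\<alpha> + l"] l by auto
      then obtain q where q1: "s (\<alpha> + l) = s' (\<alpha> + l) + q" using le_Suc_ex by blast
      have q: "s (\<alpha> + l) = s' (\<alpha> + l) + q" "s' (\<beta> + l) = s (\<beta> + l) + q"
        using q1 sums[OF l] by linarith+
      have "w i (\<alpha> + l) * q \<le> w i (\<beta> + l) * q" using ww[OF l] by simp
      then have "w i (\<alpha> + l) * s (\<alpha> + l) + w i (\<beta> + l) * s (\<beta> + l) \<le>
          w i (\<alpha> + l) * s' (\<alpha> + l) + w i (\<beta> + l) * s' (\<beta> + l)"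
        by (simp add: q algebra_simps)
      then show "w i (\<alpha> + l) * s (\<alpha> + l) + ?F (s (\<alpha> + l)) + (w i (\<beta> + l) * s (\<beta> + l) + ?F (s (\<beta> + l)))
        \<le> w i (\<alpha> + l) * s' (\<alpha> + l) + ?F (s' (\<alpha> + l)) + (w i (\<beta> + l) * s' (\<beta> + l) + ?F (s' (\<beta> + l)))"
        using F by linarith
    qed
  qed
  \<comment> \<open>Elements are gained only in the \<beta> range, with rank at most
    \<open>k\<close>, and lost only in the \<alpha> range, with rank above \<open>k\<close>. The
    premise \<open>less\<close> covers every such combination, not only matching pairs.\<close>
  have lt: "rk S x < rk S y" if x: "x \<in> ?B - ?A" and y: "y \<in> ?A - ?B" for x y
  proof -
    have xb: "x \<in> box n S" "y \<in> box n S" using x y by (auto simp: stack_def)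
    have xr: "s (x i) < rk ?T (restrict x ?T)" "rk ?T (restrict x ?T) \<le> s' (x i)"
      using x xb by (auto simp: stack_def)
    have yr: "s' (y i) < rk ?T (restrict y ?T)" "rk ?T (restrict y ?T) \<le> s (y i)"
      using y xb by (auto simp: stack_def)
    have "x i \<in> {\<beta> + 1..\<beta> + N}"
      using xr bd_a[of "x i"] s'_rest[of "x i"] by (cases "x i \<in> {\<alpha> + 1..\<alpha> + N}") fastforce+
    then obtain l where l: "l \<in> {1..N}" "x i = \<beta> + l" using rng_b by blast
    have "y i \<in> {\<alpha> + 1..\<alpha> + N}"
      using yr bd_b[of "y i"] s'_rest[of "y i"] by (cases "y i \<in> {\<beta> + 1..\<beta> + N}") fastforce+
    then obtain m where m: "m \<in> {1..N}" "y i = \<alpha> + m" using rng_a by blast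
    have "rk ?T (restrict x ?T) \<le> k" using xr bd_b[of "x i"] l by auto
    moreover have "k < rk ?T (restrict y ?T)" using yr bd_a[of "y i"] m by auto
    ultimately have "rk S ((restrict x ?T)(i := \<beta> + l)) < rk S ((restrict y ?T)(i := \<alpha> + m))"
      using less[OF l(1) m(1)] box_restrict xb by blast
    then show ?thesis using upd_restrict_box xb S l m by metis
  qed
  \<comment> \<open>In the pair \<open>e\<close> both \<open>k\<close> and \<open>m\<close> exceed
    \<open>s (\<beta> + e)\<close>, so that slice really grows.\<close>
  have "?B \<noteq> ?A"
  proof
    assume eq: "?B = ?A"
    have bl0: "\<beta> + e \<in> {1..n i}" using strict(1) ranges by auto
    then have "seg ?T (s' (\<beta> + e)) = seg ?T (s (\<beta> + e))"
      using slice_stack[OF S(2) bl0, of s] slice_stack[OF S(2) bl0, of s'] eq by simp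
    then have "s' (\<beta> + e) = s (\<beta> + e)"
      using seg_card_le[OF T(1,3) s_le[OF bl0]] seg_card_le[OF T(1,3) s'_le[OF bl0]] by simp
    then show False using s'_b[OF strict(1)] strict by auto
  qed
  then have "sum (rk S) ?B < sum (rk S) ?A"
    using sum_exchange(2)[OF fA(2,1) cB, of "rk S"] lt by blast
  then show ?thesis using dB cB wB by blast
qed

section \<open>Sets whose slices in every direction are initial segments\<close>

text \<open>Phrased with \<open>rk S\<close> instead of the ranks of the slices, so that steps along
  different coordinates can be chained.\<close>

definition line_closed :: "nat set \<Rightarrow> (nat \<Rightarrow> nat) set \<Rightarrow> bool" where
  "line_closed S A \<longleftrightarrow> A \<subseteq> box n S \<and>
    (\<forall>x\<in>A. \<forall>y\<in>box n S. \<forall>i\<in>S. y i = x i \<longrightarrow> rk S y < rk S x \<longrightarrow> y \<in> A)"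

lemma line_closedD:
  "line_closed S A \<Longrightarrow> x \<in> A \<Longrightarrow> y \<in> box n S \<Longrightarrow> i \<in> S \<Longrightarrow> y i = x i \<Longrightarrow> rk S y < rk S x \<Longrightarrow> y \<in> A"
  unfolding line_closed_def by blast

lemma line_closed_stack:
  assumes S: "S \<subseteq> {1..d}" "\<And>i. i \<in> S \<Longrightarrow> S - {i} \<noteq> {}"
    and A: "A \<subseteq> box n S" "\<And>i. i \<in> S \<Longrightarrow> stack S i (s i) = A"
  shows "line_closed S A"
  unfolding line_closed_def
proof (intro conjI ballI impI)
  fix x y i assume x: "x \<in> A" and y: "y \<in> box n S" and i: "i \<in> S" and eq: "y i = x i" and r: "rk S y < rk S x"
  have "rk (S - {i}) (restrict y (S - {i})) < rk (S - {i}) (restrict x (S - {i}))"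
    using rk_restrict[OF S(1) i S(2)[OF i] y _ eq r] x A by auto
  also have "\<dots> \<le> s i (y i)" using x A(2)[OF i] eq by (auto simp: stack_def)
  finally have "y \<in> stack S i (s i)" using y by (simp add: stack_def)
  then show "y \<in> A" using A(2)[OF i] by simp
qed (rule A)

text \<open>An element \<open>z\<close> after \<open>y\<close> and not after \<open>x\<close> would
  be in \<open>A\<close> through the coordinate it shares with \<open>x\<close>, and then
  \<open>y\<close> would be in \<open>A\<close> through the coordinate it shares with
  \<open>z\<close>.\<close>

lemma no_mixed:
  assumes S: "S \<subseteq> {1..d}" "S \<noteq> {}" and A: "line_closed S A"
    and xy: "y \<in> box n S" "y \<notin> A" "x \<in> A" and z: "z \<in> box n S"
    and ij: "i \<in> S" "j \<in> S" "z i = y i" "z j = x j"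
  shows "rk S z \<le> rk S y \<or> rk S x < rk S z"
proof (rule ccontr)
  assume "\<not> ?thesis"
  then have r: "rk S y < rk S z" "rk S z \<le> rk S x" by auto
  have xb: "x \<in> box n S" using A xy by (auto simp: line_closed_def)
  have "z \<in> A"
  proof (cases "rk S z = rk S x")
    case True
    then have "z = x" using rk_inj[OF S z xb] by simp
    then show ?thesis using xy by simp
  next
    case False
    then show ?thesis using line_closedD[OF A xy(3) z ij(2) ij(4)] r by simp
  qed
  then have "y \<in> A" using line_closedD[OF A _ xy(1) ij(1)] ij(3) r(1) by metis
  then show False using xy by simp
qed

text \<open>This isolates the coordinate responsible for \<open>y\<close> preceding
  \<open>x\<close>: the dominating coordinate of a common block, or the first coordinate whose parts
  differ. As all coordinates differ, the dominating one cannot be tied.\<close>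

lemma exists_pivot:
  assumes S: "S \<subseteq> {1..d}" "S \<noteq> {}"
    and xy: "y \<in> box n S" "x \<in> box n S" "rk S y < rk S x" "\<And>i. i \<in> S \<Longrightarrow> y i \<noteq> x i"
  obtains (dominated) c where "c \<in> S" "y c < x c" "\<And>i. i \<in> S \<Longrightarrow> p i (y i) = p i (x i)"
      "\<And>u v. u \<in> box n S \<Longrightarrow> v \<in> box n S \<Longrightarrow> (\<And>i. i \<in> S \<Longrightarrow> p i (u i) = p i (x i)) \<Longrightarrow>
        (\<And>i. i \<in> S \<Longrightarrow> p i (v i) = p i (x i)) \<Longrightarrow> u c < v c \<Longrightarrow> rk S u < rk S v"
  | (lexicographic) c where "c \<in> S" "p c (y c) < p c (x c)"
      "\<And>i. i \<in> S \<Longrightarrow> i < c \<Longrightarrow> p i (y i) = p i (x i)"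
proof (cases "\<forall>i\<in>S. p i (y i) = p i (x i)")
  case True
  obtain c where c: "c \<in> S" and dom: "\<And>u v. u \<in> box n S \<Longrightarrow> v \<in> box n S \<Longrightarrow>
      (\<forall>i\<in>S. p i (u i) = p i (x i) \<and> p i (v i) = p i (x i)) \<Longrightarrow> u c < v c \<Longrightarrow> rk S u < rk S v"
    using rk_dom[OF S xy(2)] by metis
  have "\<not> x c < y c" using dom[of x y] xy True by auto
  then have "y c < x c" using xy(4)[OF c] by simp
  then show thesis using dominated[OF c] True dom by blast
next
  case False
  let ?D = "{i \<in> S. p i (y i) \<noteq> p i (x i)}"
  have D: "finite ?D" "?D \<noteq> {}" using False finite_index[OF S(1)] by auto
  define c where "c = Min ?D"
  have c: "c \<in> ?D" using D Min_in unfolding c_def by blast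
  have less: "p i (y i) = p i (x i)" if "i \<in> S" "i < c" for i
    using that Min_le[OF D(1), of i] unfolding c_def by fastforce
  have "\<not> p c (x c) < p c (y c)"
    using rk_lex[OF S(1) xy(2,1), of c] c less xy(3) by fastforce
  then have "p c (y c) < p c (x c)" using c by auto
  then show thesis using lexicographic[of c] c less by blast
qed

text \<open>Let \<open>c\<close> be the pivot. Giving \<open>y\<close> the \<open>i\<close>-th entry
  of \<open>x\<close> for another \<open>i\<close> leaves the pivot untouched, so the new tuple
  still precedes \<open>x\<close>. It shares \<open>i\<close> with \<open>x\<close> and
  \<open>c\<close> with \<open>y\<close>, so \<open>no_mixed\<close> puts it no later than
  \<open>y\<close>; by monotonicity of the rank the entry must have decreased.\<close>

lemma pivot_unique:
  assumes S: "S \<subseteq> {1..d}" "S \<noteq> {}" and A: "line_closed S A"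
    and xy: "y \<in> box n S" "y \<notin> A" "x \<in> A" "rk S y < rk S x"
  shows "\<exists>c\<in>S. \<forall>i\<in>S - {c}. x i < y i"
proof -
  have xb: "x \<in> box n S" using A xy by (auto simp: line_closed_def)
  have ne: "y i \<noteq> x i" if "i \<in> S" for i using line_closedD[OF A xy(3,1) that] xy by blast
  have main: "x i < y i" if "c \<in> S" "i \<in> S" "i \<noteq> c" and r: "rk S (y(i := x i)) < rk S x" for c i
  proof -
    have zb: "y(i := x i) \<in> box n S"
      using box_upd_same[OF xy(1) that(2)] box_coord[OF xb that(2)] by auto
    have le: "rk S (y(i := x i)) \<le> rk S y"
      using no_mixed[OF S A xy(1-3) zb that(1,2)] that r by auto
    show ?thesis
    proof (rule ccontr)
      assume "\<not> ?thesis"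
      then have "rk S y \<le> rk S (y(i := x i))" using rk_mono[OF S xy(1) zb] by auto
      then have "y = y(i := x i)" using le rk_inj[OF S xy(1) zb] by simp
      then show False using ne[OF that(2)] by (metis fun_upd_same)
    qed
  qed
  have zb: "y(i := x i) \<in> box n S" if "i \<in> S" for i
    using box_upd_same[OF xy(1) that] box_coord[OF xb that] by auto
  show ?thesis
  proof (rule exists_pivot[OF S xy(1) xb xy(4)])
    show "\<And>i. i \<in> S \<Longrightarrow> y i \<noteq> x i" by (rule ne)
  next
    fix c assume c: "c \<in> S" "y c < x c" "\<And>i. i \<in> S \<Longrightarrow> p i (y i) = p i (x i)"
      "\<And>u v. u \<in> box n S \<Longrightarrow> v \<in> box n S \<Longrightarrow> (\<And>i. i \<in> S \<Longrightarrow> p i (u i) = p i (x i)) \<Longrightarrow>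
        (\<And>i. i \<in> S \<Longrightarrow> p i (v i) = p i (x i)) \<Longrightarrow> u c < v c \<Longrightarrow> rk S u < rk S v"
    have "rk S (y(i := x i)) < rk S x" if "i \<in> S" "i \<noteq> c" for i
      using c(2,3) that by (intro c(4)[OF zb[OF that(1)] xb]) auto
    then show ?thesis using main[OF c(1)] c(1) by blast
  next
    fix c assume c: "c \<in> S" "p c (y c) < p c (x c)"
      "\<And>i. i \<in> S \<Longrightarrow> i < c \<Longrightarrow> p i (y i) = p i (x i)"
    have "rk S (y(i := x i)) < rk S x" if "i \<in> S" "i \<noteq> c" for i
      using rk_lex[OF S(1) zb[OF that(1)] xb c(1)] c that by auto
    then show ?thesis using main[OF c(1)] c(1) by blast
  qed
qed

text \<open>Different blocks are compared by their starts alone, so any other representatives of the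
  two blocks are in the same order.\<close>

lemma rk_block_cong:
  assumes S: "S \<subseteq> {1..d}" "S \<noteq> {}"
    and b: "x \<in> box n S" "y \<in> box n S" "x' \<in> box n S" "y' \<in> box n S" "rk S x < rk S y"
    and eq: "\<And>i. i \<in> S \<Longrightarrow> p i (x' i) = p i (x i)" "\<And>i. i \<in> S \<Longrightarrow> p i (y' i) = p i (y i)"
    and ne: "\<not> (\<forall>i\<in>S. p i (x i) = p i (y i))"
  shows "rk S x' < rk S y'"
proof -
  let ?D = "{i \<in> S. p i (x i) \<noteq> p i (y i)}"
  have D: "finite ?D" "?D \<noteq> {}" using ne finite_index[OF S(1)] by auto
  define c where "c = Min ?D"
  have c: "c \<in> ?D" using D Min_in unfolding c_def by blast
  have less: "p i (x i) = p i (y i)" if "i \<in> S" "i < c" for i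
    using that Min_le[OF D(1), of i] unfolding c_def by fastforce
  have "\<not> p c (y c) < p c (x c)"
    using rk_lex[OF S(1) b(2,1), of c] c less b(5) by fastforce
  then have "p c (x c) < p c (y c)" using c by auto
  then show ?thesis using rk_lex[OF S(1) b(3,4), of c] c less eq by auto
qed

section \<open>Improving a set that is not an initial segment\<close>

lemma slice_le:
  assumes "finite S"
  shows "card (slice n S i v A) \<le> card (box n (S - {i}))"
  by (rule card_mono[OF finite_box slice_subset]) (use assms in auto)

lemma slice_card_antimono:
  assumes "finite S" "down_set n S A" "i \<in> S" "1 \<le> u" "u \<le> v" "v \<le> n i"
  shows "card (slice n S i v A) \<le> card (slice n S i u A)"
  by (rule card_mono[OF finite_subset[OF slice_subset finite_box] slice_antimono]) (use assms in auto)

text \<open>Supplies the premise \<open>closed\<close> of \<open>exchange\<close>. If it failed,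
  \<open>pivot_unique\<close> would make the entries of \<open>z(i := \<alpha>)\<close> smaller than
  those of \<open>x(i := \<beta>)\<close> in all coordinates but one. Since \<open>S\<close> has
  three elements, this includes a coordinate other than \<open>i\<close>, where
  \<open>x j \<le> z j\<close> is assumed.\<close>

lemma closed_step:
  assumes S: "S \<subseteq> {1..d}" "i \<in> S" "3 \<le> card S" and A: "line_closed S A"
    and st: "stack S i s = A"
    and \<alpha>\<beta>: "\<alpha> \<in> {1..n i}" "\<beta> \<in> {1..n i}"
    and x: "x \<in> box n (S - {i})" and z: "z \<in> box n (S - {i})" "rk (S - {i}) z \<le> s \<alpha>"
    and r: "rk S (x(i := \<beta>)) < rk S (z(i := \<alpha>))"
    and le: "\<And>j. j \<in> S - {i} \<Longrightarrow> x j \<le> z j"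
  shows "rk (S - {i}) x \<le> s \<beta>"
proof (rule ccontr)
  assume "\<not> ?thesis"
  then have y: "x(i := \<beta>) \<notin> A" using x st by (auto simp: stack_def restrict_upd_box restrict_box)
  have zA: "z(i := \<alpha>) \<in> A"
    using z st box_upd[OF z(1) S(2) \<alpha>\<beta>(1)] by (auto simp: stack_def restrict_upd_box restrict_box)
  have "S \<noteq> {}" using S by auto
  then obtain c where c: "\<forall>j\<in>S - {c}. (z(i := \<alpha>)) j < (x(i := \<beta>)) j"
    using pivot_unique[OF S(1) _ A box_upd[OF x S(2) \<alpha>\<beta>(2)] y zA r] by blast
  have "\<not> S \<subseteq> {i, c}" using S(3) card_mono[of "{i, c}" S] card_insert_le_m1[of 2 "{c}" i] by auto
  then obtain j where "j \<in> S" "j \<noteq> i" "j \<noteq> c" by blast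
  then show False using bspec[OF c, of j] le[of j] by auto
qed

text \<open>The case of \<open>exchange\<close> with one pair of slices. Slices other than \<alpha>
  and \<beta> keep their sizes, so antimonotonicity of the new sizes rests on \<open>high\<close>
  and \<open>low\<close>.\<close>

lemma improve_single:
  assumes S: "S \<subseteq> {1..d}" "i \<in> S" "3 \<le> card S" "S - {i} \<noteq> {}" and o: "opt (S - {i})"
    and A: "line_closed S A" "down_set n S A" "stack S i s = A"
    and s: "\<And>v. s v = card (slice n S i v A)"
    and ab: "1 \<le> \<alpha>" "\<alpha> < \<beta>" "\<beta> \<le> n i" "k < s \<alpha>" "s \<beta> < k"
    and high: "\<And>v. v \<in> {1..n i} \<Longrightarrow> v < \<beta> \<Longrightarrow> k \<le> s v"
    and low: "\<And>v. v \<in> {1..n i} \<Longrightarrow> \<alpha> < v \<Longrightarrow> s v \<le> k"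
    and ww: "w i \<alpha> \<le> w i \<beta>"
    and less: "\<And>x z. x \<in> box n (S - {i}) \<Longrightarrow> z \<in> box n (S - {i}) \<Longrightarrow>
       rk (S - {i}) x \<le> k \<Longrightarrow> k < rk (S - {i}) z \<Longrightarrow> rk S (x(i := \<beta>)) < rk S (z(i := \<alpha>))"
  shows "\<exists>B. down_set n S B \<and> card B = card A \<and>
    sum (weight w S) A \<le> sum (weight w S) B \<and> sum (rk S) B < sum (rk S) A"
proof -
  have fS: "finite S" using finite_index[OF S(1)] .
  have one: "l = 1" if "l \<in> {1..1::nat}" for l using that by simp
  have ex: "\<exists>B. down_set n S B \<and> card B = card (stack S i s) \<and>
    sum (weight w S) (stack S i s) \<le> sum (weight w S) B \<and> sum (rk S) B < sum (rk S) (stack S i s)"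
  \<comment> \<open>In \<open>exchange\<close> the moved slices are \<open>\<alpha> + l\<close> and
    \<open>\<beta> + l\<close> with \<open>l\<close> starting at 1, hence the offsets reduced by
    one.\<close>
  proof (rule exchange[where \<alpha> = "\<alpha> - 1" and \<beta> = "\<beta> - 1" and N = 1 and k = k and e = 1, OF S(1,2,4) o])
    show "s v \<le> s u" if "1 \<le> u" "u \<le> v" "v \<le> n i" for u v
      unfolding s by (rule slice_card_antimono[OF fS A(2) S(2) that])
    show "s v \<le> card (box n (S - {i}))" for v unfolding s by (rule slice_le[OF fS])
    show "rk (S - {i}) x \<le> s (\<beta> - 1 + l)"
      if "l \<in> {1..1}" "x \<in> box n (S - {i})" "z \<in> box n (S - {i})" "rk (S - {i}) x \<le> k" "k < rk (S - {i}) z"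
        "rk (S - {i}) z \<le> s (\<alpha> - 1 + l)" "\<And>j. j \<in> S - {i} \<Longrightarrow> x j \<le> z j" for l x z
      using closed_step[OF S(1-3) A(1,3), of \<alpha> \<beta> x z] less[OF that(2-5)] that(2,3,6,7) one[OF that(1)] ab by simp
    show "rk S (x(i := \<beta> - 1 + l)) < rk S (z(i := \<alpha> - 1 + m))"
      if "l \<in> {1..1}" "m \<in> {1..1}" "x \<in> box n (S - {i})" "z \<in> box n (S - {i})" "rk (S - {i}) x \<le> k" "k < rk (S - {i}) z"
      for l m x z
      using less[OF that(3-6)] one[OF that(1)] one[OF that(2)] ab by simp
    show "w i (\<alpha> - 1 + l) \<le> w i (\<beta> - 1 + l)" if "l \<in> {1..1}" for l
      using ww ab one[OF that] by simp
  qed (use ab high low in auto)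
  then show ?thesis unfolding A(3) .
qed

text \<open>Take the last height where \<open>s\<close> exceeds \<open>k\<close> and the first where
  it falls short of \<open>k\<close>. All heights between them have size exactly \<open>k\<close>,
  which is what a move between these two slices requires.\<close>

lemma exists_crossing:
  fixes s :: "nat \<Rightarrow> nat"
  assumes s: "\<And>u v. 1 \<le> u \<Longrightarrow> u \<le> v \<Longrightarrow> v \<le> m \<Longrightarrow> s v \<le> s u"
    and ab: "a \<in> {1..m}" "b \<in> {1..m}" "k < s a" "s b < k"
  obtains \<alpha> \<beta> where "a \<le> \<alpha>" "\<alpha> < \<beta>" "\<beta> \<le> b" "k < s \<alpha>" "s \<beta> < k"
    "\<And>v. v \<in> {1..m} \<Longrightarrow> v < \<beta> \<Longrightarrow> k \<le> s v" "\<And>v. v \<in> {1..m} \<Longrightarrow> \<alpha> < v \<Longrightarrow> s v \<le> k"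
proof -
  define \<alpha> where "\<alpha> = Max {v \<in> {1..m}. k < s v}"
  define \<beta> where "\<beta> = Min {v \<in> {1..m}. s v < k}"
  have \<alpha>: "\<alpha> \<in> {v \<in> {1..m}. k < s v}" unfolding \<alpha>_def by (rule Max_in) (use ab in auto)
  have \<beta>: "\<beta> \<in> {v \<in> {1..m}. s v < k}" unfolding \<beta>_def by (rule Min_in) (use ab in auto)
  have "a \<le> \<alpha>" unfolding \<alpha>_def using ab by (intro Max_ge) auto
  moreover have "\<beta> \<le> b" unfolding \<beta>_def using ab by (intro Min_le) auto
  moreover have "k \<le> s v" if "v \<in> {1..m}" "v < \<beta>" for v
    using Min_le[of "{v \<in> {1..m}. s v < k}" v] that unfolding \<beta>_def[symmetric] by fastforce
  moreover have "s v \<le> k" if "v \<in> {1..m}" "\<alpha> < v" for v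
    using Max_ge[of "{v \<in> {1..m}. k < s v}" v] that unfolding \<alpha>_def[symmetric] by fastforce
  moreover have "\<alpha> < \<beta>" using s[of \<beta> \<alpha>] \<alpha> \<beta> by (cases "\<alpha> < \<beta>") auto
  ultimately show thesis using that \<alpha> \<beta> by blast
qed

lemma exists_rk:
  assumes "S \<subseteq> {1..d}" "S \<noteq> {}" "k \<in> {1..card (box n S)}"
  shows "\<exists>x\<in>box n S. rk S x = k"
  using rk_bij[OF assms(1,2)] assms(3) unfolding bij_betw_def by (metis imageE)

text \<open>\<open>K\<close> consists of the elements preceding \<open>g\<close>. As the slice sizes are antimonotone,
  \<open>a i \<le> \<alpha> < \<beta> \<le> b i\<close>, so \<open>\<alpha>\<close> and \<open>\<beta>\<close> lie in one part.\<close>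

lemma improve_same_part:
  assumes S: "S \<subseteq> {1..d}" "i \<in> S" "3 \<le> card S" "S - {i} \<noteq> {}" and o: "opt (S - {i})"
    and A: "line_closed S A" "down_set n S A" "stack S i s = A"
    and s: "\<And>v. s v = card (slice n S i v A)"
    and ab: "a \<in> A" "b \<in> box n S" "b \<notin> A" and i: "i \<le> d - 1" "p i (b i) = p i (a i)"
    and g: "g \<in> box n (S - {i})"
      "\<And>j. j \<in> S - {i} \<Longrightarrow> p j (g j) = p j (a j)"
      "\<And>j. j \<in> S - {i} \<Longrightarrow> g j \<le> a j"
      "rk S b < rk S (g(i := b i))"
    and gmin: "\<And>x z \<alpha> \<beta>. x \<in> box n S \<Longrightarrow> z \<in> box n S \<Longrightarrow> (\<And>j. j \<in> S \<Longrightarrow> p j (x j) = p j (a j)) \<Longrightarrow>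
      (\<And>j. j \<in> S \<Longrightarrow> p j (z j) = p j (a j)) \<Longrightarrow> rk S x < rk S (g(i := x i)) \<Longrightarrow>
      rk S (g(i := z i)) \<le> rk S z \<Longrightarrow> rk S x < rk S z"
  shows "\<exists>B. down_set n S B \<and> card B = card A \<and>
    sum (weight w S) A \<le> sum (weight w S) B \<and> sum (rk S) B < sum (rk S) A"
proof -
  let ?T = "S - {i}"
  have fS: "finite S" using finite_index[OF S(1)] .
  have T: "?T \<subseteq> {1..d}" using S by auto
  have Sne: "S \<noteq> {}" using S by auto
  have aS: "a \<in> box n S" using A(2) ab by (auto simp: down_set_def)
  have ai: "a i \<in> {1..n i}" "b i \<in> {1..n i}" using box_coord[OF _ S(2)] aS ab by auto
  \<comment> \<open>Ranks start at 1, so \<open>k\<close> is the number of tuples before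
    \<open>g\<close>, and \<open>g\<close> itself is the first tuple outside
    \<open>K\<close>.\<close>
  define k where "k = rk ?T g - 1"
  have "rk ?T g \<ge> 1" using rk_range[OF T S(4) g(1)] by simp
  then have k: "rk ?T x \<le> k \<longleftrightarrow> rk ?T x < rk ?T g" "k < rk ?T x \<longleftrightarrow> rk ?T g \<le> rk ?T x" for x
    unfolding k_def by linarith+
  have gup: "g(i := v) \<in> box n S" if "v \<in> {1..n i}" for v using box_upd[OF g(1) S(2) that] .
  \<comment> \<open>The tuple \<open>b\<close> without coordinate \<open>i\<close> is in
    \<open>K\<close> but missing from its slice; dually, \<open>a\<close> without coordinate
    \<open>i\<close> is outside \<open>K\<close> but present in its slice.\<close>
  have sb: "s (b i) < k"
  proof -
    have "rk ?T (restrict b ?T) < rk ?T g"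
      using rk_restrict[OF S(1,2,4) ab(2) gup[OF ai(2)] _ g(4)]
      by (simp add: restrict_upd_box[OF g(1)] restrict_box[OF g(1)])
    moreover have "s (b i) < rk ?T (restrict b ?T)" using ab A(3) by (auto simp: stack_def)
    ultimately show ?thesis using k[of "restrict b ?T"] by linarith
  qed
  have sa: "k < s (a i)"
  proof -
    have "rk ?T g \<le> rk ?T (restrict a ?T)"
      using g(3) by (intro rk_mono[OF T S(4) g(1) box_restrict[OF aS]]) auto
    moreover have "rk ?T (restrict a ?T) \<le> s (a i)" using ab A(3) by (auto simp: stack_def)
    ultimately show ?thesis using k[of "restrict a ?T"] by linarith
  qed
  have s_anti: "s v \<le> s u" if "1 \<le> u" "u \<le> v" "v \<le> n i" for u v
    unfolding s by (rule slice_card_antimono[OF fS A(2) S(2) that])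
  obtain \<alpha> \<beta> where cr: "a i \<le> \<alpha>" "\<alpha> < \<beta>" "\<beta> \<le> b i" "k < s \<alpha>" "s \<beta> < k"
    "\<And>v. v \<in> {1..n i} \<Longrightarrow> v < \<beta> \<Longrightarrow> k \<le> s v" "\<And>v. v \<in> {1..n i} \<Longrightarrow> \<alpha> < v \<Longrightarrow> s v \<le> k"
    using exists_crossing[OF s_anti ai sa sb] by blast
  have ab_in: "\<alpha> \<in> {1..n i}" "\<beta> \<in> {1..n i}" using cr ai by auto
  have id: "i \<in> {1..d}" using S by auto
  have "p i (a i) \<le> p i \<alpha>" "p i \<alpha> \<le> p i \<beta>" "p i \<beta> \<le> p i (b i)"
    using p_mono[OF id, of "a i" \<alpha>] p_mono[OF id, of \<alpha> \<beta>] p_mono[OF id, of \<beta> "b i"] cr ai by auto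
  then have pp: "p i \<alpha> = p i (a i)" "p i \<beta> = p i (a i)" using i by auto
  have "w i \<alpha> \<le> w i \<beta>" using w_mono[of i \<alpha> \<beta>] id i cr ai pp by auto
  then show ?thesis
  proof (intro improve_single[OF S o A s _ cr(2) _ cr(4-7)])
    fix x z assume x: "x \<in> box n ?T" "rk ?T x \<le> k" and z: "z \<in> box n ?T" "k < rk ?T z"
    let ?X = "x(i := \<beta>)" and ?Z = "z(i := \<alpha>)"
    have b: "?X \<in> box n S" "?Z \<in> box n S" using box_upd S(2) x z ab_in by blast+
    have X: "rk S ?X < rk S (g(i := \<beta>))"
      using rk_upd_iff[OF S(1,2,4) x(1) g(1) ab_in(2)] x k by blast
    have Z: "rk S (g(i := \<alpha>)) \<le> rk S ?Z"
      using rk_upd_iff[OF S(1,2,4) z(1) g(1) ab_in(1)] z k by (metis leD leI)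
    have pg: "p j ((g(i := \<beta>)) j) = p j (a j)" "p j ((g(i := \<alpha>)) j) = p j (a j)" if "j \<in> S" for j
      using that g(2) pp by auto
    \<comment> \<open>The tuples \<open>g(i := \<alpha>)\<close> and \<open>g(i := \<beta>)\<close>
      lie in the block of \<open>a\<close>. If \<open>?X\<close> is outside this block, it precedes
      the whole block; if \<open>?Z\<close> is outside, it follows the whole block. Only when both
      are inside is \<open>gmin\<close> called upon.\<close>
    show "rk S ?X < rk S ?Z"
    proof (cases "\<forall>j\<in>S. p j (?X j) = p j (a j)")
      case XB: True
      show ?thesis
      proof (cases "\<forall>j\<in>S. p j (?Z j) = p j (a j)")
        case True
        then show ?thesis using gmin[OF b] XB X Z by simp
      next
        case False
        then have ne: "\<not> (\<forall>j\<in>S. p j ((g(i := \<alpha>)) j) = p j (?Z j))" using pg by metis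
        have "rk S (g(i := \<alpha>)) \<noteq> rk S ?Z"
          using ne rk_inj[OF S(1) Sne gup[OF ab_in(1)] b(2)] by metis
        then have "rk S (g(i := \<alpha>)) < rk S ?Z" using Z by simp
        then have "rk S (g(i := \<beta>)) < rk S ?Z"
          using rk_block_cong[OF S(1) Sne gup[OF ab_in(1)] b(2) gup[OF ab_in(2)] b(2)] ne pg by metis
        then show ?thesis using X by simp
      qed
    next
      case False
      then have ne: "\<not> (\<forall>j\<in>S. p j (?X j) = p j ((g(i := \<beta>)) j))" using pg by metis
      have "rk S ?X < rk S (g(i := \<alpha>))"
        using rk_block_cong[OF S(1) Sne b(1) gup[OF ab_in(2)] b(1) gup[OF ab_in(1)] X] ne pg by metis
      then show ?thesis using Z by simp
    qed
  qed (use ab_in cr ai in auto)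
qed

lemma rk_less_first:
  assumes "S \<subseteq> {1..d}" "x \<in> box n S" "y \<in> box n S" "c \<in> S" "\<And>j. j \<in> S \<Longrightarrow> c \<le> j" "p c (x c) < p c (y c)"
  shows "rk S x < rk S y"
  using assms(5) by (intro rk_lex[OF assms(1-4,6)]) (meson leD)

text \<open>\<open>K\<close> consists of the elements whose first coordinate lies in a part before that of \<open>a\<close>. Playing
  the coordinates \<open>c\<close> and \<open>e\<close> against \<open>i\<close> in \<open>no_mixed\<close> shows that slices larger than \<open>K\<close> occur only in
  the first part of \<open>G i\<close> and slices smaller than \<open>K\<close> only in the last one.\<close>

lemma improve_column:
  assumes S: "S \<subseteq> {1..d}" "i \<in> S" "3 \<le> card S" "S - {i} \<noteq> {}" and o: "opt (S - {i})"
    and A: "line_closed S A" "down_set n S A" "stack S i s = A"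
    and s: "\<And>v. s v = card (slice n S i v A)"
    and ab: "a \<in> A" "b \<in> box n S" "b \<notin> A"
    and cie: "c \<in> S" "c < i" "e \<in> S" "i < e" "\<And>j. j \<in> S \<Longrightarrow> c \<le> j" "p c (b c) < p c (a c)"
  shows "\<exists>B. down_set n S B \<and> card B = card A \<and>
    sum (weight w S) A \<le> sum (weight w S) B \<and> sum (rk S) B < sum (rk S) A"
proof -
  let ?T = "S - {i}"
  have fS: "finite S" using finite_index[OF S(1)] .
  have T: "?T \<subseteq> {1..d}" using S by auto
  have Sne: "S \<noteq> {}" using S by auto
  have aS: "a \<in> box n S" using A(2) ab by (auto simp: down_set_def)
  have ai: "a i \<in> {1..n i}" "b i \<in> {1..n i}" using box_coord[OF _ S(2)] aS ab by auto
  have id: "i \<in> {1..d}" "i \<in> {2..d - 1}" "c \<in> {1..d}" using S cie by fastforce+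
  have ac: "a c \<in> {1..n c}" using box_coord[OF aS cie(1)] .
  \<comment> \<open>The coordinatewise least tuple whose \<open>c\<close>-th entry has reached the
    part of \<open>a c\<close>. Every other such tuple dominates it and so has larger rank, which
    identifies the tuples before \<open>g\<close> with those whose \<open>c\<close>-th entry lies in
    an earlier part.\<close>
  define g where "g = (\<lambda>j\<in>?T. if j = c then p c (a c) else 1)"
  have pos: "1 \<le> n j" if "j \<in> S" for j using box_coord[OF aS that] by auto
  have gb: "g \<in> box n ?T"
    using pos p_start[OF id(3) ac] ac cie by (auto simp: g_def box_def)
  have gc: "p c (g c) = p c (a c)" using p_start[OF id(3) ac] cie by (simp add: g_def)
  define k where "k = rk ?T g - 1"
  have g1: "rk ?T g \<in> {1..card (box n ?T)}" using rk_range[OF T S(4) gb] .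
  then have k: "rk ?T x \<le> k \<longleftrightarrow> rk ?T x < rk ?T g" "k < rk ?T x \<longleftrightarrow> rk ?T g \<le> rk ?T x" for x
    unfolding k_def by auto
  have gup: "g(i := v) \<in> box n S" if "v \<in> {1..n i}" for v using box_upd[OF gb S(2) that] .
  have lo: "p c (x c) < p c (a c)" if x: "x \<in> box n ?T" "rk ?T x \<le> k" for x
  proof (rule ccontr)
    assume "\<not> ?thesis"
    then have "p c (a c) \<le> p c (x c)" by simp
    moreover have xc: "x c \<in> {1..n c}" using box_coord[OF x(1)] cie by auto
    ultimately have xa: "p c (a c) \<le> x c" using p_start[OF id(3) xc] by auto
    have "g j \<le> x j" if j: "j \<in> ?T" for j using box_coord[OF x(1) j] xa j by (simp add: g_def)
    then have "rk ?T g \<le> rk ?T x" using rk_mono[OF T S(4) gb x(1)] by blast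
    then show False using x k by (metis leD)
  qed
  have hi: "p c (a c) \<le> p c (z c)" if z: "z \<in> box n ?T" "k < rk ?T z" for z
  proof (rule ccontr)
    assume "\<not> ?thesis"
    then have "rk ?T z < rk ?T g"
      using cie gc by (intro rk_less_first[OF T z(1) gb, of c]) auto
    then show False using z k by (metis leD)
  qed
  have less: "rk S (x(i := v)) < rk S (z(i := u))"
    if "x \<in> box n ?T" "z \<in> box n ?T" "rk ?T x \<le> k" "k < rk ?T z" "u \<in> {1..n i}" "v \<in> {1..n i}" for x z u v
    using lo[OF that(1,3)] hi[OF that(2,4)] cie(2)
    by (intro rk_less_first[OF S(1) box_upd[OF that(1) S(2) that(6)] box_upd[OF that(2) S(2) that(5)] cie(1,5)]) auto
  have sb: "s (b i) < k"
  proof -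
    have "rk S b < rk S (g(i := b i))"
      using gc cie(2,6) by (intro rk_less_first[OF S(1) ab(2) gup[OF ai(2)] cie(1,5)]) auto
    then have "rk ?T (restrict b ?T) < rk ?T g"
      using rk_restrict[OF S(1,2,4) ab(2) gup[OF ai(2)]]
      by (simp add: restrict_upd_box[OF gb] restrict_box[OF gb])
    moreover have "s (b i) < rk ?T (restrict b ?T)" using ab A(3) by (auto simp: stack_def)
    ultimately show ?thesis using k[of "restrict b ?T"] by linarith
  qed
  have sa: "k < s (a i)"
  proof -
    have "g j \<le> restrict a ?T j" if "j \<in> ?T" for j
      using that p_start[OF id(3) ac] box_coord[OF aS, of j] by (auto simp: g_def)
    then have "rk ?T g \<le> rk ?T (restrict a ?T)"
      by (intro rk_mono[OF T S(4) gb box_restrict[OF aS]])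
    moreover have "rk ?T (restrict a ?T) \<le> s (a i)" using ab A(3) by (auto simp: stack_def)
    ultimately show ?thesis using k[of "restrict a ?T"] by linarith
  qed
  have s_anti: "s v \<le> s u" if "1 \<le> u" "u \<le> v" "v \<le> n i" for u v
    unfolding s by (rule slice_card_antimono[OF fS A(2) S(2) that])
  have last: "p i v = p i (n i)" if v: "v \<in> {1..n i}" "s v < k" for v
  proof (rule ccontr)
    assume ne: "p i v \<noteq> p i (n i)"
    have lt: "p i v < p i (n i)" using p_mono[OF id(1), of v "n i"] v ne by auto
    have "k \<in> {1..card (box n ?T)}" using v g1 by (auto simp: k_def)
    then obtain x where x: "x \<in> box n ?T" "rk ?T x = k" using exists_rk[OF T S(4)] by blast
    \<comment> \<open>Here \<open>x\<close> is the last tuple of \<open>K\<close>, so the slice at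
      \<open>v\<close>, being too small, misses it. The tuple \<open>?Z\<close> shares
      \<open>c\<close> with \<open>?X\<close> and \<open>e\<close> with \<open>a\<close>. It comes
      after \<open>?X\<close> by the later part at \<open>i\<close>, since \<open>e\<close> is
      behind \<open>i\<close> in the lexicographic comparison, and before \<open>a\<close> by
      coordinate \<open>c\<close>: \<open>no_mixed\<close> forbids this.\<close>
    let ?X = "x(i := v)" and ?Z = "x(i := n i, e := a e)"
    have Xb: "?X \<in> box n S" using box_upd[OF x(1) S(2) v(1)] .
    have Zb: "?Z \<in> box n S"
      using box_upd_same[OF box_upd[OF x(1) S(2), of "n i"] cie(3)] box_coord[OF aS cie(3)] ai by auto
    have XA: "?X \<notin> A"
      using x v A(3) by (auto simp: stack_def restrict_upd_box[OF x(1)] restrict_box[OF x(1)])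
    have ra: "rk S ?Z < rk S a" "rk S ?X < rk S a"
      using lo[OF x(1)] x(2) cie(2,4)
      by (auto intro!: rk_less_first[OF S(1) Zb aS cie(1,5)] rk_less_first[OF S(1) Xb aS cie(1,5)])
    have "rk S ?X < rk S ?Z"
      using lt cie(4) by (intro rk_lex[OF S(1) Xb Zb S(2)]) auto
    moreover have "?Z c = ?X c" "?Z e = a e" using cie by auto
    ultimately show False
      using no_mixed[OF S(1) Sne A(1) Xb XA ab(1) Zb cie(1,3)] ra by linarith
  qed
  have first: "p i v = p i 1" if v: "v \<in> {1..n i}" "k < s v" for v
  proof (rule ccontr)
    assume ne: "p i v \<noteq> p i 1"
    have lt: "p i 1 < p i v" using p_mono[OF id(1), of 1 v] v ne by auto
    \<comment> \<open>The dual configuration: \<open>g\<close> is the first tuple outside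
      \<open>K\<close>, so an oversized slice contains it, and \<open>?Z\<close> is in
      \<open>A\<close>. The tuple \<open>?Y\<close> shares \<open>e\<close> with \<open>b\<close>
      and \<open>c\<close> with \<open>?Z\<close> and lies strictly between them.\<close>
    let ?Z = "g(i := v)" and ?Y = "g(i := 1, e := b e)"
    have Zb: "?Z \<in> box n S" using gup[OF v(1)] .
    have Yb: "?Y \<in> box n S"
      using box_upd_same[OF gup[of 1] cie(3)] box_coord[OF ab(2) cie(3)] v by auto
    have "rk ?T g \<le> s v" using v g1 by (auto simp: k_def)
    then have ZA: "?Z \<in> A"
      using Zb A(3) by (auto simp: stack_def restrict_upd_box[OF gb] restrict_box[OF gb])
    have rb: "rk S b < rk S ?Y"
      using gc cie(2,4,6) by (intro rk_less_first[OF S(1) ab(2) Yb cie(1,5)]) auto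
    have rz: "rk S ?Y < rk S ?Z"
      using lt cie(4) by (intro rk_lex[OF S(1) Yb Zb S(2)]) auto
    have "?Y e = b e" "?Y c = ?Z c" using cie by auto
    then show False
      using no_mixed[OF S(1) Sne A(1) ab(2,3) ZA Yb cie(3,1)] rb rz by linarith
  qed
  obtain \<alpha> \<beta> where cr: "\<alpha> \<in> {1..n i}" "\<alpha> < \<beta>" "\<beta> \<in> {1..n i}" "k < s \<alpha>" "s \<beta> < k"
    "\<And>v. v \<in> {1..n i} \<Longrightarrow> v < \<beta> \<Longrightarrow> k \<le> s v" "\<And>v. v \<in> {1..n i} \<Longrightarrow> \<alpha> < v \<Longrightarrow> s v \<le> k"
  proof (rule exists_crossing[OF s_anti ai sa sb])
    fix \<alpha> \<beta> assume h: "a i \<le> \<alpha>" "\<alpha> < \<beta>" "\<beta> \<le> b i" "k < s \<alpha>" "s \<beta> < k"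
      "\<And>v. v \<in> {1..n i} \<Longrightarrow> v < \<beta> \<Longrightarrow> k \<le> s v" "\<And>v. v \<in> {1..n i} \<Longrightarrow> \<alpha> < v \<Longrightarrow> s v \<le> k"
    show thesis by (rule that[OF _ h(2) _ h(4-7)]) (use h(1-3) ai in auto)
  qed
  show ?thesis
  proof (cases "w i \<alpha> \<le> w i \<beta>")
    case True
    show ?thesis
      by (rule improve_single[OF S o A s _ cr(2) _ cr(4-7) True]) (use cr less in auto)
  next
    case False
    obtain N where N: "N \<le> n i" "\<And>v. v \<in> {1..n i} \<Longrightarrow> p i v = p i 1 \<longleftrightarrow> v \<le> N"
      "\<And>v. v \<in> {1..n i} \<Longrightarrow> p i v = p i (n i) \<longleftrightarrow> n i - N < v"
      "\<And>l. l \<in> {1..N} \<Longrightarrow> w i l \<le> w i (n i - N + l)"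
      using w_regular[OF id(2)] by blast
    have idd: "i \<in> {1..d - 1}" using id by auto
    have pa: "p i \<alpha> = p i 1" "\<alpha> \<le> N" using first[OF cr(1,4)] N(2)[OF cr(1)] by auto
    have pb: "p i \<beta> = p i (n i)" "n i - N < \<beta>" using last[OF cr(3,5)] N(3)[OF cr(3)] by auto
    have ne: "p i \<alpha> \<noteq> p i \<beta>" using w_mono[OF idd, of \<alpha> \<beta>] cr False by auto
    have N1: "N \<in> {1..n i}" using pa cr N(1) by auto
    have half: "N \<le> n i - N"
    proof (rule ccontr)
      assume "\<not> ?thesis"
      then have "p i N = p i (n i)" "p i N = p i 1" using N(2)[OF N1] N(3)[OF N1] by auto
      then show False using pa pb ne by simp
    qed
    \<comment> \<open>The place of \<beta> within the last part; its partner is slice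
      \<open>l0\<close> of the first part. If \<open>l0\<close> were at least \<alpha>, monotonicity
      in the first part and regularity would give \<open>w i \<alpha> \<le> w i \<beta>\<close>. So
      slice \<open>l0\<close> lies below \<alpha> and is oversized as well, which makes the pair
      \<open>l0\<close> strict.\<close>
    define l0 where "l0 = \<beta> - (n i - N)"
    have l0: "l0 \<in> {1..N}" "n i - N + l0 = \<beta>" using pb cr by (auto simp: l0_def)
    have "l0 < \<alpha>"
    proof (rule ccontr)
      assume "\<not> ?thesis"
      then have "w i \<alpha> \<le> w i l0"
        using w_mono[OF idd, of \<alpha> l0] cr(1) l0(1) N1 N(2)[of l0] pa by auto
      then show False using N(4)[OF l0(1)] l0(2) False by simp
    qed
    then have sl0: "k < s l0" using s_anti[of l0 \<alpha>] l0(1) cr(1,4) by auto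
    \<comment> \<open>Moving only between \<open>l0\<close> and \<beta> could break
      antimonotonicity, because slice \<alpha> lies above \<open>l0\<close> and still exceeds
      \<open>k\<close>. Hence all pairs of the two parts are treated at once.\<close>
    have ex: "\<exists>B. down_set n S B \<and> card B = card (stack S i s) \<and>
      sum (weight w S) (stack S i s) \<le> sum (weight w S) B \<and> sum (rk S) B < sum (rk S) (stack S i s)"
    proof (rule exchange[where \<alpha> = 0 and \<beta> = "n i - N" and N = N and k = k and e = l0, OF S(1,2,4) o s_anti])
      show "s v \<le> card (box n (S - {i}))" for v unfolding s by (rule slice_le[OF fS])
      show "k \<le> s v" if "v \<in> {1..n i - N}" for v
      proof (rule ccontr)
        assume "\<not> ?thesis"
        moreover have v: "v \<in> {1..n i}" using that diff_le_self[of "n i" N] by (auto intro: le_trans)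
        ultimately have "p i v = p i (n i)" using last[of v] by auto
        then show False using N(3)[OF v] that by auto
      qed
      show "s v \<le> k" if "v \<in> {0 + N + 1..n i}" for v
      proof (rule ccontr)
        assume "\<not> ?thesis"
        then have "p i v = p i 1" using first[of v] that by auto
        then show False using N(2)[of v] that by auto
      qed
      show "rk ?T x \<le> s (n i - N + l)"
        if "l \<in> {1..N}" "x \<in> box n ?T" "z \<in> box n ?T" "rk ?T x \<le> k" "k < rk ?T z"
          "rk ?T z \<le> s (0 + l)" "\<And>j. j \<in> ?T \<Longrightarrow> x j \<le> z j" for l x z
      proof (rule closed_step[OF S(1-3) A(1,3)])
        show "l \<in> {1..n i}" "n i - N + l \<in> {1..n i}" using that N by auto
        then show "rk S (x(i := n i - N + l)) < rk S (z(i := l))" using less[OF that(2-5)] by blast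
      qed (use that in auto)
      show "rk S (x(i := n i - N + l)) < rk S (z(i := 0 + m))"
        if "l \<in> {1..N}" "m \<in> {1..N}" "x \<in> box n ?T" "z \<in> box n ?T" "rk ?T x \<le> k" "k < rk ?T z" for l m x z
        using that N by (intro less) auto
    qed (use half N l0 sl0 cr in auto)
    then show ?thesis unfolding A(3) .
  qed
qed

section \<open>Induction on the number of coordinates\<close>

lemma opt_step:
  assumes S: "S \<subseteq> {1..d}" "3 \<le> card S" and o: "\<And>i. i \<in> S \<Longrightarrow> opt (S - {i})"
  shows "opt S"
  unfolding opt_def
proof (intro allI impI)
  fix A0 assume A0: "down_set n S A0"
  have fS: "finite S" using finite_index[OF S(1)] .
  have Sne: "S \<noteq> {}" using S by auto
  have sub: "S - {i} \<noteq> {}" if "i \<in> S" for i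
  proof
    assume "S - {i} = {}"
    then have "card S \<le> card {i}" by (intro card_mono) auto
    then show False using S(2) by simp
  qed
  let ?P = "\<lambda>A. down_set n S A \<and> card A = card A0 \<and> sum (weight w S) A0 \<le> sum (weight w S) A"
  obtain A where A: "?P A" and least: "\<And>B. ?P B \<Longrightarrow> sum (rk S) A \<le> sum (rk S) B"
    using ex_has_least_nat[of ?P A0 "sum (rk S)"] A0 by auto
  have AS: "A \<subseteq> box n S" using A down_set_subset by blast
  define s where "s i v = card (slice n S i v A)" for i v
  have st: "stack S i (s i) = A" if i: "i \<in> S" for i
  proof (rule ccontr)
    assume ne: "stack S i (s i) \<noteq> A"
    have s_eq: "s i = (\<lambda>v. card (slice n S i v A))" by (simp add: s_def fun_eq_iff)
    have "?P (stack S i (s i))" "sum (rk S) (stack S i (s i)) < sum (rk S) A"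
      using compression[OF S(1) i sub[OF i] o[OF i], of A] A ne unfolding s_eq by auto
    then show False using least by fastforce
  qed
  have lc: "line_closed S A" using line_closed_stack[OF S(1) sub AS st] by blast
  have no_improve: False if "\<exists>B. down_set n S B \<and> card B = card A \<and>
      sum (weight w S) A \<le> sum (weight w S) B \<and> sum (rk S) B < sum (rk S) A"
    using that A least by (metis leD order_trans)
  have gap: "b \<in> A" if b: "b \<in> box n S" and a: "a \<in> A" and r: "rk S b < rk S a" for a b
  proof (rule ccontr)
    assume bA: "b \<notin> A"
    have aS: "a \<in> box n S" using a AS by blast
    have ne: "b i \<noteq> a i" if "i \<in> S" for i using line_closedD[OF lc a b that _ r] bA by blast
    define mn mx where "mn = Min S" and "mx = Max S"
    have mn: "mn \<in> S" "\<And>j. j \<in> S \<Longrightarrow> mn \<le> j" and mx: "mx \<in> S" "\<And>j. j \<in> S \<Longrightarrow> j \<le> mx"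
      using fS Sne by (auto simp: mn_def mx_def)
    have third: "\<exists>i\<in>S. i \<noteq> u \<and> i \<noteq> v" for u v
    proof -
      have "card {u, v} \<le> 2" by (simp add: card_insert_if)
      then have "\<not> S \<subseteq> {u, v}" using S(2) card_mono[of "{u, v}" S] by fastforce
      then show ?thesis by blast
    qed
    have coord: "a i \<in> {1..n i}" "p i (a i) \<in> {1..n i}" "p i (p i (a i)) = p i (a i)" "p i (a i) \<le> a i"
      "b i \<in> {1..n i}" if "i \<in> S" for i
      using p_start[of i "a i"] box_coord[OF aS that] box_coord[OF b that] that S(1) by auto
    \<comment> \<open>An index different from the largest one of \<open>S\<close> is at most
      \<open>d - 1\<close>, where the values of \<open>w i\<close> increase inside parts.\<close>
    have same: False if i: "i \<in> S" "i \<noteq> mx" "p i (b i) = p i (a i)"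
      and g: "g \<in> box n (S - {i})" "\<And>j. j \<in> S - {i} \<Longrightarrow> p j (g j) = p j (a j)"
      "\<And>j. j \<in> S - {i} \<Longrightarrow> g j \<le> a j" "rk S b < rk S (g(i := b i))"
      and gm: "\<And>x z. x \<in> box n S \<Longrightarrow> z \<in> box n S \<Longrightarrow> (\<And>j. j \<in> S \<Longrightarrow> p j (x j) = p j (a j)) \<Longrightarrow>
        (\<And>j. j \<in> S \<Longrightarrow> p j (z j) = p j (a j)) \<Longrightarrow> rk S x < rk S (g(i := x i)) \<Longrightarrow>
        rk S (g(i := z i)) \<le> rk S z \<Longrightarrow> rk S x < rk S z" for i g
    proof -
      have "i < mx" "mx \<in> {1..d}" using i mx S(1) le_neq_trans by auto
      then have "i \<le> d - 1" by auto
      have dA: "down_set n S A" using A by blast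
      show False
        by (rule no_improve, rule improve_same_part[OF S(1) i(1) S(2) sub[OF i(1)] o[OF i(1)] lc dA st[OF i(1)]
              s_def a b bA \<open>i \<le> d - 1\<close> i(3) g gm])
    qed
    show False
    proof (rule exists_pivot[OF S(1) Sne b aS r])
      show "\<And>i. i \<in> S \<Longrightarrow> b i \<noteq> a i" by (rule ne)
    next
      fix c assume c: "c \<in> S" "b c < a c" "\<And>i. i \<in> S \<Longrightarrow> p i (b i) = p i (a i)"
        and dom: "\<And>u v. u \<in> box n S \<Longrightarrow> v \<in> box n S \<Longrightarrow> (\<And>i. i \<in> S \<Longrightarrow> p i (u i) = p i (a i)) \<Longrightarrow>
          (\<And>i. i \<in> S \<Longrightarrow> p i (v i) = p i (a i)) \<Longrightarrow> u c < v c \<Longrightarrow> rk S u < rk S v"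
      \<comment> \<open>Avoiding \<open>c\<close> keeps the dominating coordinate among the
        remaining ones; avoiding \<open>mx\<close> makes \<open>w i\<close> monotone inside
        parts.\<close>
      obtain i where i: "i \<in> S" "i \<noteq> c" "i \<noteq> mx" using third by blast
      \<comment> \<open>The entry \<open>a c\<close> at the dominating coordinate and part starts
        elsewhere: within the block of \<open>a\<close>, preceding \<open>g\<close> completed by the
        tuple's own \<open>i\<close>-th entry then amounts to having \<open>c\<close>-th entry below
        \<open>a c\<close>.\<close>
      define g where "g = (\<lambda>j\<in>S - {i}. if j = c then a c else p j (a j))"
      have gb: "g \<in> box n (S - {i})" using coord by (auto simp: g_def box_def)
      have gp: "p j (g j) = p j (a j)" "g j \<le> a j" if "j \<in> S - {i}" for j
        using coord[of j] that by (auto simp: g_def)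
      have gc: "g c = a c" using c i by (simp add: g_def)
      have gup: "g(i := v) \<in> box n S" if "v \<in> {1..n i}" for v using box_upd[OF gb i(1) that] .
      have rb: "rk S b < rk S (g(i := b i))"
        using c gc gp i gup coord(5)[OF i(1)] by (intro dom[OF b]) auto
      show False
      proof (rule same[OF i(1,3) c(3)[OF i(1)] gb gp rb])
        fix x z assume x: "x \<in> box n S" "\<And>j. j \<in> S \<Longrightarrow> p j (x j) = p j (a j)"
          and z: "z \<in> box n S" "\<And>j. j \<in> S \<Longrightarrow> p j (z j) = p j (a j)"
          and rx: "rk S x < rk S (g(i := x i))" and rz: "rk S (g(i := z i)) \<le> rk S z"
        have xi: "x i \<in> {1..n i}" "z i \<in> {1..n i}" using box_coord x z i by blast+
        have "x c < a c"
        proof (rule ccontr)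
          assume "\<not> ?thesis"
          moreover have "p j (a j) \<le> x j" if "j \<in> S" for j
            using p_start[of j "x j"] x(2)[OF that] box_coord[OF x(1) that] that S(1) by auto
          ultimately have "(g(i := x i)) j \<le> x j" if "j \<in> S" for j using that by (simp add: g_def)
          then show False using rk_mono[OF S(1) Sne gup[OF xi(1)] x(1)] rx by (meson leD)
        qed
        moreover have "a c \<le> z c"
        proof (rule ccontr)
          assume "\<not> ?thesis"
          then have "rk S z < rk S (g(i := z i))"
            using gc gp i gup xi z by (intro dom[OF z(1)]) auto
          then show False using rz by simp
        qed
        ultimately show "rk S x < rk S z" using dom[OF x(1) z(1)] x z by fastforce
      qed
    next
      fix c assume c: "c \<in> S" "p c (b c) < p c (a c)" "\<And>i. i \<in> S \<Longrightarrow> i < c \<Longrightarrow> p i (b i) = p i (a i)"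
      show False
      proof (cases "c = mn")
        case True
        \<comment> \<open>Strictly between the extremes: \<open>mn\<close> decides the order,
          \<open>mx\<close> comes after \<open>i\<close> and is free for the mixed tuples, and
          \<open>w_regular\<close> applies to \<open>i\<close>.\<close>
        obtain i where i: "i \<in> S" "i \<noteq> mn" "i \<noteq> mx" using third by blast
        have "mn < i" "i < mx" using mn mx i le_neq_trans by auto
        have dA: "down_set n S A" using A by blast
        have cm: "p mn (b mn) < p mn (a mn)" using c True by simp
        show False
          by (rule no_improve, rule improve_column[OF S(1) i(1) S(2) sub[OF i(1)] o[OF i(1)] lc dA st[OF i(1)]
                s_def a b bA mn(1) \<open>mn < i\<close> mx(1) \<open>i < mx\<close> mn(2) cm])
      next
        case False
        have mc: "mn < c" using mn(2)[OF c(1)] False by simp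
        \<comment> \<open>The start of the block of \<open>a\<close>. As \<open>mn\<close> precedes
          the first coordinate with different parts, \<open>a\<close> and \<open>b\<close> share
          their part at \<open>mn\<close>, so \<open>mn\<close> can serve as \<open>i\<close>. No
          tuple in the block of \<open>a\<close> precedes this start, so the comparison required
          inside that block is vacuous.\<close>
        define g where "g = (\<lambda>j\<in>S - {mn}. p j (a j))"
        have gb: "g \<in> box n (S - {mn})" using coord by (auto simp: g_def box_def)
        have gp: "p j (g j) = p j (a j)" "g j \<le> a j" if "j \<in> S - {mn}" for j
          using coord[of j] that by (auto simp: g_def)
        have gup: "g(mn := v) \<in> box n S" if "v \<in> {1..n mn}" for v using box_upd[OF gb mn(1) that] .
        have mm: "mn \<noteq> mx" using mc mx(2)[OF c(1)] by simp
        have rb: "rk S b < rk S (g(mn := b mn))"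
        proof (rule rk_lex[OF S(1) b gup[OF coord(5)[OF mn(1)]] c(1)])
          show "p c (b c) < p c ((g(mn := b mn)) c)" using c gp[of c] mc by auto
          show "p j (b j) = p j ((g(mn := b mn)) j)" if "j \<in> S" "j < c" for j
            using c(3)[OF that] gp(1)[of j] that by (cases "j = mn") auto
        qed
        show False
        proof (rule same[OF mn(1) mm c(3)[OF mn(1) mc] gb gp rb])
          fix x z assume x: "x \<in> box n S" "\<And>j. j \<in> S \<Longrightarrow> p j (x j) = p j (a j)"
            and rx: "rk S x < rk S (g(mn := x mn))"
          have "p j (a j) \<le> x j" if "j \<in> S" for j
            using p_start[of j "x j"] x(2)[OF that] box_coord[OF x(1) that] that S(1) by auto
          then have "(g(mn := x mn)) j \<le> x j" if "j \<in> S" for j using that by (simp add: g_def)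
          then have False
            using rk_mono[OF S(1) Sne gup[OF box_coord[OF x(1) mn(1)]] x(1)] rx by (meson leD)
          then show "rk S x < rk S z" ..
        qed
      qed
    qed
  qed
  have "A = seg S (card A)"
  proof (rule card_subset_eq)
    show "finite (seg S (card A))" by (rule finite_subset[OF seg_subset finite_box[OF fS]])
    have cA: "card A \<le> card (box n S)" using AS finite_box[OF fS] by (rule card_mono[rotated])
    then show "card A = card (seg S (card A))" using seg_card_le[OF S(1) Sne] by simp
    show "A \<subseteq> seg S (card A)"
    proof
      fix a assume a: "a \<in> A"
      have aS: "a \<in> box n S" using a AS by blast
      have "seg S (rk S a) \<subseteq> A"
      proof
        fix b assume b: "b \<in> seg S (rk S a)"
        then have bS: "b \<in> box n S" "rk S b \<le> rk S a" by (auto simp: seg_def)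
        show "b \<in> A"
        proof (cases "rk S b = rk S a")
          case True
          then show ?thesis using rk_inj[OF S(1) Sne bS(1) aS] a by simp
        next
          case False
          then show ?thesis using gap[OF bS(1) a] bS(2) by simp
        qed
      qed
      moreover have "finite A" using AS finite_box[OF fS] finite_subset by blast
      ultimately have "card (seg S (rk S a)) \<le> card A" by (simp add: card_mono)
      moreover have "card (seg S (rk S a)) = rk S a"
        using rk_range[OF S(1) Sne aS] seg_card_le[OF S(1) Sne] by simp
      ultimately show "a \<in> seg S (card A)" using aS by (simp add: seg_def)
    qed
  qed
  then show "sum (weight w S) A0 \<le> sum (weight w S) (seg S (card A0))" using A by metis
qed

lemma opt_of_pairs:
  assumes pairs: "\<And>i j. i \<in> {1..d} \<Longrightarrow> j \<in> {1..d} \<Longrightarrow> i < j \<Longrightarrow> opt {i, j}"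
    and S: "S \<subseteq> {1..d}" "2 \<le> card S"
  shows "opt S"
  using S
proof (induction "card S" arbitrary: S rule: less_induct)
  case less
  have fS: "finite S" using finite_index[OF less.prems(1)] .
  show ?case
  proof (cases "card S = 2")
    case True
    obtain i j where ij: "S = {i, j}" "i \<noteq> j" using True by (meson card_2_iff)
    have "opt {i, j}"
    proof (cases "i < j")
      case True
      then show ?thesis using pairs ij less.prems(1) by auto
    next
      case False
      then have "opt {j, i}" using pairs[of j i] ij less.prems(1) by auto
      then show ?thesis by (simp only: insert_commute[of i j])
    qed
    then show ?thesis using ij by simp
  next
    case False
    show ?thesis
    proof (rule opt_step[OF less.prems(1)])
      show "3 \<le> card S" using False less.prems(2) by simp
      fix i assume "i \<in> S"
      then show "opt (S - {i})"
        using less.prems False fS by (intro less.hyps) (auto simp: card_Diff_singleton)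
    qed
  qed
qed

end

section \<open>One-dimensional compression\<close>

definition line :: "(nat \<Rightarrow> nat) \<Rightarrow> nat \<Rightarrow> (nat \<Rightarrow> nat) \<Rightarrow> (nat \<Rightarrow> nat) set \<Rightarrow> nat set" where
  "line n i z A = {t \<in> {1..n i}. z(i := t) \<in> A}"

definition lower_nbrs :: "(nat \<Rightarrow> nat) \<Rightarrow> (nat \<Rightarrow> nat \<Rightarrow> nat \<Rightarrow> bool) \<Rightarrow> nat \<Rightarrow> nat \<Rightarrow> nat set" where
  "lower_nbrs n adj i u = {t \<in> {1..n i}. t < u \<and> adj i t u}"

definition line_score :: "(nat \<Rightarrow> nat) \<Rightarrow> (nat \<Rightarrow> nat \<Rightarrow> nat \<Rightarrow> bool) \<Rightarrow> nat \<Rightarrow> nat set \<Rightarrow> nat" where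
  "line_score n adj i X = (\<Sum>u\<in>X. card (lower_nbrs n adj i u \<inter> X))"

text \<open>Edges in direction \<open>j\<close> with both ends in \<open>A\<close>, each counted at
  its later end. Unlike the weight, the count depends on which lower neighbours belong to
  \<open>A\<close>.\<close>

definition dir_score ::
    "(nat \<Rightarrow> nat) \<Rightarrow> (nat \<Rightarrow> nat \<Rightarrow> nat \<Rightarrow> bool) \<Rightarrow> (nat \<Rightarrow> nat) set \<Rightarrow> nat \<Rightarrow> nat" where
  "dir_score n adj A j = (\<Sum>x\<in>A. card {t \<in> lower_nbrs n adj j (x j). x(j := t) \<in> A})"

definition score ::
    "(nat \<Rightarrow> nat) \<Rightarrow> (nat \<Rightarrow> nat \<Rightarrow> nat \<Rightarrow> bool) \<Rightarrow> nat set \<Rightarrow> (nat \<Rightarrow> nat) set \<Rightarrow> nat" where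
  "score n adj S A = (\<Sum>j\<in>S. dir_score n adj A j)"

text \<open>Pushes every line in direction \<open>i\<close> to the bottom. In contrast to
  \<open>stack\<close>, which rearranges slices with one coordinate fixed, only optimality of the
  factor \<open>G i\<close> is involved.\<close>

definition compress :: "(nat \<Rightarrow> nat) \<Rightarrow> nat set \<Rightarrow> nat \<Rightarrow> (nat \<Rightarrow> nat) set \<Rightarrow> (nat \<Rightarrow> nat) set" where
  "compress n S i A = {x \<in> box n S. x i \<le> card (line n i x A)}"

lemma finite_line: "finite (line n i z A)"
  unfolding line_def by auto

lemma line_subset: "line n i z A \<subseteq> {1..n i}"
  unfolding line_def by blast

lemma card_line_le: "card (line n i z A) \<le> n i"
  using card_mono[OF _ line_subset, of n i z A] by simp

lemma line_upd: "line n i (z(i := v)) A = line n i z A"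
  unfolding line_def by simp

lemma line_compress:
  assumes "z \<in> box n (S - {i})" "i \<in> S"
  shows "line n i z (compress n S i A) = {1..card (line n i z A)}"
proof -
  have "z(i := t) \<in> compress n S i A \<longleftrightarrow> t \<le> card (line n i z A)" if "t \<in> {1..n i}" for t
    unfolding compress_def mem_Collect_eq line_upd fun_upd_same using box_upd[OF assms that] by blast
  then have "line n i z (compress n S i A) = {t \<in> {1..n i}. t \<le> card (line n i z A)}"
    unfolding line_def[of n i z "compress n S i A"] by blast
  also have "\<dots> = {1..card (line n i z A)}"
    using card_line_le by (auto intro: order_trans)
  finally show ?thesis .
qed

lemma compress_subset: "compress n S i A \<subseteq> box n S"
  unfolding compress_def by blast

lemma sum_lines:
  assumes "finite S" "A \<subseteq> box n S" "i \<in> S"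
  shows "sum g A = (\<Sum>z\<in>box n (S - {i}). \<Sum>v\<in>line n i z A. g (z(i := v)))"
proof -
  have "sum g A = (\<Sum>v\<in>{1..n i}. \<Sum>z\<in>{z \<in> box n (S - {i}). z(i := v) \<in> A}. g (z(i := v)))"
    using sum_slices[OF assms] by (simp add: slice_def)
  also have "\<dots> = (\<Sum>z\<in>box n (S - {i}). \<Sum>v\<in>{v \<in> {1..n i}. z(i := v) \<in> A}. g (z(i := v)))"
    using assms by (intro sum.swap_restrict finite_box) auto
  finally show ?thesis by (simp add: line_def)
qed

lemma card_compress:
  assumes "finite S" "A \<subseteq> box n S" "i \<in> S"
  shows "card (compress n S i A) = card A"
  using sum_lines[OF assms, of "\<lambda>_. 1::nat"] sum_lines[OF assms(1) compress_subset[of n S i A] assms(3), of "\<lambda>_. 1::nat"]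
    line_compress[OF _ assms(3)] by simp

lemma dir_score_same:
  assumes "finite S" "A \<subseteq> box n S" "i \<in> S"
  shows "dir_score n adj A i = (\<Sum>z\<in>box n (S - {i}). line_score n adj i (line n i z A))"
proof -
  have "{t \<in> lower_nbrs n adj i v. (z(i := v, i := t)) \<in> A} = lower_nbrs n adj i v \<inter> line n i z A" for z v
    by (auto simp: lower_nbrs_def line_def)
  then show ?thesis
    unfolding dir_score_def sum_lines[OF assms] line_score_def by simp
qed

text \<open>An edge in direction \<open>j\<close> joins two parallel lines of direction
  \<open>i\<close> at the same height, so a pair of adjacent lines carries as many edges as the
  lines have common heights.\<close>

lemma dir_score_other:
  assumes "finite S" "A \<subseteq> box n S" "i \<in> S" "j \<noteq> i"
  shows "dir_score n adj A j =
    (\<Sum>z\<in>box n (S - {i}). \<Sum>t\<in>lower_nbrs n adj j (z j). card (line n i z A \<inter> line n i (z(j := t)) A))"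
proof -
  have fin: "finite (lower_nbrs n adj j u)" for u by (simp add: lower_nbrs_def)
  have "(\<Sum>v\<in>line n i z A. card {t \<in> lower_nbrs n adj j (z j). z(i := v, j := t) \<in> A}) =
    (\<Sum>t\<in>lower_nbrs n adj j (z j). card (line n i z A \<inter> line n i (z(j := t)) A))" for z
  proof -
    have "(\<Sum>v\<in>line n i z A. card {t \<in> lower_nbrs n adj j (z j). z(i := v, j := t) \<in> A}) =
      (\<Sum>v\<in>line n i z A. \<Sum>t\<in>{t \<in> lower_nbrs n adj j (z j). z(i := v, j := t) \<in> A}. 1)" by simp
    also have "\<dots> = (\<Sum>t\<in>lower_nbrs n adj j (z j). \<Sum>v\<in>{v \<in> line n i z A. z(i := v, j := t) \<in> A}. 1)"
      by (rule sum.swap_restrict[OF finite_line fin])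
    also have "\<dots> = (\<Sum>t\<in>lower_nbrs n adj j (z j). card (line n i z A \<inter> line n i (z(j := t)) A))"
    proof (intro sum.cong refl)
      fix t
      have "z(i := v, j := t) = z(j := t, i := v)" for v using assms(4) by auto
      then have "{v \<in> line n i z A. z(i := v, j := t) \<in> A} = line n i z A \<inter> line n i (z(j := t)) A"
        by (auto simp: line_def)
      then show "(\<Sum>v\<in>{v \<in> line n i z A. z(i := v, j := t) \<in> A}. 1) = card (line n i z A \<inter> line n i (z(j := t)) A)"
        by simp
    qed
    finally show ?thesis .
  qed
  then show ?thesis
    unfolding dir_score_def sum_lines[OF assms(1-3)] using assms(4) by simp
qed

text \<open>Edges along a line do not decrease because initial segments are optimal in
  \<open>G i\<close>. Edges between two parallel lines are bounded by the smaller line, and two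
  initial segments attain this bound.\<close>

lemma score_compress:
  assumes S: "finite S" "A \<subseteq> box n S" "i \<in> S"
    and o: "\<And>X. X \<subseteq> {1..n i} \<Longrightarrow> line_score n adj i X \<le> line_score n adj i {1..card X}"
  shows "score n adj S A \<le> score n adj S (compress n S i A)"
  unfolding score_def
proof (rule sum_mono)
  fix j assume j: "j \<in> S"
  let ?B = "compress n S i A"
  have B: "?B \<subseteq> box n S" by (rule compress_subset)
  show "dir_score n adj A j \<le> dir_score n adj ?B j"
  proof (cases "j = i")
    case True
    show ?thesis
      unfolding True dir_score_same[OF S] dir_score_same[OF S(1) B S(3)]
    proof (intro sum_mono)
      fix z assume "z \<in> box n (S - {i})"
      then show "line_score n adj i (line n i z A) \<le> line_score n adj i (line n i z ?B)"
        using o[OF line_subset[of n i z A]] by (simp add: line_compress[OF _ S(3)])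
    qed
  next
    case False
    show ?thesis
      unfolding dir_score_other[OF S False] dir_score_other[OF S(1) B S(3) False]
    proof (intro sum_mono)
      fix z t assume z: "z \<in> box n (S - {i})" and t: "t \<in> lower_nbrs n adj j (z j)"
      have z': "z(j := t) \<in> box n (S - {i})"
        using j False t by (intro box_upd_same z) (auto simp: lower_nbrs_def)
      have "card (line n i z A \<inter> line n i (z(j := t)) A) \<le>
          min (card (line n i z A)) (card (line n i (z(j := t)) A))"
        by (simp add: card_mono finite_line)
      also have "\<dots> = card ({1..card (line n i z A)} \<inter> {1..card (line n i (z(j := t)) A)})"
        by simp
      also have "\<dots> = card (line n i z ?B \<inter> line n i (z(j := t)) ?B)"
        using line_compress[OF z S(3)] line_compress[OF z' S(3)] by simp
      finally show "card (line n i z A \<inter> line n i (z(j := t)) A) \<le> card (line n i z ?B \<inter> line n i (z(j := t)) ?B)" .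
    qed
  qed
qed

lemma compress_potential:
  assumes S: "finite S" "A \<subseteq> box n S" "i \<in> S" and ne: "compress n S i A \<noteq> A"
  shows "sum (\<lambda>x. \<Sum>j\<in>S. x j) (compress n S i A) < sum (\<lambda>x. \<Sum>j\<in>S. x j) A"
proof -
  let ?B = "compress n S i A" and ?g = "\<lambda>x::nat \<Rightarrow> nat. \<Sum>j\<in>S. x j"
  have B: "?B \<subseteq> box n S" by (rule compress_subset)
  let ?r = "\<lambda>A z. \<Sum>v\<in>line n i z A. ?g (z(i := v))"
  have lt: "?g (z(i := u)) < ?g (z(i := v))" if "u < v" for z u v
    using that S by (simp add: sum.remove[of S i])
  have le: "?r ?B z \<le> ?r A z" "line n i z ?B \<noteq> line n i z A \<Longrightarrow> ?r ?B z < ?r A z"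
    if z: "z \<in> box n (S - {i})" for z
  proof -
    have c: "card (line n i z ?B) = card (line n i z A)" using line_compress[OF z S(3)] by simp
    have "?g (z(i := u)) < ?g (z(i := v))"
      if "u \<in> line n i z ?B - line n i z A" "v \<in> line n i z A - line n i z ?B" for u v
    proof (rule lt)
      have "1 \<le> v" using that by (auto simp: line_def)
      then show "u < v" using that line_compress[OF z S(3), of A] by auto
    qed
    then show "?r ?B z \<le> ?r A z" "line n i z ?B \<noteq> line n i z A \<Longrightarrow> ?r ?B z < ?r A z"
      using sum_exchange[OF finite_line finite_line c, of "\<lambda>v. ?g (z(i := v))"] by blast+
  qed
  have "\<exists>z\<in>box n (S - {i}). line n i z ?B \<noteq> line n i z A"
  proof (rule ccontr)
    assume "\<not> ?thesis"
    then have eq: "line n i z ?B = line n i z A" if "z \<in> box n (S - {i})" for z using that by blast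
    have "slice n S i v ?B = slice n S i v A" if v: "v \<in> {1..n i}" for v
    proof -
      have "z(i := v) \<in> ?B \<longleftrightarrow> z(i := v) \<in> A" if "z \<in> box n (S - {i})" for z
        using eq[OF that] v unfolding line_def by blast
      then show ?thesis unfolding slice_def by blast
    qed
    then show False using ne slice_eqI[OF B S(2,3)] by blast
  qed
  then show ?thesis
    unfolding sum_lines[OF S] sum_lines[OF S(1) B S(3)]
    by (intro sum_strict_mono_ex1 finite_box) (use S le in auto)
qed

text \<open>The entries of \<open>x\<close> are lowered to those of \<open>y\<close> one coordinate
  at a time; \<open>F\<close> collects the coordinates already changed.\<close>

lemma down_set_of_steps:
  assumes S: "finite S" and A: "A \<subseteq> box n S"
    and step: "\<And>x i t. x \<in> A \<Longrightarrow> i \<in> S \<Longrightarrow> 1 \<le> t \<Longrightarrow> t \<le> x i \<Longrightarrow> x(i := t) \<in> A"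
  shows "down_set n S A"
  unfolding down_set_def
proof (intro conjI ballI impI A)
  fix x y assume x: "x \<in> A" and y: "y \<in> box n S" and le: "\<forall>i\<in>S. y i \<le> x i"
  have "(\<lambda>i. if i \<in> F then y i else x i) \<in> A" if "finite F" "F \<subseteq> S" for F
    using that
  proof (induction F)
    case empty
    then show ?case using x by simp
  next
    case (insert a F)
    have "(\<lambda>i. if i \<in> insert a F then y i else x i) = (\<lambda>i. if i \<in> F then y i else x i)(a := y a)"
      by auto
    moreover have "\<dots> \<in> A"
      using insert le box_coord[OF y, of a] by (intro step) auto
    ultimately show ?case by simp
  qed
  from this[OF S] have "(\<lambda>i. if i \<in> S then y i else x i) \<in> A" by simp
  moreover have "x \<in> box n S" using x A by blast
  then have "x i = y i" if "i \<notin> S" for i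
    using PiE_arb[OF _ that, of x] PiE_arb[OF _ that, of y] y unfolding box_def by metis
  then have "(\<lambda>i. if i \<in> S then y i else x i) = y" by auto
  ultimately show "y \<in> A" by simp
qed

lemma exists_down_set:
  assumes S: "finite S" "A \<subseteq> box n S"
    and o: "\<And>i X. i \<in> S \<Longrightarrow> X \<subseteq> {1..n i} \<Longrightarrow> line_score n adj i X \<le> line_score n adj i {1..card X}"
  shows "\<exists>B. down_set n S B \<and> card B = card A \<and> score n adj S A \<le> score n adj S B"
proof -
  let ?P = "\<lambda>B. B \<subseteq> box n S \<and> card B = card A \<and> score n adj S A \<le> score n adj S B"
  obtain B where B: "?P B" and least: "\<And>C. ?P C \<Longrightarrow> sum (\<lambda>x. \<Sum>j\<in>S. x j) B \<le> sum (\<lambda>x. \<Sum>j\<in>S. x j) C"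
    using ex_has_least_nat[of ?P A "sum (\<lambda>x. \<Sum>j\<in>S. x j)"] S by auto
  have fixed: "compress n S i B = B" if i: "i \<in> S" for i
  proof (rule ccontr)
    assume ne: "compress n S i B \<noteq> B"
    have BS: "B \<subseteq> box n S" using B by blast
    have "score n adj S B \<le> score n adj S (compress n S i B)"
      by (rule score_compress[OF S(1) BS i o[OF i]])
    then have "?P (compress n S i B)"
      using B card_compress[OF S(1) BS i] compress_subset[of n S i B] by auto
    then show False using least[of "compress n S i B"] compress_potential[OF S(1) BS i ne] by simp
  qed
  have "down_set n S B"
  proof (rule down_set_of_steps[OF S(1)])
    show "B \<subseteq> box n S" using B by blast
    fix x i t assume x: "x \<in> B" "i \<in> S" "1 \<le> t" "t \<le> x i"
    have xb: "x \<in> box n S" using x B by blast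
    have "x(i := t) \<in> box n S" using box_upd_same[OF xb x(2)] box_coord[OF xb x(2)] x by auto
    moreover have "x i \<le> card (line n i x B)" using fixed[OF x(2)] x(1) by (auto simp: compress_def)
    ultimately have "x(i := t) \<in> compress n S i B" using x by (simp add: compress_def line_upd)
    then show "x(i := t) \<in> B" using fixed[OF x(2)] by simp
  qed
  then show ?thesis using B by blast
qed

text \<open>All lower neighbours of an element of a down-set are present, so the number of edges
  counted at an element no longer depends on the set. This is where edge counts become
  additive.\<close>

lemma score_down_set:
  assumes S: "finite S" and A: "down_set n S A"
  shows "score n adj S A = sum (weight (\<lambda>i u. card (lower_nbrs n adj i u)) S) A"
proof -
  have "{t \<in> lower_nbrs n adj j (x j). x(j := t) \<in> A} = lower_nbrs n adj j (x j)" if "x \<in> A" "j \<in> S" for x j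
  proof -
    have xb: "x \<in> box n S" using that A by (auto simp: down_set_def)
    have "x(j := t) \<in> A" if t: "t \<in> lower_nbrs n adj j (x j)" for t
    proof (rule down_setD[OF A \<open>x \<in> A\<close>])
      show "x(j := t) \<in> box n S" using t by (intro box_upd_same xb \<open>j \<in> S\<close>) (auto simp: lower_nbrs_def)
    qed (use t in \<open>auto simp: lower_nbrs_def\<close>)
    then show ?thesis by blast
  qed
  then have "score n adj S A = (\<Sum>j\<in>S. \<Sum>x\<in>A. card (lower_nbrs n adj j (x j)))"
    unfolding score_def dir_score_def by (intro sum.cong refl) auto
  also have "\<dots> = (\<Sum>x\<in>A. \<Sum>j\<in>S. card (lower_nbrs n adj j (x j)))" by (rule sum.swap)
  finally show ?thesis by (simp add: weight_def)
qed

section \<open>Optimal orders and isoperimetric partitions\<close>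

text \<open>A function \<open>f\<close> that separates the ends of every edge orients the edges, and
  each edge is counted at its end of larger value.\<close>

lemma card_induced_edges:
  fixes f :: "'a \<Rightarrow> nat"
  assumes G: "simple_graph G" and X: "finite X"
    and f: "\<And>x y. x \<in> X \<Longrightarrow> y \<in> X \<Longrightarrow> {x, y} \<in> edges G \<Longrightarrow> f x \<noteq> f y"
  shows "card (induced_edges G X) = (\<Sum>x\<in>X. card {y \<in> X. f y < f x \<and> {x, y} \<in> edges G})"
proof -
  let ?S = "SIGMA x:X. {y \<in> X. f y < f x \<and> {x, y} \<in> edges G}"
  have "bij_betw (\<lambda>(x, y). {x, y}) ?S (induced_edges G X)"
    unfolding bij_betw_def
  proof
    show "inj_on (\<lambda>(x, y). {x, y}) ?S" by (auto simp: inj_on_def doubleton_eq_iff)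
    show "(\<lambda>(x, y). {x, y}) ` ?S = induced_edges G X"
    proof
      show "(\<lambda>(x, y). {x, y}) ` ?S \<subseteq> induced_edges G X"
        by (auto simp: induced_edges_def edges_between_def)
      show "induced_edges G X \<subseteq> (\<lambda>(x, y). {x, y}) ` ?S"
      proof
        fix e assume "e \<in> induced_edges G X"
        then obtain u v where uv: "u \<in> X" "v \<in> X" "e = {u, v}" "{u, v} \<in> edges G"
          by (auto simp: induced_edges_def edges_between_def)
        consider "f v < f u" | "f u < f v" using f[OF uv(1,2,4)] by linarith
        then show "e \<in> (\<lambda>(x, y). {x, y}) ` ?S"
        proof cases
          case 1
          then show ?thesis using uv by (intro image_eqI[of _ _ "(u, v)"]) auto
        next
          case 2
          then show ?thesis using uv by (intro image_eqI[of _ _ "(v, u)"]) (auto simp: insert_commute)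
        qed
      qed
    qed
  qed
  then have "card ?S = card (induced_edges G X)" by (rule bij_betw_same_card)
  then show ?thesis using X by (simp flip: card_SigmaI)
qed

lemma finite_edge_counts:
  assumes "finite (verts G)"
  shows "finite {card (induced_edges G Y) | Y. Y \<subseteq> verts G \<and> card Y = k}"
proof (rule finite_subset)
  show "finite ((\<lambda>Y. card (induced_edges G Y)) ` Pow (verts G))" using assms by simp
qed blast

lemma max_edges_ge:
  assumes "simple_graph G" "X \<subseteq> verts G"
  shows "card (induced_edges G X) \<le> max_edges G (card X)"
proof -
  have "finite (verts G)" using assms by (simp add: simple_graph_def)
  then have "finite {card (induced_edges G Y) | Y. Y \<subseteq> verts G \<and> card Y = card X}"
    by (rule finite_edge_counts)
  then show ?thesis unfolding max_edges_def using assms by (intro Max_ge) auto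
qed

lemma max_edges_attained:
  assumes "simple_graph G" "k \<le> card (verts G)"
  shows "\<exists>X\<subseteq>verts G. card X = k \<and> max_edges G k = card (induced_edges G X)"
proof -
  let ?M = "{card (induced_edges G Y) | Y. Y \<subseteq> verts G \<and> card Y = k}"
  have "finite (verts G)" using assms by (simp add: simple_graph_def)
  then have "finite ?M" by (rule finite_edge_counts)
  moreover have "?M \<noteq> {}" using obtain_subset_with_card_n[OF assms(2)] by blast
  ultimately have "Max ?M \<in> ?M" by (rule Max_in)
  then show ?thesis unfolding max_edges_def by auto
qed

lemma segment_card:
  assumes "total_order G r" "k \<le> card (verts G)"
  shows "card (segment G r 1 k) = k"
proof -
  have b: "bij_betw r (verts G) {1..card (verts G)}" using assms by (simp add: total_order_def)
  have "bij_betw r (segment G r 1 k) {1..k}"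
    unfolding bij_betw_def
  proof
    show "inj_on r (segment G r 1 k)"
      using b by (auto simp: bij_betw_def segment_def intro: inj_on_subset)
    show "r ` segment G r 1 k = {1..k}"
    proof
      show "{1..k} \<subseteq> r ` segment G r 1 k"
      proof
        fix j assume j: "j \<in> {1..k}"
        then have "j \<in> r ` verts G" using b assms by (auto simp: bij_betw_def)
        then show "j \<in> r ` segment G r 1 k" using j by (auto simp: segment_def)
      qed
    qed (auto simp: segment_def)
  qed
  then show ?thesis using bij_betw_same_card by fastforce
qed

text \<open>For sizes up to the number of vertices the maximum is attained, so optimality is a
  comparison of each vertex set with the segment of its size, without \<open>Max\<close>.\<close>

lemma optimal_order_iff:
  assumes G: "simple_graph G"
  shows "optimal_order G r \<longleftrightarrow> total_order G r \<and>
    (\<forall>X\<subseteq>verts G. card (induced_edges G X) \<le> card (induced_edges G (segment G r 1 (card X))))"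
proof
  assume o: "optimal_order G r"
  have fin: "finite (verts G)" using G by (simp add: simple_graph_def)
  have "card (induced_edges G X) \<le> card (induced_edges G (segment G r 1 (card X)))" if "X \<subseteq> verts G" for X
    using o max_edges_ge[OF G that] card_mono[OF fin that] by (simp add: optimal_order_def)
  then show "total_order G r \<and>
    (\<forall>X\<subseteq>verts G. card (induced_edges G X) \<le> card (induced_edges G (segment G r 1 (card X))))"
    using o by (simp add: optimal_order_def)
next
  assume a: "total_order G r \<and>
    (\<forall>X\<subseteq>verts G. card (induced_edges G X) \<le> card (induced_edges G (segment G r 1 (card X))))"
  have "card (induced_edges G (segment G r 1 k)) = max_edges G k" if k: "k \<le> card (verts G)" for k
  proof (rule antisym)
    have "segment G r 1 k \<subseteq> verts G" by (auto simp: segment_def)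
    then show "card (induced_edges G (segment G r 1 k)) \<le> max_edges G k"
      using max_edges_ge[OF G] segment_card[of G r k] a k by metis
    obtain X where "X \<subseteq> verts G" "card X = k" "max_edges G k = card (induced_edges G X)"
      using max_edges_attained[OF G k] by blast
    then show "max_edges G k \<le> card (induced_edges G (segment G r 1 k))" using a by auto
  qed
  then show "optimal_order G r" using a by (simp add: optimal_order_def)
qed

definition lower_degree :: "'a ugraph \<Rightarrow> ('a \<Rightarrow> nat) \<Rightarrow> 'a \<Rightarrow> nat" where
  "lower_degree G r v = card {u \<in> verts G. r u < r v \<and> {v, u} \<in> edges G}"

text \<open>Two consecutive segments attain consecutive maxima and differ by one vertex, whose new
  edges lead to its earlier neighbours.\<close>

lemma delta_eq_lower_degree:
  assumes G: "simple_graph G" and o: "optimal_order G r" and v: "v \<in> verts G"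
  shows "delta G (r v) = int (lower_degree G r v)"
proof -
  have b: "bij_betw r (verts G) {1..card (verts G)}" using o by (simp add: optimal_order_def total_order_def)
  have fin: "finite (verts G)" using G by (simp add: simple_graph_def)
  have inj: "inj_on r (verts G)" using b by (simp add: bij_betw_def)
  have rv: "r v \<in> {1..card (verts G)}" using b v by (auto simp: bij_betw_def)
  have rng: "1 \<le> r u" if "u \<in> verts G" for u using b that by (auto simp: bij_betw_def)
  have loop: "{x, x} \<notin> edges G" for x using G by (auto simp: simple_graph_def doubleton_eq_iff)
  have cnt: "card (induced_edges G (segment G r 1 k)) = (\<Sum>x\<in>segment G r 1 k. lower_degree G r x)" for k
  proof -
    have "card (induced_edges G (segment G r 1 k)) =
      (\<Sum>x\<in>segment G r 1 k. card {y \<in> segment G r 1 k. r y < r x \<and> {x, y} \<in> edges G})"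
    proof (rule card_induced_edges[OF G])
      show "finite (segment G r 1 k)" using fin by (simp add: segment_def)
      show "r x \<noteq> r y" if "x \<in> segment G r 1 k" "y \<in> segment G r 1 k" "{x, y} \<in> edges G" for x y
        using that loop[of x] inj_onD[OF inj, of x y] by (auto simp: segment_def)
    qed
    also have "\<dots> = (\<Sum>x\<in>segment G r 1 k. lower_degree G r x)"
      unfolding lower_degree_def using rng
      by (intro sum.cong refl arg_cong[where f = card]) (auto simp: segment_def)
    finally show ?thesis .
  qed
  show ?thesis
  proof (cases "r v \<le> 1")
    case True
    then have "{u \<in> verts G. r u < r v \<and> {v, u} \<in> edges G} = {}" using rng by fastforce
    then have "lower_degree G r v = 0" unfolding lower_degree_def by (simp only: card.empty)
    then show ?thesis using True by (simp add: delta_def)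
  next
    case False
    have seg: "segment G r 1 (r v) = insert v (segment G r 1 (r v - 1))"
    proof -
      have "r u \<le> r v - 1 \<or> u = v" if "u \<in> verts G" "r u \<le> r v" for u
        using that v inj_onD[OF inj, of u v] by (cases "r u = r v") auto
      then show ?thesis using v rv by (auto simp: segment_def)
    qed
    have new: "v \<notin> segment G r 1 (r v - 1)" "finite (segment G r 1 (r v - 1))"
      using False fin by (auto simp: segment_def)
    have "card (induced_edges G (segment G r 1 (r v))) =
        lower_degree G r v + card (induced_edges G (segment G r 1 (r v - 1)))"
      using cnt[of "r v"] cnt[of "r v - 1"] sum.insert[OF new(2,1), of "lower_degree G r"] by (simp only: seg)
    moreover have "card (induced_edges G (segment G r 1 (r v))) = max_edges G (r v)"
      "card (induced_edges G (segment G r 1 (r v - 1))) = max_edges G (r v - 1)"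
      using o rv by (auto simp: optimal_order_def)
    ultimately show ?thesis using False by (simp add: delta_def)
  qed
qed

lemma simple_induced_subgraph:
  assumes "simple_graph G" "Z \<subseteq> verts G"
  shows "simple_graph (induced_subgraph G Z)"
  unfolding simple_graph_def
proof (intro conjI subsetI)
  show "finite (verts (induced_subgraph G Z))"
    using assms finite_subset by (auto simp: simple_graph_def induced_subgraph_def)
  fix e assume "e \<in> edges (induced_subgraph G Z)"
  then obtain x y where e: "e \<in> edges G" "x \<in> Z" "y \<in> Z" "e = {x, y}"
    by (auto simp: induced_subgraph_def induced_edges_def edges_between_def)
  moreover have "x \<noteq> y" using assms(1) e by (auto simp: simple_graph_def doubleton_eq_iff)
  ultimately show "e \<in> {{u, v} | u v. u \<in> verts (induced_subgraph G Z) \<and> v \<in> verts (induced_subgraph G Z) \<and> u \<noteq> v}"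
    by (auto simp: induced_subgraph_def)
qed

definition part_of :: "'a set set \<Rightarrow> 'a \<Rightarrow> 'a set" where
  "part_of P v = (THE Z. Z \<in> P \<and> v \<in> Z)"

text \<open>The earlier neighbours of \<open>u\<close> split at the beginning of its part. Those
  before the part number \<open>delta G A\<close>, the same for all its vertices by the second
  condition on the partition; those inside are counted by \<open>delta\<close> of the induced
  subgraph at the relative position of \<open>u\<close>.\<close>

lemma part_structure:
  assumes G: "simple_graph G" and o: "optimal_order G r" and P: "isoperimetric_partition G r P"
    and v: "v \<in> verts G"
  obtains A B where "1 \<le> A" "A \<le> r v" "r v \<le> B" "B \<le> card (verts G)"
    "part_of P v \<in> P" "r (start r (part_of P v)) = A" "part_of P v = segment G r A B"
    "\<And>u. u \<in> segment G r A B \<Longrightarrow> part_of P u = part_of P v"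
    "\<And>u. u \<in> segment G r A B \<Longrightarrow>
      int (lower_degree G r u) = delta G A + delta (induced_subgraph G (segment G r A B)) (r u - A + 1)"
proof -
  have b: "bij_betw r (verts G) {1..card (verts G)}" using o by (simp add: optimal_order_def total_order_def)
  have fin: "finite (verts G)" using G by (simp add: simple_graph_def)
  have inj: "inj_on r (verts G)" using b by (simp add: bij_betw_def)
  have rng: "r u \<in> {1..card (verts G)}" if "u \<in> verts G" for u using b that by (auto simp: bij_betw_def)
  have surj: "\<exists>u\<in>verts G. r u = t" if "t \<in> {1..card (verts G)}" for t
    using b that unfolding bij_betw_def by (metis imageE)
  obtain k a e where k: "1 \<le> k" "P = (\<lambda>i. segment G r (a i) (e i)) ` {1..k}"
    and a1: "a 1 = 1" and next': "\<And>i. i \<in> {1..<k} \<Longrightarrow> a (Suc i) = e i + 1"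
    and ek: "e k = card (verts G)" and ae: "\<And>i. i \<in> {1..k} \<Longrightarrow> a i \<le> e i"
    and opt: "\<And>i. i \<in> {1..k} \<Longrightarrow> optimal_rel (induced_subgraph G (segment G r (a i) (e i))) (\<lambda>u v. r u < r v)"
    and prev: "\<And>i u. i \<in> {1..k} \<Longrightarrow> u \<in> segment G r (a i) (e i) \<Longrightarrow>
      int (card (edges_between G (segment G r (a 1) (a i - 1)) {u})) = delta G (a i)"
    using P unfolding isoperimetric_partition_def by blast
  have gap: "e i < a j" if "i \<in> {1..k}" "j \<in> {1..k}" "i < j" for i j
    using that
  proof (induction j)
    case (Suc j)
    then have j: "a (Suc j) = e j + 1" using next'[of j] by auto
    show ?case
    proof (cases "i = j")
      case False
      then have "e i < a j" using Suc by auto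
      also have "\<dots> \<le> e j" using ae Suc.prems False by auto
      finally show ?thesis using j by simp
    qed (use j in simp)
  qed simp
  have cover: "\<exists>i\<in>{1..m}. t \<in> {a i..e i}" if "m \<in> {1..k}" "t \<in> {1..e m}" for m t
    using that
  proof (induction m)
    case (Suc m)
    show ?case
    proof (cases "m = 0")
      case True
      then show ?thesis using Suc.prems a1 by auto
    next
      case False
      then have am: "a (Suc m) = e m + 1" using next'[of m] Suc.prems by auto
      show ?thesis
      proof (cases "t \<le> e m")
        case True
        then obtain i where "i \<in> {1..m}" "t \<in> {a i..e i}" using Suc False by auto
        then show ?thesis by (intro bexI[of _ i]) auto
      next
        case f: False
        then show ?thesis using am Suc.prems by (intro bexI[of _ "Suc m"]) auto
      qed
    qed
  qed simp
  obtain i where i: "i \<in> {1..k}" "r v \<in> {a i..e i}" using cover[of k "r v"] rng[OF v] k ek by auto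
  let ?A = "a i" and ?B = "e i"
  let ?Z = "segment G r ?A ?B"
  have uniq: "j = i" if "j \<in> {1..k}" "u \<in> ?Z" "u \<in> segment G r (a j) (e j)" for j u
    using gap[OF that(1) i(1)] gap[OF i(1) that(1)] that by (cases i j rule: linorder_cases) (auto simp: segment_def)
  have part: "part_of P u = ?Z" if u: "u \<in> ?Z" for u
    unfolding part_of_def
  proof (rule the_equality)
    show "?Z \<in> P \<and> u \<in> ?Z" using u k i by auto
    show "Z = ?Z" if Z: "Z \<in> P \<and> u \<in> Z" for Z
    proof -
      obtain j where j: "j \<in> {1..k}" "Z = segment G r (a j) (e j)" using Z k(2) by blast
      then have "j = i" using uniq[OF j(1) u] Z by blast
      then show ?thesis using j by simp
    qed
  qed
  have vZ: "v \<in> ?Z" using v i by (simp add: segment_def)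
  have A1: "1 \<le> ?A"
  proof (cases "i = 1")
    case False
    then have "e 1 < a i" using gap[of 1 i] i by auto
    then show ?thesis by simp
  qed (use a1 in simp)
  have Bn: "?B \<le> card (verts G)"
  proof (cases "i = k")
    case False
    then have "e i < a k" using gap[of i k] i by auto
    then show ?thesis using ae[of k] ek k by auto
  qed (simp add: ek)
  have fZ: "finite ?Z" using fin by (simp add: segment_def)
  have "start r ?Z = arg_min_on r ?Z" by (simp add: start_def)
  then have st: "start r ?Z \<in> ?Z" "\<And>u. u \<in> ?Z \<Longrightarrow> r (start r ?Z) \<le> r u"
    using arg_min_if_finite[OF fZ, of r] vZ by (auto simp: not_less)
  obtain u0 where u0: "u0 \<in> verts G" "r u0 = ?A" using surj[of ?A] A1 i Bn by auto
  then have "u0 \<in> ?Z" using i by (auto simp: segment_def)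
  then have start: "r (start r ?Z) = ?A" using st(1) st(2)[of u0] u0 by (auto simp: segment_def)
  have deg: "int (lower_degree G r u) = delta G ?A + delta (induced_subgraph G ?Z) (r u - ?A + 1)" if u: "u \<in> ?Z" for u
  proof -
    let ?H = "induced_subgraph G ?Z"
    let ?om = "order_map (verts ?H) (\<lambda>u v. r u < r v)"
    have ZV: "?Z \<subseteq> verts G" by (auto simp: segment_def)
    have H: "simple_graph ?H" using simple_induced_subgraph[OF G ZV] .
    have vH: "verts ?H = ?Z" by (simp add: induced_subgraph_def)
    have om: "?om x = r x - ?A + 1" if x: "x \<in> ?Z" for x
    proof -
      have "bij_betw r {y \<in> ?Z. r y < r x} {?A..<r x}"
        unfolding bij_betw_def
      proof
        show "inj_on r {y \<in> ?Z. r y < r x}" using inj by (rule inj_on_subset) (auto simp: segment_def)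
        show "r ` {y \<in> ?Z. r y < r x} = {?A..<r x}"
        proof
          show "{?A..<r x} \<subseteq> r ` {y \<in> ?Z. r y < r x}"
          proof
            fix t assume t: "t \<in> {?A..<r x}"
            then obtain y where "y \<in> verts G" "r y = t" using surj[of t] A1 rng[of x] x by (auto simp: segment_def)
            then show "t \<in> r ` {y \<in> ?Z. r y < r x}" using t x by (auto simp: segment_def)
          qed
        qed (auto simp: segment_def)
      qed
      then have "card {y \<in> ?Z. r y < r x} = r x - ?A" using bij_betw_same_card by fastforce
      then show ?thesis by (simp add: order_map_def vH)
    qed
    have "optimal_order ?H ?om" using opt[OF i(1)] by (simp add: optimal_rel_def)
    then have "delta ?H (?om u) = int (lower_degree ?H ?om u)" using delta_eq_lower_degree[OF H] u vH by blast
    also have "lower_degree ?H ?om u = card {y \<in> ?Z. r y < r u \<and> {u, y} \<in> edges G}"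
      unfolding lower_degree_def
    proof (rule arg_cong[where f = card])
      have "?om y < ?om u \<longleftrightarrow> r y < r u" if "y \<in> ?Z" for y
        unfolding om[OF that] om[OF u] using that u by (auto simp: segment_def)
      moreover have "{u, y} \<in> edges ?H \<longleftrightarrow> {u, y} \<in> edges G" if "y \<in> ?Z" for y
        using that u by (auto simp: induced_subgraph_def induced_edges_def edges_between_def)
      ultimately show "{y \<in> verts ?H. ?om y < ?om u \<and> {u, y} \<in> edges ?H} = {y \<in> ?Z. r y < r u \<and> {u, y} \<in> edges G}"
        unfolding vH by blast
    qed
    finally have in_part: "delta ?H (r u - ?A + 1) = int (card {y \<in> ?Z. r y < r u \<and> {u, y} \<in> edges G})"
      using om[OF u] by simp
    let ?Y = "{y \<in> verts G. r y < ?A \<and> {u, y} \<in> edges G}"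
    have uA: "?A \<le> r u" using u by (simp add: segment_def)
    have "edges_between G (segment G r (a 1) (?A - 1)) {u} = (\<lambda>y. {y, u}) ` ?Y"
    proof (intro equalityI subsetI)
      fix s assume "s \<in> edges_between G (segment G r (a 1) (?A - 1)) {u}"
      then obtain y where y: "s = {y, u}" "s \<in> edges G" "y \<in> verts G" "r y \<le> ?A - 1"
        by (auto simp: edges_between_def segment_def)
      then have "r y < ?A" "{u, y} \<in> edges G" using A1 by (auto simp: insert_commute)
      then show "s \<in> (\<lambda>y. {y, u}) ` ?Y" using y by blast
    next
      fix s assume "s \<in> (\<lambda>y. {y, u}) ` ?Y"
      then obtain y where y: "s = {y, u}" "y \<in> verts G" "r y < ?A" "{y, u} \<in> edges G"
        by (auto simp: insert_commute)
      moreover have "r y \<in> {a 1..?A - 1}" using y rng[of y] a1 by auto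
      ultimately show "s \<in> edges_between G (segment G r (a 1) (?A - 1)) {u}"
        unfolding edges_between_def segment_def by blast
    qed
    moreover have "inj_on (\<lambda>y. {y, u}) ?Y" by (auto simp: inj_on_def doubleton_eq_iff)
    ultimately have before: "int (card ?Y) = delta G ?A" using prev[OF i(1) u] by (simp add: card_image)
    have "{y \<in> verts G. r y < r u \<and> {u, y} \<in> edges G} = ?Y \<union> {y \<in> ?Z. r y < r u \<and> {u, y} \<in> edges G}"
      using uA u by (auto simp: segment_def)
    moreover have "card (?Y \<union> {y \<in> ?Z. r y < r u \<and> {u, y} \<in> edges G}) =
        card ?Y + card {y \<in> ?Z. r y < r u \<and> {u, y} \<in> edges G}"
      using fin fZ by (intro card_Un_disjoint) (auto simp: segment_def)
    ultimately show ?thesis unfolding lower_degree_def using before in_part by simp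
  qed
  show thesis
    using A1 i(2) Bn part[OF vZ] start k(2) i(1) deg part by (intro that[of ?A ?B]) auto
qed

section \<open>Lexicographic orders and ranks\<close>

lemma lex_less_irrefl: "\<not> lex_less k x x"
  unfolding lex_less_def by simp

lemma lex_less_trans:
  assumes "lex_less k x y" "lex_less k y z"
  shows "lex_less k x z"
proof -
  obtain i where i: "i < k" "\<And>j. j \<in> {1..i} \<Longrightarrow> x j = y j" "x (i + 1) < y (i + 1)"
    using assms(1) unfolding lex_less_def by blast
  obtain l where l: "l < k" "\<And>j. j \<in> {1..l} \<Longrightarrow> y j = z j" "y (l + 1) < z (l + 1)"
    using assms(2) unfolding lex_less_def by blast
  have "x j = z j" if "j \<in> {1..min i l}" for j using i(2)[of j] l(2)[of j] that by simp
  moreover have "x (min i l + 1) < z (min i l + 1)"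
  proof (cases i l rule: linorder_cases)
    case less
    then show ?thesis using i(3) l(2)[of "i + 1"] by simp
  next
    case equal
    then show ?thesis using i(3) l(3) by simp
  next
    case greater
    then show ?thesis using l(3) i(2)[of "l + 1"] by simp
  qed
  ultimately show ?thesis unfolding lex_less_def using i(1) l(1) by (intro exI[of _ "min i l"]) auto
qed

lemma lex_less_first:
  fixes x y :: "nat \<Rightarrow> 'b::linorder"
  assumes "\<exists>j\<in>{1..k}. x j \<noteq> y j"
  obtains c where "c \<in> {1..k}" "x c \<noteq> y c" "\<And>j. j \<in> {1..k} \<Longrightarrow> j < c \<Longrightarrow> x j = y j"
    "x c < y c \<Longrightarrow> lex_less k x y" "y c < x c \<Longrightarrow> lex_less k y x"
proof -
  let ?D = "{j \<in> {1..k}. x j \<noteq> y j}"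
  have D: "finite ?D" "?D \<noteq> {}" using assms by auto
  define c where "c = Min ?D"
  have c: "c \<in> ?D" unfolding c_def by (rule Min_in[OF D])
  have less: "x j = y j" if "j \<in> {1..k}" "j < c" for j
    using Min_le[OF D(1), of j] that unfolding c_def[symmetric] by auto
  have "\<exists>i<k. (\<forall>j\<in>{1..i}. x j = y j) \<and> i + 1 = c"
    using c less by (intro exI[of _ "c - 1"]) auto
  then have "x c < y c \<Longrightarrow> lex_less k x y" "y c < x c \<Longrightarrow> lex_less k y x"
    unfolding lex_less_def by metis+
  then show thesis using that c less by blast
qed

lemma lex_less_cong:
  assumes "\<And>j. j \<in> {1..k} \<Longrightarrow> x j = x' j" "\<And>j. j \<in> {1..k} \<Longrightarrow> y j = y' j"
  shows "lex_less k x y \<longleftrightarrow> lex_less k x' y'"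
  unfolding lex_less_def
proof (intro ex_cong1 conj_cong refl ball_cong)
  fix i j assume "i < k" "j \<in> {1..i}"
  then have "j \<in> {1..k}" by simp
  then show "(x j = y j) = (x' j = y' j)" using assms by simp
next
  fix i assume "i < k"
  then have "i + 1 \<in> {1..k}" by simp
  then show "(x (i + 1) < y (i + 1)) = (x' (i + 1) < y' (i + 1))" using assms by simp
qed

lemma nth_index_bij:
  assumes "finite S"
  shows "bij_betw (nth_index S) {1..card S} S"
proof -
  have "bij_betw (\<lambda>j. sorted_list_of_set S ! j) {..<card S} S"
    using bij_betw_nth[of "sorted_list_of_set S"] assms by simp
  moreover have "bij_betw (\<lambda>j. j - 1) {1..card S} {..<card S}"
    by (rule bij_betw_byWitness[where f' = Suc]) auto
  ultimately show ?thesis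
    using bij_betw_trans unfolding nth_index_def comp_def by fastforce
qed

lemma nth_index_less:
  assumes "finite S" "j \<in> {1..card S}" "l \<in> {1..card S}" "j < l"
  shows "nth_index S j < nth_index S l"
  using sorted_wrt_nth_less[OF strict_sorted_list_of_set[of S], of "j - 1" "l - 1"] assms
  by (simp add: nth_index_def)

lemma order_map_strict:
  assumes W: "finite W" and irr: "\<And>u. u \<in> W \<Longrightarrow> \<not> r u u"
    and tr: "\<And>u v x. u \<in> W \<Longrightarrow> v \<in> W \<Longrightarrow> x \<in> W \<Longrightarrow> r u v \<Longrightarrow> r v x \<Longrightarrow> r u x"
    and tot: "\<And>u v. u \<in> W \<Longrightarrow> v \<in> W \<Longrightarrow> u \<noteq> v \<Longrightarrow> r u v \<or> r v u"
  shows "bij_betw (order_map W r) W {1..card W}"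
    and "\<And>u v. u \<in> W \<Longrightarrow> v \<in> W \<Longrightarrow> order_map W r u < order_map W r v \<longleftrightarrow> r u v"
proof -
  have up: "order_map W r u < order_map W r v" if "u \<in> W" "v \<in> W" "r u v" for u v
  proof -
    have "{x \<in> W. r x u} \<subset> {x \<in> W. r x v}" using that irr tr by blast
    then show ?thesis using W by (simp add: order_map_def psubset_card_mono)
  qed
  show iff: "order_map W r u < order_map W r v \<longleftrightarrow> r u v" if "u \<in> W" "v \<in> W" for u v
    using up[OF that] up[OF that(2,1)] tot[OF that] by fastforce
  have inj: "inj_on (order_map W r) W"
    using up tot by (intro inj_onI) (metis less_irrefl)
  have "order_map W r v \<in> {1..card W}" if "v \<in> W" for v
  proof -
    have "{x \<in> W. r x v} \<subset> W" using irr that by blast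
    then have "card {x \<in> W. r x v} < card W" by (rule psubset_card_mono[OF W])
    then show ?thesis by (simp add: order_map_def)
  qed
  then have "order_map W r ` W \<subseteq> {1..card W}" by blast
  then have "order_map W r ` W = {1..card W}"
    using card_image[OF inj] by (intro card_subset_eq) auto
  then show "bij_betw (order_map W r) W {1..card W}" using inj by (simp add: bij_betw_def)
qed

section \<open>Products of graphs\<close>

locale graph_product =
  fixes d :: nat and G :: "nat \<Rightarrow> 'a ugraph" and ord :: "nat \<Rightarrow> 'a \<Rightarrow> nat" and P :: "nat \<Rightarrow> 'a set set"
  assumes simple: "\<And>i. i \<in> {1..d} \<Longrightarrow> simple_graph (G i)"
    and optimal: "\<And>i. i \<in> {1..d} \<Longrightarrow> optimal_order (G i) (ord i)"
    and partition: "\<And>i. i \<in> {1..d} \<Longrightarrow> isoperimetric_partition (G i) (ord i) (P i)"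
begin

definition n :: "nat \<Rightarrow> nat" where
  "n i = card (verts (G i))"

definition vtx :: "nat \<Rightarrow> nat \<Rightarrow> 'a" where
  "vtx i = inv_into (verts (G i)) (ord i)"

definition p :: "nat \<Rightarrow> nat \<Rightarrow> nat" where
  "p i t = ord i (start (ord i) (part_of (P i) (vtx i t)))"

definition adj :: "nat \<Rightarrow> nat \<Rightarrow> nat \<Rightarrow> bool" where
  "adj i t u \<longleftrightarrow> {vtx i t, vtx i u} \<in> edges (G i)"

definition w :: "nat \<Rightarrow> nat \<Rightarrow> nat" where
  "w i u = card (lower_nbrs n adj i u)"

definition vtup :: "nat set \<Rightarrow> (nat \<Rightarrow> nat) \<Rightarrow> nat \<Rightarrow> 'a" where
  "vtup S q = (\<lambda>i\<in>S. vtx i (q i))"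

section \<open>Parts and lower degrees of a single factor in terms of positions\<close>

lemma ord_bij: "i \<in> {1..d} \<Longrightarrow> bij_betw (ord i) (verts (G i)) {1..n i}"
  using optimal by (auto simp: optimal_order_def total_order_def n_def)

lemma vtx_bij: "i \<in> {1..d} \<Longrightarrow> bij_betw (vtx i) {1..n i} (verts (G i))"
  unfolding vtx_def by (rule bij_betw_inv_into[OF ord_bij])

lemma vtx_in: "i \<in> {1..d} \<Longrightarrow> t \<in> {1..n i} \<Longrightarrow> vtx i t \<in> verts (G i)"
  using vtx_bij bij_betwE by blast

lemma ord_vtx: "i \<in> {1..d} \<Longrightarrow> t \<in> {1..n i} \<Longrightarrow> ord i (vtx i t) = t"
  unfolding vtx_def using ord_bij bij_betw_inv_into_right by metis

lemma vtx_ord: "i \<in> {1..d} \<Longrightarrow> v \<in> verts (G i) \<Longrightarrow> vtx i (ord i v) = v"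
  unfolding vtx_def using ord_bij bij_betw_inv_into_left by metis

lemma ord_in: "i \<in> {1..d} \<Longrightarrow> v \<in> verts (G i) \<Longrightarrow> ord i v \<in> {1..n i}"
  using ord_bij bij_betwE by blast

lemma finite_verts: "i \<in> {1..d} \<Longrightarrow> finite (verts (G i))"
  using simple by (simp add: simple_graph_def)

lemma w_eq_lower_degree:
  assumes i: "i \<in> {1..d}" and t: "t \<in> {1..n i}"
  shows "w i t = lower_degree (G i) (ord i) (vtx i t)"
proof -
  have "vtx i ` lower_nbrs n adj i t = {u \<in> verts (G i). ord i u < ord i (vtx i t) \<and> {vtx i t, u} \<in> edges (G i)}"
  proof (intro equalityI subsetI)
    fix u assume "u \<in> {u \<in> verts (G i). ord i u < ord i (vtx i t) \<and> {vtx i t, u} \<in> edges (G i)}"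
    then have "ord i u \<in> lower_nbrs n adj i t" "u = vtx i (ord i u)"
      using vtx_ord[OF i] ord_in[OF i] ord_vtx[OF i t] by (auto simp: lower_nbrs_def adj_def insert_commute)
    then show "u \<in> vtx i ` lower_nbrs n adj i t" by blast
  qed (use ord_vtx[OF i] vtx_in[OF i] t in \<open>auto simp: lower_nbrs_def adj_def insert_commute\<close>)
  moreover have "inj_on (vtx i) (lower_nbrs n adj i t)"
    using vtx_bij[OF i] by (auto simp: bij_betw_def lower_nbrs_def intro: inj_on_subset)
  ultimately show ?thesis unfolding w_def lower_degree_def by (metis card_image)
qed

lemma part_interval:
  assumes i: "i \<in> {1..d}" and t: "t \<in> {1..n i}"
  obtains A B where "1 \<le> A" "A \<le> t" "t \<le> B" "B \<le> n i"
    "part_of (P i) (vtx i t) \<in> P i" "part_of (P i) (vtx i t) = segment (G i) (ord i) A B"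
    "\<And>u. u \<in> {A..B} \<Longrightarrow> part_of (P i) (vtx i u) = part_of (P i) (vtx i t)"
    "\<And>u. u \<in> {A..B} \<Longrightarrow> p i u = A"
    "\<And>u. u \<in> {A..B} \<Longrightarrow>
      int (w i u) = delta (G i) A + delta (induced_subgraph (G i) (segment (G i) (ord i) A B)) (u - A + 1)"
proof (rule part_structure[OF simple[OF i] optimal[OF i] partition[OF i] vtx_in[OF i t]])
  fix A B
  assume AB: "1 \<le> A" "A \<le> ord i (vtx i t)" "ord i (vtx i t) \<le> B" "B \<le> card (verts (G i))"
    "part_of (P i) (vtx i t) \<in> P i" "ord i (start (ord i) (part_of (P i) (vtx i t))) = A"
    "part_of (P i) (vtx i t) = segment (G i) (ord i) A B"
    and same: "\<And>u. u \<in> segment (G i) (ord i) A B \<Longrightarrow> part_of (P i) u = part_of (P i) (vtx i t)"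
    and deg: "\<And>u. u \<in> segment (G i) (ord i) A B \<Longrightarrow>
      int (lower_degree (G i) (ord i) u) =
      delta (G i) A + delta (induced_subgraph (G i) (segment (G i) (ord i) A B)) (ord i u - A + 1)"
  have u: "u \<in> {1..n i}" "vtx i u \<in> segment (G i) (ord i) A B" if "u \<in> {A..B}" for u
    using that AB ord_vtx[OF i, of u] vtx_in[OF i, of u] by (auto simp: segment_def n_def)
  have AB': "A \<le> t" "t \<le> B" "B \<le> n i"
    using AB(2-4) ord_vtx[OF i t] by (simp_all add: n_def)
  show thesis
  proof (rule that[of A B])
    show "part_of (P i) (vtx i u) = part_of (P i) (vtx i t)" if "u \<in> {A..B}" for u using same u(2)[OF that] .
    then show "p i u = A" if "u \<in> {A..B}" for u using AB that by (simp add: p_def)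
    show "int (w i u) = delta (G i) A + delta (induced_subgraph (G i) (segment (G i) (ord i) A B)) (u - A + 1)"
      if "u \<in> {A..B}" for u
      using deg[OF u(2)[OF that]] ord_vtx[OF i u(1)[OF that]] w_eq_lower_degree[OF i u(1)[OF that]] by simp
  qed (fact AB AB')+
qed

lemma part_start_idem:
  assumes "i \<in> {1..d}" "t \<in> {1..n i}"
  shows "p i t \<in> {1..t} \<and> p i (p i t) = p i t"
proof (rule part_interval[OF assms])
  fix A B assume AB: "1 \<le> A" "A \<le> t" "t \<le> B" and p: "\<And>u. u \<in> {A..B} \<Longrightarrow> p i u = A"
  have "p i t = A" "p i A = A" using p[of t] p[of A] AB by simp_all
  then show ?thesis using AB by simp
qed

lemma part_eq_iff:
  assumes i: "i \<in> {1..d}" and t: "t \<in> {1..n i}" and u: "u \<in> {1..n i}"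
  shows "part_of (P i) (vtx i t) = part_of (P i) (vtx i u) \<longleftrightarrow> p i t = p i u"
proof
  assume eq: "p i t = p i u"
  have "part_of (P i) (vtx i (p i t)) = part_of (P i) (vtx i t)" if "t \<in> {1..n i}" for t
  proof (rule part_interval[OF i that])
    fix A B assume AB: "A \<le> t" "t \<le> B"
      and same: "\<And>u. u \<in> {A..B} \<Longrightarrow> part_of (P i) (vtx i u) = part_of (P i) (vtx i t)"
      and p: "\<And>u. u \<in> {A..B} \<Longrightarrow> p i u = A"
    have "p i t = A" using p AB by simp
    moreover have "part_of (P i) (vtx i A) = part_of (P i) (vtx i t)" by (rule same) (use AB in simp)
    ultimately show ?thesis by (simp only:)
  qed
  from this[OF u, folded eq] this[OF t] show "part_of (P i) (vtx i t) = part_of (P i) (vtx i u)"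
    by (rule trans[OF sym, rotated])
qed (simp add: p_def)

lemma vtx_in_part:
  assumes i: "i \<in> {1..d}" and t: "t \<in> {1..n i}"
  shows "vtx i t \<in> part_of (P i) (vtx i t)"
proof (rule part_interval[OF i t])
  fix A B assume "A \<le> t" "t \<le> B" "part_of (P i) (vtx i t) = segment (G i) (ord i) A B"
  then show ?thesis using ord_vtx[OF i t] vtx_in[OF i t] by (simp add: segment_def)
qed

text \<open>Parts are intervals, and two of them that meet have the same start. If the part of
  \<open>u\<close> begins within that of \<open>t\<close>, the position \<open>B\<close> turns out
  to lie in both.\<close>

lemma part_start_mono:
  assumes i: "i \<in> {1..d}" and t: "1 \<le> t" "t \<le> u" "u \<le> n i"
  shows "p i t \<le> p i u"
proof -
  have tt: "t \<in> {1..n i}" "u \<in> {1..n i}" using t by auto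
  obtain A B where AB: "A \<le> t" "t \<le> B" "B \<le> n i" "1 \<le> A" "part_of (P i) (vtx i t) = segment (G i) (ord i) A B"
    "\<And>v. v \<in> {A..B} \<Longrightarrow> p i v = A" by (rule part_interval[OF i tt(1)]) (rule that; blast)
  obtain A' B' where AB': "A' \<le> u" "u \<le> B'" "1 \<le> A'" "part_of (P i) (vtx i u) = segment (G i) (ord i) A' B'"
    "\<And>v. v \<in> {A'..B'} \<Longrightarrow> p i v = A'" by (rule part_interval[OF i tt(2)]) (rule that; blast)
  have pt: "p i t = A" "p i u = A'" using AB AB' by auto
  show ?thesis
  proof (cases "A' \<le> B")
    case True
    have "B \<le> B'"
    proof (rule ccontr)
      assume "\<not> B \<le> B'"
      then have "p i u = A" using AB(6)[of u] AB'(1,2) t AB(1) by simp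
      then have "part_of (P i) (vtx i u) = part_of (P i) (vtx i t)" using part_eq_iff[OF i tt] pt by simp
      moreover have B: "B \<in> {1..n i}" using AB by auto
      ultimately have "vtx i B \<in> segment (G i) (ord i) A' B'"
        using AB AB'(4) ord_vtx[OF i B] vtx_in[OF i B] by (auto simp: segment_def)
      then show False using ord_vtx[OF i B] \<open>\<not> B \<le> B'\<close> by (simp add: segment_def)
    qed
    then have "A' = A" using AB'(5)[of B] AB(6)[of B] AB True by simp
    then show ?thesis using pt by simp
  next
    case False
    then show ?thesis using pt AB by simp
  qed
qed

lemma delta_seq_nth:
  assumes "j < card (verts H)"
  shows "delta_seq H ! j = delta H (j + 1)"
  using assms by (simp add: delta_seq_def del: upt_Suc)

lemma card_interval_subgraph:
  assumes i: "i \<in> {1..d}" and "1 \<le> A" "B \<le> n i"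
  shows "card (verts (induced_subgraph (G i) (segment (G i) (ord i) A B))) = B + 1 - A"
proof -
  have "segment (G i) (ord i) A B = vtx i ` {A..B}"
    using assms vtx_ord[OF i] vtx_in[OF i] ord_vtx[OF i] ord_in[OF i]
    by (auto simp: segment_def image_iff) (metis atLeastAtMost_iff)
  moreover have "inj_on (vtx i) {A..B}"
    using vtx_bij[OF i] assms by (auto simp: bij_betw_def intro: inj_on_subset)
  ultimately show ?thesis by (simp add: induced_subgraph_def card_image)
qed

text \<open>Inside a part, \<open>w i\<close> is the delta sequence of the induced subgraph shifted
  by a constant.\<close>

lemma w_mono_in_part:
  assumes i: "i \<in> {1..d}" and nd: "nondecreasing_partition (G i) (P i)"
    and uv: "1 \<le> u" "u \<le> v" "v \<le> n i" "p i u = p i v"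
  shows "w i u \<le> w i v"
proof -
  have uu: "u \<in> {1..n i}" "v \<in> {1..n i}" using uv by auto
  obtain A B where AB: "1 \<le> A" "A \<le> u" "u \<le> B" "B \<le> n i" "part_of (P i) (vtx i u) \<in> P i"
    "part_of (P i) (vtx i u) = segment (G i) (ord i) A B"
    "\<And>t. t \<in> {A..B} \<Longrightarrow>
      int (w i t) = delta (G i) A + delta (induced_subgraph (G i) (segment (G i) (ord i) A B)) (t - A + 1)"
    by (rule part_interval[OF i uu(1)]) (rule that; blast)
  let ?H = "induced_subgraph (G i) (segment (G i) (ord i) A B)"
  have "vtx i v \<in> segment (G i) (ord i) A B"
    using vtx_in_part[OF i uu(2)] part_eq_iff[OF i uu] uv(4) AB(6) by simp
  then have vB: "v \<le> B" using ord_vtx[OF i uu(2)] by (simp add: segment_def)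
  have c: "card (verts ?H) = B + 1 - A" using card_interval_subgraph[OF i] AB by simp
  have "sorted (delta_seq ?H)" using nd AB(5,6) by (simp add: nondecreasing_partition_def)
  moreover have "u - A \<le> v - A" "v - A < length (delta_seq ?H)"
    using uv vB AB c by (auto simp: delta_seq_def)
  ultimately have "delta_seq ?H ! (u - A) \<le> delta_seq ?H ! (v - A)" by (intro sorted_nth_mono)
  then have "delta ?H (u - A + 1) \<le> delta ?H (v - A + 1)"
    using delta_seq_nth[of "u - A" ?H] delta_seq_nth[of "v - A" ?H] uv vB AB c by simp
  moreover have "int (w i u) = delta (G i) A + delta ?H (u - A + 1)"
    by (rule AB(7)) (use AB(2,3) in simp)
  moreover have "int (w i v) = delta (G i) A + delta ?H (v - A + 1)"
    by (rule AB(7)) (use AB(2) uv(2) vB in simp)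
  ultimately show ?thesis by linarith
qed

lemma part_subset:
  assumes "i \<in> {1..d}" "Z \<in> P i"
  shows "Z \<subseteq> verts (G i)"
  using partition[OF assms(1)] assms(2) unfolding isoperimetric_partition_def segment_def by auto

lemma part_of_eq_THE:
  assumes i: "i \<in> {1..d}" and t: "t \<in> {1..n i}"
  shows "(THE Z. Z \<in> P i \<and> (\<exists>v\<in>Z. ord i v = t)) = part_of (P i) (vtx i t)"
proof -
  have "(Z \<in> P i \<and> (\<exists>v\<in>Z. ord i v = t)) \<longleftrightarrow> (Z \<in> P i \<and> vtx i t \<in> Z)" for Z
  proof -
    have "vtx i t \<in> Z" if "Z \<in> P i" "v \<in> Z" "ord i v = t" for v
      using vtx_ord[OF i, of v] part_subset[OF i that(1)] that by auto
    then show ?thesis using ord_vtx[OF i t] by blast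
  qed
  then show ?thesis unfolding part_of_def by simp
qed

text \<open>Equal delta sequences force equal sizes of the two parts and equal contributions from
  inside them. The constant added is 0 in the first part, and in the last part it is a number of
  neighbours, hence nonnegative. If the two parts coincide, every position is paired with
  itself.\<close>

lemma w_le_in_last_part:
  assumes i: "i \<in> {1..d}" and reg: "regular_partition (G i) (ord i) (P i)"
  shows "\<exists>N\<le>n i.
      (\<forall>v\<in>{1..n i}. (p i v = p i 1 \<longleftrightarrow> v \<le> N) \<and> (p i v = p i (n i) \<longleftrightarrow> n i - N < v)) \<and>
      (\<forall>l\<in>{1..N}. w i l \<le> w i (n i - N + l))"
proof (cases "n i = 0")
  case True
  then show ?thesis by (intro exI[of _ 0]) auto
next
  case False
  then have en: "1 \<in> {1..n i}" "n i \<in> {1..n i}" by auto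
  obtain A B where AB: "1 \<le> A" "A \<le> 1" "1 \<le> B" "B \<le> n i"
    "part_of (P i) (vtx i 1) = segment (G i) (ord i) A B" "\<And>t. t \<in> {A..B} \<Longrightarrow> p i t = A"
    "\<And>t. t \<in> {A..B} \<Longrightarrow>
      int (w i t) = delta (G i) A + delta (induced_subgraph (G i) (segment (G i) (ord i) A B)) (t - A + 1)"
    by (rule part_interval[OF i en(1)]) (rule that; blast)
  have A: "A = 1" using AB by simp
  obtain C D where CD: "1 \<le> C" "C \<le> n i" "n i \<le> D" "D \<le> n i"
    "part_of (P i) (vtx i (n i)) = segment (G i) (ord i) C D" "\<And>t. t \<in> {C..D} \<Longrightarrow> p i t = C"
    "\<And>t. t \<in> {C..D} \<Longrightarrow>
      int (w i t) = delta (G i) C + delta (induced_subgraph (G i) (segment (G i) (ord i) C D)) (t - C + 1)"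
    by (rule part_interval[OF i en(2)]) (rule that; blast)
  have D: "D = n i" using CD by simp
  let ?F = "induced_subgraph (G i) (segment (G i) (ord i) A B)"
  let ?L = "induced_subgraph (G i) (segment (G i) (ord i) C D)"
  have seq: "delta_seq ?F = delta_seq ?L"
    using reg part_of_eq_THE[OF i en(1)] part_of_eq_THE[OF i en(2)] AB(5) CD(5)
    by (simp add: regular_partition_def first_part_def last_part_def n_def)
  have cF: "card (verts ?F) = B" using card_interval_subgraph[OF i AB(1,4)] A by simp
  have cL: "card (verts ?L) = n i + 1 - C" using card_interval_subgraph[OF i CD(1,4)] D by simp
  have len: "B = n i + 1 - C" using arg_cong[OF seq, of length] cF cL by (simp add: delta_seq_def del: upt_Suc)
  have C: "C = n i - B + 1" using len CD by simp
  have "w i l \<le> w i (n i - B + l)" if l: "l \<in> {1..B}" for l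
  proof -
    have "delta (G i) C = int (lower_degree (G i) (ord i) (vtx i C))"
      using delta_eq_lower_degree[OF simple[OF i] optimal[OF i] vtx_in[OF i, of C]] ord_vtx[OF i, of C] CD by simp
    moreover have "delta (G i) A = 0" using A by (simp add: delta_def)
    moreover have "delta ?F l = delta ?L l"
    proof -
      have "l - 1 < card (verts ?F)" "l - 1 < card (verts ?L)" "l - 1 + 1 = l"
        unfolding cF cL len[symmetric] using l by auto
      then show ?thesis using delta_seq_nth[of "l - 1" ?F] delta_seq_nth[of "l - 1" ?L] seq by metis
    qed
    moreover have "int (w i l) = delta (G i) A + delta ?F (l - A + 1)"
      by (rule AB(7)) (use A l in simp)
    moreover have "int (w i (n i - B + l)) = delta (G i) C + delta ?L (n i - B + l - C + 1)"
      by (rule CD(7)) (use C D AB(4) l in auto)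
    moreover have "l - A + 1 = l" "n i - B + l - C + 1 = l" using A C l by auto
    ultimately show ?thesis by simp
  qed
  moreover have "p i v = p i 1 \<longleftrightarrow> v \<le> B" if v: "v \<in> {1..n i}" for v
  proof
    assume "p i v = p i 1"
    then have "part_of (P i) (vtx i v) = segment (G i) (ord i) A B" using part_eq_iff[OF i v en(1)] AB(5) by simp
    moreover have "vtx i v \<in> part_of (P i) (vtx i v)"
      by (rule vtx_in_part[OF i v])
    ultimately show "v \<le> B" using ord_vtx[OF i v] by (simp add: segment_def)
  qed (use AB(3,6) A v in auto)
  moreover have "p i v = p i (n i) \<longleftrightarrow> n i - B < v" if v: "v \<in> {1..n i}" for v
  proof
    assume "p i v = p i (n i)"
    then have "part_of (P i) (vtx i v) = segment (G i) (ord i) C D" using part_eq_iff[OF i v en(2)] CD(5) by simp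
    moreover have "vtx i v \<in> part_of (P i) (vtx i v)"
      by (rule vtx_in_part[OF i v])
    ultimately show "n i - B < v" using ord_vtx[OF i v] C by (simp add: segment_def)
  qed (use CD(2,6) C D v in auto)
  ultimately show ?thesis using AB(4) by blast
qed

section \<open>Tuples of vertices, tuples of positions, and edge counts\<close>

lemma vtup_bij:
  assumes S: "S \<subseteq> {1..d}"
  shows "bij_betw (vtup S) (box n S) (\<Pi>\<^sub>E i\<in>S. verts (G i))"
proof (rule bij_betw_byWitness[where f' = "\<lambda>x. \<lambda>i\<in>S. ord i (x i)"])
  have i: "i \<in> {1..d}" if "i \<in> S" for i using that S by blast
  show "\<forall>q\<in>box n S. (\<lambda>i\<in>S. ord i (vtup S q i)) = q"
    using ord_vtx[OF i] by (auto simp: vtup_def fun_eq_iff box_def restrict_def PiE_iff extensional_def)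
  show "\<forall>x\<in>\<Pi>\<^sub>E i\<in>S. verts (G i). vtup S (\<lambda>i\<in>S. ord i (x i)) = x"
    using vtx_ord[OF i] by (auto simp: vtup_def fun_eq_iff restrict_def PiE_iff extensional_def)
  show "vtup S ` box n S \<subseteq> (\<Pi>\<^sub>E i\<in>S. verts (G i))"
    using vtx_in[OF i] box_coord by (fastforce simp: vtup_def)
  show "(\<lambda>x. \<lambda>i\<in>S. ord i (x i)) ` (\<Pi>\<^sub>E i\<in>S. verts (G i)) \<subseteq> box n S"
    using ord_in[OF i] by (fastforce simp: box_def)
qed

lemma vtup_in: "S \<subseteq> {1..d} \<Longrightarrow> q \<in> box n S \<Longrightarrow> vtup S q \<in> (\<Pi>\<^sub>E i\<in>S. verts (G i))"
  using vtup_bij bij_betwE by blast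

lemma vtup_inj: "S \<subseteq> {1..d} \<Longrightarrow> inj_on (vtup S) (box n S)"
  using vtup_bij by (auto simp: bij_betw_def)

lemma vtup_surj: "S \<subseteq> {1..d} \<Longrightarrow> vtup S ` box n S = (\<Pi>\<^sub>E i\<in>S. verts (G i))"
  using vtup_bij by (auto simp: bij_betw_def)

lemma simple_prod: "S \<subseteq> {1..d} \<Longrightarrow> simple_graph (prod_graph S G)"
proof -
  assume S: "S \<subseteq> {1..d}"
  have "finite S" using S finite_subset by blast
  then have "finite (\<Pi>\<^sub>E i\<in>S. verts (G i))" using S finite_verts by (intro finite_PiE) auto
  then show ?thesis unfolding simple_graph_def prod_graph_def by auto
qed

lemma prod_edge_iff:
  assumes S: "S \<subseteq> {1..d}" and q: "q \<in> box n S" "q' \<in> box n S"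
  shows "{vtup S q, vtup S q'} \<in> edges (prod_graph S G) \<longleftrightarrow>
    (\<exists>i\<in>S. q' = q(i := q' i) \<and> q' i \<noteq> q i \<and> adj i (q' i) (q i))"
proof -
  let ?E = "\<lambda>x y. \<exists>i\<in>S. x i \<noteq> y i \<and> {x i, y i} \<in> edges (G i) \<and> (\<forall>j\<in>S - {i}. x j = y j)"
  have sym: "?E x y \<longleftrightarrow> ?E y x" for x y :: "nat \<Rightarrow> 'a" by (metis insert_commute)
  have v: "vtup S q i = vtx i (q i)" "vtup S q' i = vtx i (q' i)" if "i \<in> S" for i
    using that by (simp_all add: vtup_def)
  have eq: "vtx i (q i) = vtx i (q' i) \<longleftrightarrow> q i = q' i" if "i \<in> S" for i
    using ord_vtx[of i] box_coord[OF q(1) that] box_coord[OF q(2) that] that S by (metis subsetD)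
  have "{vtup S q, vtup S q'} \<in> edges (prod_graph S G) \<longleftrightarrow> ?E (vtup S q) (vtup S q')"
  proof
    assume "{vtup S q, vtup S q'} \<in> edges (prod_graph S G)"
    then obtain x y where "{vtup S q, vtup S q'} = {x, y}" "?E x y" by (auto simp: prod_graph_def)
    then show "?E (vtup S q) (vtup S q')" using sym by (auto simp: doubleton_eq_iff)
  next
    assume "?E (vtup S q) (vtup S q')"
    then show "{vtup S q, vtup S q'} \<in> edges (prod_graph S G)"
      using vtup_in[OF S q(1)] vtup_in[OF S q(2)] unfolding prod_graph_def by auto
  qed
  also have "\<dots> \<longleftrightarrow> (\<exists>i\<in>S. q' i \<noteq> q i \<and> adj i (q' i) (q i) \<and> (\<forall>j\<in>S - {i}. q j = q' j))"
  proof (intro bex_cong refl)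
    fix i assume i: "i \<in> S"
    have "(\<forall>j\<in>S - {i}. vtup S q j = vtup S q' j) \<longleftrightarrow> (\<forall>j\<in>S - {i}. q j = q' j)"
      by (intro ball_cong refl) (simp add: v eq)
    then show "(vtup S q i \<noteq> vtup S q' i \<and> {vtup S q i, vtup S q' i} \<in> edges (G i) \<and>
        (\<forall>j\<in>S - {i}. vtup S q j = vtup S q' j)) =
      (q' i \<noteq> q i \<and> adj i (q' i) (q i) \<and> (\<forall>j\<in>S - {i}. q j = q' j))"
      unfolding adj_def insert_commute[of "vtx i (q' i)"] using v[OF i] eq[OF i] by metis
  qed
  also have "\<dots> \<longleftrightarrow> (\<exists>i\<in>S. q' = q(i := q' i) \<and> q' i \<noteq> q i \<and> adj i (q' i) (q i))"
  proof (intro bex_cong refl)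
    fix i assume i: "i \<in> S"
    have "(\<forall>j\<in>S - {i}. q j = q' j) \<longleftrightarrow> q' = q(i := q' i)"
    proof
      assume "\<forall>j\<in>S - {i}. q j = q' j"
      then show "q' = q(i := q' i)"
        using box_upd_same[OF q(1) i box_coord[OF q(2) i]] by (intro box_ext[OF q(2)]) auto
    qed (metis DiffE fun_upd_other singletonI)
    then show "(q' i \<noteq> q i \<and> adj i (q' i) (q i) \<and> (\<forall>j\<in>S - {i}. q j = q' j)) =
      (q' = q(i := q' i) \<and> q' i \<noteq> q i \<and> adj i (q' i) (q i))" by blast
  qed
  finally show ?thesis .
qed

text \<open>The sum of the positions orients every edge, since its ends differ in one coordinate only.\<close>

lemma card_induced_prod:
  assumes S: "S \<subseteq> {1..d}" and A: "A \<subseteq> box n S"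
  shows "card (induced_edges (prod_graph S G) (vtup S ` A)) = score n adj S A"
proof -
  have fS: "finite S" using S finite_subset by blast
  have fA: "finite A" using A finite_box[OF fS] finite_subset by blast
  have inj: "inj_on (vtup S) A" using vtup_inj[OF S] A inj_on_subset by blast
  let ?f = "\<lambda>x. \<Sum>i\<in>S. ord i (x i)"
  let ?h = "\<lambda>q::nat \<Rightarrow> nat. \<Sum>i\<in>S. q i"
  have f: "?f (vtup S q) = ?h q" if "q \<in> A" for q
  proof (intro sum.cong refl)
    fix i assume i: "i \<in> S"
    have "i \<in> {1..d}" "q i \<in> {1..n i}" using i S box_coord[of q n S i] that A by blast+
    then show "ord i (vtup S q i) = q i" using ord_vtx i by (simp add: vtup_def)
  qed
  have edge: "{vtup S q, vtup S q'} \<in> edges (prod_graph S G) \<longleftrightarrow>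
    (\<exists>i\<in>S. q' = q(i := q' i) \<and> q' i \<noteq> q i \<and> adj i (q' i) (q i))" if "q \<in> A" "q' \<in> A" for q q'
    using prod_edge_iff[OF S] A that by blast
  have h_upd: "?h (q(i := t)) + q i = ?h q + t" if "i \<in> S" for q :: "nat \<Rightarrow> nat" and i t
    using that fS by (simp add: sum.remove[of S i])
  have "card (induced_edges (prod_graph S G) (vtup S ` A)) =
    (\<Sum>x\<in>vtup S ` A. card {y \<in> vtup S ` A. ?f y < ?f x \<and> {x, y} \<in> edges (prod_graph S G)})"
  proof (rule card_induced_edges[OF simple_prod[OF S]])
    show "finite (vtup S ` A)" using fA by simp
    fix x y assume "x \<in> vtup S ` A" "y \<in> vtup S ` A" and e: "{x, y} \<in> edges (prod_graph S G)"
    then obtain q q' where q: "q \<in> A" "q' \<in> A" "x = vtup S q" "y = vtup S q'" by blast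
    then obtain i where i: "i \<in> S" "q' = q(i := q' i)" "q' i \<noteq> q i" using edge e by blast
    have "?h q' \<noteq> ?h q" using h_upd[OF i(1), of q "q' i"] i(2,3) by auto
    then show "?f x \<noteq> ?f y" using q f by simp
  qed
  also have "\<dots> = (\<Sum>q\<in>A. card {y \<in> vtup S ` A. ?f y < ?f (vtup S q) \<and> {vtup S q, y} \<in> edges (prod_graph S G)})"
    by (simp add: sum.reindex[OF inj])
  also have "\<dots> = (\<Sum>q\<in>A. \<Sum>i\<in>S. card {t \<in> lower_nbrs n adj i (q i). q(i := t) \<in> A})"
  proof (intro sum.cong refl)
    fix q assume q: "q \<in> A"
    have qb: "q \<in> box n S" using q A by blast
    let ?Q = "{q' \<in> A. ?h q' < ?h q \<and> {vtup S q, vtup S q'} \<in> edges (prod_graph S G)}"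
    let ?T = "SIGMA i:S. {t \<in> lower_nbrs n adj i (q i). q(i := t) \<in> A}"
    have "{y \<in> vtup S ` A. ?f y < ?f (vtup S q) \<and> {vtup S q, y} \<in> edges (prod_graph S G)} = vtup S ` ?Q"
      using f q by auto
    moreover have "inj_on (vtup S) ?Q" using inj by (rule inj_on_subset) blast
    moreover have "?Q = (\<lambda>(i, t). q(i := t)) ` ?T"
    proof (intro equalityI subsetI)
      fix q' assume q': "q' \<in> ?Q"
      then obtain i where i: "i \<in> S" "q' = q(i := q' i)" "adj i (q' i) (q i)" using edge q by blast
      have "q' i < q i" using h_upd[OF i(1), of q "q' i"] i(2) q' by auto
      moreover have "q' i \<in> {1..n i}" using q' A i(1) box_coord by blast
      ultimately have "(i, q' i) \<in> ?T" using i q' by (auto simp: lower_nbrs_def)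
      then show "q' \<in> (\<lambda>(i, t). q(i := t)) ` ?T" using i(2) by (intro image_eqI[of _ _ "(i, q' i)"]) auto
    next
      fix q' assume "q' \<in> (\<lambda>(i, t). q(i := t)) ` ?T"
      then obtain i t where t: "i \<in> S" "t \<in> lower_nbrs n adj i (q i)" "q(i := t) \<in> A" "q' = q(i := t)" by auto
      have "?h q' < ?h q" using h_upd[OF t(1), of q t] t(2,4) by (auto simp: lower_nbrs_def)
      moreover have "{vtup S q, vtup S q'} \<in> edges (prod_graph S G)"
        using edge[OF q] t by (auto simp: lower_nbrs_def)
      ultimately show "q' \<in> ?Q" using t by blast
    qed
    moreover have "inj_on (\<lambda>(i, t). q(i := t)) ?T"
    proof (rule inj_onI, clarify)
      fix i t j t' assume h: "t \<in> lower_nbrs n adj i (q i)" "t' \<in> lower_nbrs n adj j (q j)" "q(i := t) = q(j := t')"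
      have "i = j"
        using fun_cong[OF h(3), of i] h(1) by (cases "i = j") (auto simp: lower_nbrs_def)
      then show "i = j \<and> t = t'" using fun_cong[OF h(3), of i] by simp
    qed
    ultimately show "card {y \<in> vtup S ` A. ?f y < ?f (vtup S q) \<and> {vtup S q, y} \<in> edges (prod_graph S G)} =
      (\<Sum>i\<in>S. card {t \<in> lower_nbrs n adj i (q i). q(i := t) \<in> A})"
      using fS by (simp add: card_image lower_nbrs_def)
  qed
  also have "\<dots> = score n adj S A" unfolding score_def dir_score_def by (rule sum.swap)
  finally show ?thesis .
qed

lemma line_score_optimal:
  assumes i: "i \<in> {1..d}" and X: "X \<subseteq> {1..n i}"
  shows "line_score n adj i X \<le> line_score n adj i {1..card X}"
proof -
  have e: "card (induced_edges (G i) (vtx i ` X)) = line_score n adj i X" if X: "X \<subseteq> {1..n i}" for X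
  proof -
    have inj: "inj_on (vtx i) X" using vtx_bij[OF i] X by (auto simp: bij_betw_def intro: inj_on_subset)
    have o: "ord i (vtx i t) = t" if "t \<in> X" for t using ord_vtx[OF i] that X by blast
    have loop: "{v, v} \<notin> edges (G i)" for v using simple[OF i] by (auto simp: simple_graph_def doubleton_eq_iff)
    have "card (induced_edges (G i) (vtx i ` X)) =
      (\<Sum>x\<in>vtx i ` X. card {y \<in> vtx i ` X. ord i y < ord i x \<and> {x, y} \<in> edges (G i)})"
    proof (rule card_induced_edges[OF simple[OF i]])
      show "finite (vtx i ` X)" using X finite_subset by blast
      show "ord i x \<noteq> ord i y" if "x \<in> vtx i ` X" "y \<in> vtx i ` X" "{x, y} \<in> edges (G i)" for x y
        using that o loop[of x] by auto
    qed
    also have "\<dots> = (\<Sum>u\<in>X. card {y \<in> vtx i ` X. ord i y < ord i (vtx i u) \<and> {vtx i u, y} \<in> edges (G i)})"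
      by (simp add: sum.reindex[OF inj])
    also have "\<dots> = line_score n adj i X"
      unfolding line_score_def
    proof (intro sum.cong refl)
      fix u assume u: "u \<in> X"
      have "{y \<in> vtx i ` X. ord i y < ord i (vtx i u) \<and> {vtx i u, y} \<in> edges (G i)} =
          vtx i ` (lower_nbrs n adj i u \<inter> X)"
        using o u X by (auto simp: lower_nbrs_def adj_def insert_commute)
      moreover have "inj_on (vtx i) (lower_nbrs n adj i u \<inter> X)" using inj by (rule inj_on_subset) blast
      ultimately show "card {y \<in> vtx i ` X. ord i y < ord i (vtx i u) \<and> {vtx i u, y} \<in> edges (G i)} =
          card (lower_nbrs n adj i u \<inter> X)" by (simp add: card_image)
    qed
    finally show ?thesis .
  qed
  have inj: "inj_on (vtx i) X" using vtx_bij[OF i] X by (auto simp: bij_betw_def intro: inj_on_subset)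
  have k: "card X \<le> n i" using card_mono[OF _ X] by simp
  have "vtx i ` X \<subseteq> verts (G i)" using vtx_in[OF i] X by blast
  then have "card (induced_edges (G i) (vtx i ` X)) \<le> card (induced_edges (G i) (segment (G i) (ord i) 1 (card X)))"
    using optimal[OF i] optimal_order_iff[OF simple[OF i]] card_image[OF inj] by metis
  moreover have "segment (G i) (ord i) 1 (card X) = vtx i ` {1..card X}"
  proof (intro equalityI subsetI)
    fix v assume "v \<in> segment (G i) (ord i) 1 (card X)"
    then show "v \<in> vtx i ` {1..card X}"
      using vtx_ord[OF i, of v] by (intro image_eqI[of _ _ "ord i v"]) (auto simp: segment_def)
  qed (use vtx_in[OF i] ord_vtx[OF i] k in \<open>auto simp: segment_def\<close>)
  ultimately show ?thesis using e[OF X] e[of "{1..card X}"] k by simp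
qed

end

section \<open>Block-lexicographic orders\<close>

locale dominated_product = graph_product +
  fixes \<pi> :: "nat set \<Rightarrow> (nat \<Rightarrow> 'a set) \<Rightarrow> nat \<Rightarrow> nat"
  assumes nondecreasing: "\<And>i. i \<in> {1..d - 1} \<Longrightarrow> nondecreasing_partition (G i) (P i)"
    and regular: "\<And>i. i \<in> {2..d - 1} \<Longrightarrow> regular_partition (G i) (ord i) (P i)"
    and domination: "domination_collection d G ord P \<pi>"
begin

definition precedes :: "nat set \<Rightarrow> (nat \<Rightarrow> nat) \<Rightarrow> (nat \<Rightarrow> nat) \<Rightarrow> bool" where
  "precedes S q q' \<longleftrightarrow> block_lex_less S ord P \<pi> (vtup S q) (vtup S q')"

definition rk :: "nat set \<Rightarrow> (nat \<Rightarrow> nat) \<Rightarrow> nat" where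
  "rk S q = order_map (\<Pi>\<^sub>E i\<in>S. verts (G i)) (block_lex_less S ord P \<pi>) (vtup S q)"

lemma block_of_vtup: "i \<in> S \<Longrightarrow> block_of S P (vtup S q) i = part_of (P i) (vtx i (q i))"
  by (simp add: block_of_def part_of_def vtup_def)

lemma index_coord: "S \<subseteq> {1..d} \<Longrightarrow> q \<in> box n S \<Longrightarrow> i \<in> S \<Longrightarrow> i \<in> {1..d} \<and> q i \<in> {1..n i}"
  using box_coord by blast

lemma same_block_iff:
  assumes S: "S \<subseteq> {1..d}" and q: "q \<in> box n S" "q' \<in> box n S"
  shows "block_of S P (vtup S q) = block_of S P (vtup S q') \<longleftrightarrow> (\<forall>i\<in>S. p i (q i) = p i (q' i))"
proof -
  have "block_of S P (vtup S q) = block_of S P (vtup S q') \<longleftrightarrow>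
    (\<forall>i\<in>S. block_of S P (vtup S q) i = block_of S P (vtup S q') i)"
    by (auto simp: block_of_def fun_eq_iff)
  also have "\<dots> \<longleftrightarrow> (\<forall>i\<in>S. p i (q i) = p i (q' i))"
  proof (intro ball_cong refl)
    fix i assume i: "i \<in> S"
    show "(block_of S P (vtup S q) i = block_of S P (vtup S q') i) = (p i (q i) = p i (q' i))"
      unfolding block_of_vtup[OF i]
      by (rule part_eq_iff) (use index_coord[OF S q(1) i] index_coord[OF S q(2) i] in blast)+
  qed
  finally show ?thesis .
qed

lemma nth_index_in: "S \<subseteq> {1..d} \<Longrightarrow> j \<in> {1..card S} \<Longrightarrow> nth_index S j \<in> S"
  using bij_betwE[OF nth_index_bij[OF finite_subset[of S "{1..d}"]]] by simp

lemma nth_index_surj: "S \<subseteq> {1..d} \<Longrightarrow> i \<in> S \<Longrightarrow> \<exists>j\<in>{1..card S}. nth_index S j = i"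
proof -
  assume "S \<subseteq> {1..d}" "i \<in> S"
  then have "i \<in> nth_index S ` {1..card S}"
    using bij_betw_imp_surj_on[OF nth_index_bij[OF finite_subset[of S "{1..d}"]]] by simp
  then show ?thesis by blast
qed

lemma positions_vtup:
  assumes S: "S \<subseteq> {1..d}" and q: "q \<in> box n S" and j: "j \<in> {1..card S}"
  shows "positions S ord (vtup S q) j = q (nth_index S j)"
    "positions S ord (block_start S ord (block_of S P (vtup S q))) j = p (nth_index S j) (q (nth_index S j))"
proof -
  have i: "nth_index S j \<in> S" using nth_index_in[OF S j] .
  then show "positions S ord (vtup S q) j = q (nth_index S j)"
    using index_coord[OF S q i] ord_vtx by (simp add: positions_def vtup_def)
  show "positions S ord (block_start S ord (block_of S P (vtup S q))) j = p (nth_index S j) (q (nth_index S j))"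
    using i by (simp add: positions_def block_start_def block_of_vtup p_def)
qed

lemma block_in:
  assumes S: "S \<subseteq> {1..d}" and q: "q \<in> box n S"
  shows "block_of S P (vtup S q) \<in> (\<Pi>\<^sub>E i\<in>S. P i)" "vtup S q \<in> (\<Pi>\<^sub>E i\<in>S. block_of S P (vtup S q) i)"
proof -
  have "part_of (P i) (vtx i (q i)) \<in> P i" if "i \<in> S" for i
  proof (rule part_interval)
    show "i \<in> {1..d}" "q i \<in> {1..n i}" using index_coord[OF S q that] by auto
  qed
  then show "block_of S P (vtup S q) \<in> (\<Pi>\<^sub>E i\<in>S. P i)"
    by (intro PiE_I) (simp_all only: block_of_vtup, simp add: block_of_def)
  show "vtup S q \<in> (\<Pi>\<^sub>E i\<in>S. block_of S P (vtup S q) i)"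
    using vtx_in_part index_coord[OF S q] by (simp add: PiE_iff block_of_vtup) (simp add: vtup_def)
qed

lemma permutes:
  assumes "S \<subseteq> {1..d}" "S \<noteq> {}" "q \<in> box n S"
  shows "\<pi> S (block_of S P (vtup S q)) permutes {1..card S}"
  using domination block_in(1)[OF assms(1,3)] assms unfolding domination_collection_def by blast

lemma precedes_same_block:
  assumes S: "S \<subseteq> {1..d}" "S \<noteq> {}" and q: "q \<in> box n S" "q' \<in> box n S"
    and same: "\<And>i. i \<in> S \<Longrightarrow> p i (q i) = p i (q' i)"
  shows "precedes S q q' \<longleftrightarrow> lex_less (card S) (\<lambda>j. q (nth_index S (\<pi> S (block_of S P (vtup S q)) j)))
    (\<lambda>j. q' (nth_index S (\<pi> S (block_of S P (vtup S q)) j)))"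
proof -
  let ?\<pi> = "\<pi> S (block_of S P (vtup S q))"
  have "block_of S P (vtup S q) = block_of S P (vtup S q')" using same_block_iff[OF S(1) q] same by simp
  then have "precedes S q q' \<longleftrightarrow> lex_less (card S) (\<lambda>j. positions S ord (vtup S q) (?\<pi> j)) (\<lambda>j. positions S ord (vtup S q') (?\<pi> j))"
    by (simp add: precedes_def block_lex_less_def block_dom_less_def dom_less_def)
  also have "\<dots> \<longleftrightarrow> lex_less (card S) (\<lambda>j. q (nth_index S (?\<pi> j))) (\<lambda>j. q' (nth_index S (?\<pi> j)))"
  proof (rule lex_less_cong)
    fix j assume "j \<in> {1..card S}"
    then have "?\<pi> j \<in> {1..card S}" using permutes_in_image[OF permutes[OF S q(1)]] by blast
    then show "positions S ord (vtup S q) (?\<pi> j) = q (nth_index S (?\<pi> j))"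
      "positions S ord (vtup S q') (?\<pi> j) = q' (nth_index S (?\<pi> j))"
      using positions_vtup(1)[OF S(1)] q by blast+
  qed
  finally show ?thesis .
qed

lemma precedes_other_block:
  assumes S: "S \<subseteq> {1..d}" and q: "q \<in> box n S" "q' \<in> box n S"
    and other: "\<not> (\<forall>i\<in>S. p i (q i) = p i (q' i))"
  shows "precedes S q q' \<longleftrightarrow> lex_less (card S) (\<lambda>j. p (nth_index S j) (q (nth_index S j)))
    (\<lambda>j. p (nth_index S j) (q' (nth_index S j)))"
proof -
  have "block_of S P (vtup S q) \<noteq> block_of S P (vtup S q')" using same_block_iff[OF S q] other by simp
  then have "precedes S q q' \<longleftrightarrow> lex_less (card S) (positions S ord (block_start S ord (block_of S P (vtup S q))))
     (positions S ord (block_start S ord (block_of S P (vtup S q'))))"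
    by (simp add: precedes_def block_lex_less_def)
  also have "\<dots> \<longleftrightarrow> lex_less (card S) (\<lambda>j. p (nth_index S j) (q (nth_index S j)))
    (\<lambda>j. p (nth_index S j) (q' (nth_index S j)))"
    by (rule lex_less_cong) (rule positions_vtup(2)[OF S q(1)] positions_vtup(2)[OF S q(2)], assumption)+
  finally show ?thesis .
qed

lemma precedes_lex:
  assumes S: "S \<subseteq> {1..d}" and q: "x \<in> box n S" "y \<in> box n S" and c: "c \<in> S" "p c (x c) < p c (y c)"
    and before: "\<And>i. i \<in> S \<Longrightarrow> i < c \<Longrightarrow> p i (x i) = p i (y i)"
  shows "precedes S x y"
proof -
  have fS: "finite S" using S finite_subset by blast
  obtain j where j: "j \<in> {1..card S}" "nth_index S j = c" using nth_index_surj[OF S c(1)] by blast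
  have "p (nth_index S l) (x (nth_index S l)) = p (nth_index S l) (y (nth_index S l))" if "l \<in> {1..j - 1}" for l
  proof -
    have l: "l \<in> {1..card S}" "l < j" using that j by auto
    then have "nth_index S l < c" using nth_index_less[OF fS l(1) j(1) l(2)] j(2) by simp
    then show ?thesis using before nth_index_in[OF S l(1)] by blast
  qed
  then have "lex_less (card S) (\<lambda>j. p (nth_index S j) (x (nth_index S j))) (\<lambda>j. p (nth_index S j) (y (nth_index S j)))"
    unfolding lex_less_def using j c by (intro exI[of _ "j - 1"]) auto
  moreover have "\<not> (\<forall>i\<in>S. p i (x i) = p i (y i))" using c by (metis nat_neq_iff)
  ultimately show ?thesis using precedes_other_block[OF S q] by simp
qed

lemma precedes_irrefl: "\<not> precedes S q q"
  by (simp add: precedes_def block_lex_less_def block_dom_less_def dom_less_def lex_less_irrefl)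

text \<open>A comparison between different blocks depends on the parts only, so an endpoint may be
  replaced by another tuple of its block. Two such comparisons in a row cannot lead back to the
  first block, since the lexicographic order is irreflexive.\<close>

lemma precedes_trans:
  assumes S: "S \<subseteq> {1..d}" "S \<noteq> {}" and q: "x \<in> box n S" "y \<in> box n S" "z \<in> box n S"
    and less: "precedes S x y" "precedes S y z"
  shows "precedes S x z"
proof -
  let ?same = "\<lambda>x y. \<forall>i\<in>S. p i (x i) = p i (y i)"
  let ?k = "\<lambda>x j. p (nth_index S j) (x (nth_index S j))"
  have cong: "?k x j = ?k y j" if "?same x y" "j \<in> {1..card S}" for x y j
    using that nth_index_in[OF S(1)] by blast
  show ?thesis
  proof (cases "?same x y")
    case xy: True
    show ?thesis
    proof (cases "?same y z")
      case True
      then have "?same x z" using xy by simp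
      moreover have b: "block_of S P (vtup S y) = block_of S P (vtup S x)"
        using same_block_iff[OF S(1) q(1,2)] xy by simp
      have "lex_less (card S) (\<lambda>j. x (nth_index S (\<pi> S (block_of S P (vtup S x)) j)))
          (\<lambda>j. y (nth_index S (\<pi> S (block_of S P (vtup S x)) j)))"
        using less(1) precedes_same_block[OF S q(1,2)] xy by simp
      moreover have "lex_less (card S) (\<lambda>j. y (nth_index S (\<pi> S (block_of S P (vtup S x)) j)))
          (\<lambda>j. z (nth_index S (\<pi> S (block_of S P (vtup S x)) j)))"
        using less(2) precedes_same_block[OF S q(2,3)] True unfolding b by simp
      ultimately show ?thesis using precedes_same_block[OF S q(1,3)] lex_less_trans by simp
    next
      case False
      then have xz: "\<not> ?same x z" using xy by auto
      have "lex_less (card S) (?k y) (?k z)" using less(2) precedes_other_block[OF S(1) q(2,3) False] by simp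
      then have "lex_less (card S) (?k x) (?k z)" using lex_less_cong[of "card S" "?k x" "?k y" "?k z" "?k z"] cong[OF xy] by simp
      then show ?thesis using precedes_other_block[OF S(1) q(1,3) xz] by simp
    qed
  next
    case xy: False
    have lxy: "lex_less (card S) (?k x) (?k y)" using less(1) precedes_other_block[OF S(1) q(1,2) xy] by simp
    show ?thesis
    proof (cases "?same y z")
      case True
      then have xz: "\<not> ?same x z" using xy by auto
      have "lex_less (card S) (?k x) (?k z)"
        using lxy lex_less_cong[of "card S" "?k x" "?k x" "?k y" "?k z"] cong[OF True] by simp
      then show ?thesis using precedes_other_block[OF S(1) q(1,3) xz] by simp
    next
      case False
      have "lex_less (card S) (?k y) (?k z)" using less(2) precedes_other_block[OF S(1) q(2,3) False] by simp
      then have l: "lex_less (card S) (?k x) (?k z)" using lxy lex_less_trans by blast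
      have "\<not> ?same x z"
      proof
        assume "?same x z"
        then have "lex_less (card S) (?k x) (?k x)"
          using l lex_less_cong[of "card S" "?k x" "?k x" "?k x" "?k z"] cong by simp
        then show False using lex_less_irrefl by blast
      qed
      then show ?thesis using l precedes_other_block[OF S(1) q(1,3)] by simp
    qed
  qed
qed

text \<open>Within a block the first position, in permuted order, where the tuples differ decides.
  One exists because the permutation reaches every coordinate. The resulting \<open>c\<close>
  depends on the two tuples, in contrast to the fixed coordinate of \<open>rk_dom\<close>.\<close>

lemma precedes_at_dominant:
  assumes S: "S \<subseteq> {1..d}" "S \<noteq> {}" and q: "q \<in> box n S" "q' \<in> box n S"
    and same: "\<And>i. i \<in> S \<Longrightarrow> p i (q i) = p i (q' i)"
    and ne: "q \<noteq> q'"
  obtains c where "c \<in> S" "q c \<noteq> q' c" "q c < q' c \<Longrightarrow> precedes S q q'" "q' c < q c \<Longrightarrow> precedes S q' q"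
proof -
  let ?\<pi> = "\<pi> S (block_of S P (vtup S q))"
  have perm: "?\<pi> permutes {1..card S}" by (rule permutes[OF S q(1)])
  obtain i where i: "i \<in> S" "q i \<noteq> q' i" using box_ext[OF q] ne by blast
  obtain j where j: "j \<in> {1..card S}" "nth_index S j = i" using nth_index_surj[OF S(1) i(1)] by blast
  obtain l where "?\<pi> l = j" using permutes_surj[OF perm] by (metis surjE)
  then have "\<exists>l\<in>{1..card S}. q (nth_index S (?\<pi> l)) \<noteq> q' (nth_index S (?\<pi> l))"
    using i j permutes_in_image[OF perm] by blast
  then obtain e where e: "e \<in> {1..card S}" "q (nth_index S (?\<pi> e)) \<noteq> q' (nth_index S (?\<pi> e))"
    "q (nth_index S (?\<pi> e)) < q' (nth_index S (?\<pi> e)) \<Longrightarrow>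
      lex_less (card S) (\<lambda>j. q (nth_index S (?\<pi> j))) (\<lambda>j. q' (nth_index S (?\<pi> j)))"
    "q' (nth_index S (?\<pi> e)) < q (nth_index S (?\<pi> e)) \<Longrightarrow>
      lex_less (card S) (\<lambda>j. q' (nth_index S (?\<pi> j))) (\<lambda>j. q (nth_index S (?\<pi> j)))"
    by (rule lex_less_first) blast
  have b: "block_of S P (vtup S q') = block_of S P (vtup S q)" using same_block_iff[OF S(1) q] same by simp
  have "nth_index S (?\<pi> e) \<in> S" using nth_index_in[OF S(1)] permutes_in_image[OF perm] e(1) by blast
  then show thesis
    using e(2-4) precedes_same_block[OF S q same] precedes_same_block[OF S q(2,1) same[symmetric]] b
    by (intro that[of "nth_index S (?\<pi> e)"]) auto
qed

lemma precedes_at_first: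
  assumes S: "S \<subseteq> {1..d}" and q: "q \<in> box n S" "q' \<in> box n S"
    and other: "\<not> (\<forall>i\<in>S. p i (q i) = p i (q' i))"
  obtains c where "c \<in> S" "p c (q c) \<noteq> p c (q' c)"
    "p c (q c) < p c (q' c) \<Longrightarrow> precedes S q q'" "p c (q' c) < p c (q c) \<Longrightarrow> precedes S q' q"
proof -
  let ?k = "\<lambda>x j. p (nth_index S j) (x (nth_index S j))"
  obtain i where "i \<in> S" "p i (q i) \<noteq> p i (q' i)" using other by blast
  then have "\<exists>j\<in>{1..card S}. ?k q j \<noteq> ?k q' j" using nth_index_surj[OF S] by metis
  then obtain e where e: "e \<in> {1..card S}" "?k q e \<noteq> ?k q' e"
    "?k q e < ?k q' e \<Longrightarrow> lex_less (card S) (?k q) (?k q')"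
    "?k q' e < ?k q e \<Longrightarrow> lex_less (card S) (?k q') (?k q)"
    by (rule lex_less_first) blast
  have other': "\<not> (\<forall>i\<in>S. p i (q' i) = p i (q i))" using other by metis
  show thesis
    using e(2-4) nth_index_in[OF S e(1)] precedes_other_block[OF S q other] precedes_other_block[OF S q(2,1) other']
    by (intro that[of "nth_index S e"]) auto
qed

lemma precedes_total:
  assumes S: "S \<subseteq> {1..d}" "S \<noteq> {}" and q: "q \<in> box n S" "q' \<in> box n S" "q \<noteq> q'"
  shows "precedes S q q' \<or> precedes S q' q"
proof (cases "\<forall>i\<in>S. p i (q i) = p i (q' i)")
  case True
  then show ?thesis using precedes_at_dominant[OF S q(1,2) _ q(3)] by (metis neqE)
next
  case False
  then show ?thesis using precedes_at_first[OF S(1) q(1,2)] by (metis neqE)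
qed

text \<open>Whichever coordinate decides, its entry or its part start is not larger for
  \<open>q\<close>, by \<open>part_start_mono\<close> in the latter case.\<close>

lemma precedes_of_le:
  assumes S: "S \<subseteq> {1..d}" "S \<noteq> {}" and q: "q \<in> box n S" "q' \<in> box n S" "q \<noteq> q'"
    and le: "\<And>i. i \<in> S \<Longrightarrow> q i \<le> q' i"
  shows "precedes S q q'"
proof (cases "\<forall>i\<in>S. p i (q i) = p i (q' i)")
  case True
  then show ?thesis using precedes_at_dominant[OF S q(1,2) _ q(3)] le by (metis le_neq_trans)
next
  case False
  have "p c (q c) \<le> p c (q' c)" if "c \<in> S" for c
    using part_start_mono[of c "q c" "q' c"] index_coord[OF S(1) q(1) that] index_coord[OF S(1) q(2) that] le[OF that] by simp
  then show ?thesis using precedes_at_first[OF S(1) q(1,2) False] by (metis le_neq_trans)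
qed

lemma
  assumes S: "S \<subseteq> {1..d}" "S \<noteq> {}"
  shows rk_bij_betw: "bij_betw (rk S) (box n S) {1..card (box n S)}"
    and rk_less_iff: "\<And>q q'. q \<in> box n S \<Longrightarrow> q' \<in> box n S \<Longrightarrow> rk S q < rk S q' \<longleftrightarrow> precedes S q q'"
    and order_map_bij: "bij_betw (order_map (\<Pi>\<^sub>E i\<in>S. verts (G i)) (block_lex_less S ord P \<pi>))
      (\<Pi>\<^sub>E i\<in>S. verts (G i)) {1..card (\<Pi>\<^sub>E i\<in>S. verts (G i))}"
proof -
  let ?W = "\<Pi>\<^sub>E i\<in>S. verts (G i)" and ?r = "block_lex_less S ord P \<pi>"
  have W: "?W = vtup S ` box n S" using vtup_surj[OF S(1)] by simp
  have "finite S" using S finite_subset by blast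
  then have fin: "finite ?W" unfolding W by (intro finite_imageI finite_box)
  have c: "card ?W = card (box n S)" unfolding W by (rule card_image[OF vtup_inj[OF S(1)]])
  have irr: "\<not> ?r u u" if "u \<in> ?W" for u
    using that precedes_irrefl unfolding W precedes_def by blast
  have tr: "?r u x" if "u \<in> ?W" "v \<in> ?W" "x \<in> ?W" "?r u v" "?r v x" for u v x
    using that precedes_trans[OF S] unfolding W precedes_def by blast
  have tot: "?r u v \<or> ?r v u" if "u \<in> ?W" "v \<in> ?W" "u \<noteq> v" for u v
    using that precedes_total[OF S] unfolding W precedes_def by blast
  show bij: "bij_betw (order_map ?W ?r) ?W {1..card ?W}"
    by (rule order_map_strict(1)[OF fin]) (erule irr, rule tr, assumption+, rule tot, assumption+)
  have less: "order_map ?W ?r u < order_map ?W ?r v \<longleftrightarrow> ?r u v" if "u \<in> ?W" "v \<in> ?W" for u v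
    by (rule order_map_strict(2)[OF fin _ _ _ that]) (erule irr, rule tr, assumption+, rule tot, assumption+)
  show "bij_betw (rk S) (box n S) {1..card (box n S)}"
    using bij_betw_trans[OF vtup_bij[OF S(1)] bij] c by (simp add: rk_def[abs_def] comp_def)
  show "rk S q < rk S q' \<longleftrightarrow> precedes S q q'" if "q \<in> box n S" "q' \<in> box n S" for q q'
    unfolding rk_def precedes_def by (rule less) (rule vtup_in[OF S(1)], rule that)+
qed

text \<open>Within one block this is consistency of the domination orders. Between different blocks
  the deciding coordinate is the first one with different parts; it cannot be \<open>i\<close>,
  where the tuples agree, and so it survives the restriction.\<close>

lemma precedes_restrict:
  assumes S: "S \<subseteq> {1..d}" and i: "i \<in> S" "S - {i} \<noteq> {}" and q: "x \<in> box n S" "y \<in> box n S"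
    and eq: "x i = y i" and less: "precedes S x y"
  shows "precedes (S - {i}) (restrict x (S - {i})) (restrict y (S - {i}))"
proof -
  let ?T = "S - {i}"
  have T: "?T \<subseteq> {1..d}" "?T \<subset> S" using S i by auto
  have xb: "restrict x ?T \<in> box n ?T" "restrict y ?T \<in> box n ?T" using q box_restrict by blast+
  have Sne: "S \<noteq> {}" using i by blast
  have rv: "restrict (vtup S q) ?T = vtup ?T (restrict q ?T)" for q by (auto simp: vtup_def fun_eq_iff)
  have rb: "restrict (block_of S P (vtup S q)) ?T = block_of ?T P (vtup ?T (restrict q ?T))" for q
    by (auto simp: block_of_def vtup_def fun_eq_iff)
  show ?thesis
  proof (cases "\<forall>j\<in>S. p j (x j) = p j (y j)")
    case True
    let ?Z = "block_of S P (vtup S x)"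
    have Zy: "block_of S P (vtup S y) = ?Z" using same_block_iff[OF S q] True by simp
    have "block_dom_less S ord \<pi> ?Z (vtup S x) (vtup S y)"
      using less Zy by (simp add: precedes_def block_lex_less_def)
    moreover have "consistent S (\<Pi>\<^sub>E i\<in>S. ?Z i) (block_dom_less S ord \<pi> ?Z) ?T (block_dom_less ?T ord \<pi> (restrict ?Z ?T))"
      using domination T S i(2) block_in(1)[OF S q(1)] unfolding domination_collection_def by blast
    moreover have "vtup S x j = vtup S y j" if "j \<in> S - ?T" for j
      using that eq by (simp add: vtup_def)
    ultimately have "block_dom_less ?T ord \<pi> (restrict ?Z ?T) (restrict (vtup S x) ?T) (restrict (vtup S y) ?T)"
      using block_in(2)[OF S q(1)] block_in(2)[OF S q(2)] Zy unfolding consistent_def by metis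
    moreover have "block_of ?T P (vtup ?T (restrict x ?T)) = block_of ?T P (vtup ?T (restrict y ?T))"
      unfolding rb[symmetric] Zy ..
    ultimately show ?thesis unfolding precedes_def block_lex_less_def rv rb by (simp only: if_True simp_thms)
  next
    case False
    obtain c where c: "c \<in> S" "p c (x c) < p c (y c)" "\<And>j. j \<in> S \<Longrightarrow> j < c \<Longrightarrow> p j (x j) = p j (y j)"
    proof -
      let ?D = "{j \<in> S. p j (x j) \<noteq> p j (y j)}"
      have D: "finite ?D" "?D \<noteq> {}" using False S finite_subset[of S "{1..d}"] by auto
      define c where "c = Min ?D"
      have c: "c \<in> ?D" unfolding c_def by (rule Min_in[OF D])
      have before: "p j (x j) = p j (y j)" if "j \<in> S" "j < c" for j
        using Min_le[OF D(1), of j] that unfolding c_def[symmetric] by auto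
      have "\<not> p c (y c) < p c (x c)"
      proof
        assume "p c (y c) < p c (x c)"
        then have "precedes S y x" using precedes_lex[OF S q(2,1)] c before by simp
        then show False using less precedes_trans[OF S Sne q(1,2,1)] precedes_irrefl by blast
      qed
      then show thesis using that[of c] c before by simp
    qed
    then have "c \<in> ?T" using eq by auto
    then show ?thesis using precedes_lex[OF T(1) xb, of c] c by simp
  qed
qed

end

sublocale dominated_product \<subseteq> block_order d n p w rk
proof
  show "p i u \<le> p i v" if "i \<in> {1..d}" "1 \<le> u" "u \<le> v" "v \<le> n i" for i u v
    using part_start_mono that .
  show "p i u \<in> {1..u} \<and> p i (p i u) = p i u" if "i \<in> {1..d}" "u \<in> {1..n i}" for i u
    using part_start_idem that .
  show "bij_betw (rk S) (box n S) {1..card (box n S)}" if "S \<subseteq> {1..d}" "S \<noteq> {}" for S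
    using rk_bij_betw that .
  show "rk S x \<le> rk S y"
    if "S \<subseteq> {1..d}" "S \<noteq> {}" "x \<in> box n S" "y \<in> box n S" "\<And>i. i \<in> S \<Longrightarrow> x i \<le> y i" for S x y
  proof (cases "x = y")
    case False
    then have "precedes S x y" using precedes_of_le[OF that(1-4)] that(5) by blast
    then show ?thesis using rk_less_iff[OF that(1-4)] by simp
  qed simp
  show "rk (S - {i}) (restrict x (S - {i})) < rk (S - {i}) (restrict y (S - {i}))"
    if "S \<subseteq> {1..d}" "i \<in> S" "S - {i} \<noteq> {}" "x \<in> box n S" "y \<in> box n S" "x i = y i" "rk S x < rk S y" for S i x y
  proof -
    have "S \<noteq> {}" "S - {i} \<subseteq> {1..d}" using that by auto
    then have "precedes S x y" using rk_less_iff that by blast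
    then have "precedes (S - {i}) (restrict x (S - {i})) (restrict y (S - {i}))"
      by (rule precedes_restrict[OF that(1-6)])
    then show ?thesis
      using rk_less_iff[OF \<open>S - {i} \<subseteq> {1..d}\<close> that(3) box_restrict[OF that(4)] box_restrict[OF that(5)]] by simp
  qed
  show "rk S x < rk S y"
    if "S \<subseteq> {1..d}" "x \<in> box n S" "y \<in> box n S" "c \<in> S" "p c (x c) < p c (y c)"
      "\<And>i. i \<in> S \<Longrightarrow> i < c \<Longrightarrow> p i (x i) = p i (y i)" for S x y c
  proof -
    have "precedes S x y" using that(6) by (rule precedes_lex[OF that(1-5)])
    moreover have "S \<noteq> {}" using that(4) by blast
    ultimately show ?thesis using rk_less_iff[OF that(1) _ that(2,3)] by simp
  qed
  show "\<exists>c\<in>S. \<forall>y\<in>box n S. \<forall>z\<in>box n S.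
      (\<forall>i\<in>S. p i (y i) = p i (x i) \<and> p i (z i) = p i (x i)) \<longrightarrow> y c < z c \<longrightarrow> rk S y < rk S z"
    if S: "S \<subseteq> {1..d}" "S \<noteq> {}" and x: "x \<in> box n S" for S x
  proof -
    \<comment> \<open>The first entry of the permutation of a block names the coordinate compared
      first, which settles the order whenever the two tuples differ there.\<close>
    let ?\<pi> = "\<pi> S (block_of S P (vtup S x))"
    have "card S \<noteq> 0" using S finite_subset[of S "{1..d}"] by simp
    then have k: "1 \<in> {1..card S}" by simp
    then have "?\<pi> 1 \<in> {1..card S}" using permutes_in_image[OF permutes[OF S x]] by blast
    then have c: "nth_index S (?\<pi> 1) \<in> S" by (rule nth_index_in[OF S(1)])
    have "rk S y < rk S z"
      if y: "y \<in> box n S" and z: "z \<in> box n S"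
        and same: "\<forall>i\<in>S. p i (y i) = p i (x i) \<and> p i (z i) = p i (x i)"
        and less: "y (nth_index S (?\<pi> 1)) < z (nth_index S (?\<pi> 1))" for y z
    proof -
      have "block_of S P (vtup S y) = block_of S P (vtup S x)" using same_block_iff[OF S(1) y x] same by simp
      moreover have "lex_less (card S) (\<lambda>j. y (nth_index S (?\<pi> j))) (\<lambda>j. z (nth_index S (?\<pi> j)))"
        unfolding lex_less_def using less k by (intro exI[of _ 0]) auto
      ultimately have "precedes S y z" using precedes_same_block[OF S y z] same by simp
      then show ?thesis using rk_less_iff[OF S y z] by simp
    qed
    then show ?thesis using c by blast
  qed
  show "w i u \<le> w i v" if "i \<in> {1..d - 1}" "1 \<le> u" "u \<le> v" "v \<le> n i" "p i u = p i v" for i u v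
  proof (rule w_mono_in_part[OF _ nondecreasing[OF that(1)] that(2-5)])
    show "i \<in> {1..d}" using that(1) by auto
  qed
  show "\<exists>N\<le>n i.
      (\<forall>v\<in>{1..n i}. (p i v = p i 1 \<longleftrightarrow> v \<le> N) \<and> (p i v = p i (n i) \<longleftrightarrow> n i - N < v)) \<and>
      (\<forall>l\<in>{1..N}. w i l \<le> w i (n i - N + l))" if "i \<in> {2..d - 1}" for i
  proof (rule w_le_in_last_part[OF _ regular[OF that]])
    show "i \<in> {1..d}" using that by auto
  qed
qed

section \<open>Translation between the graphs and the boxes of positions\<close>

context dominated_product
begin

lemma segment_eq_seg:
  assumes S: "S \<subseteq> {1..d}" "S \<noteq> {}"
  shows "segment (prod_graph S G) (order_map (verts (prod_graph S G)) (block_lex_less S ord P \<pi>)) 1 k =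
    vtup S ` seg S k"
proof -
  have v: "verts (prod_graph S G) = vtup S ` box n S"
    using vtup_surj[OF S(1)] by (simp add: prod_graph_def)
  have "order_map (vtup S ` box n S) (block_lex_less S ord P \<pi>) (vtup S q) = rk S q" for q
    using vtup_surj[OF S(1)] by (simp add: rk_def)
  moreover have "1 \<le> rk S q" for q by (simp add: rk_def order_map_def)
  ultimately show ?thesis unfolding segment_def seg_def v by auto
qed

text \<open>Induced edges are counted by \<open>score\<close>. Compression along single coordinates
  replaces any set by a down-set of at least the same score, and on down-sets, to which the initial
  segments belong, the score is the sum of weights. One direction serves the hypothesis on pairs of
  factors, the other the conclusion for all of them.\<close>

lemma optimal_rel_iff_opt:
  assumes S: "S \<subseteq> {1..d}" "S \<noteq> {}"
  shows "optimal_rel (prod_graph S G) (block_lex_less S ord P \<pi>) \<longleftrightarrow> opt S"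
proof -
  let ?H = "prod_graph S G"
  let ?om = "order_map (verts ?H) (block_lex_less S ord P \<pi>)"
  have fS: "finite S" using finite_index[OF S(1)] .
  have v: "verts ?H = vtup S ` box n S"
    using vtup_surj[OF S(1)] by (simp add: prod_graph_def)
  have tot: "total_order ?H ?om"
    using order_map_bij[OF S] by (simp add: total_order_def prod_graph_def)
  have card: "card (vtup S ` A) = card A" if "A \<subseteq> box n S" for A
    by (rule card_image[OF inj_on_subset[OF vtup_inj[OF S(1)] that]])
  have "optimal_rel ?H (block_lex_less S ord P \<pi>) \<longleftrightarrow>
    (\<forall>X\<subseteq>verts ?H. card (induced_edges ?H X) \<le> card (induced_edges ?H (segment ?H ?om 1 (card X))))"
    unfolding optimal_rel_def using optimal_order_iff[OF simple_prod[OF S(1)]] tot by blast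
  also have "\<dots> \<longleftrightarrow> (\<forall>A\<subseteq>box n S. score n adj S A \<le> score n adj S (seg S (card A)))"
  proof -
    have "card (induced_edges ?H (vtup S ` A)) = score n adj S A \<and>
      card (induced_edges ?H (segment ?H ?om 1 (card (vtup S ` A)))) = score n adj S (seg S (card A))"
      if "A \<subseteq> box n S" for A
      using card_induced_prod[OF S(1) that] card_induced_prod[OF S(1) seg_subset] card[OF that]
        segment_eq_seg[OF S] by simp
    then show ?thesis unfolding v by (simp add: all_subset_image)
  qed
  also have "\<dots> \<longleftrightarrow> opt S"
  proof
    have w: "weight w S = weight (\<lambda>i u. card (lower_nbrs n adj i u)) S"
      by (simp add: weight_def w_def fun_eq_iff)
    have sc: "score n adj S A = sum (weight w S) A" if "down_set n S A" for A
      unfolding w by (rule score_down_set[OF fS that])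
    show "opt S" if a: "\<forall>A\<subseteq>box n S. score n adj S A \<le> score n adj S (seg S (card A))"
      unfolding opt_def
    proof (intro allI impI)
      fix A assume A: "down_set n S A"
      then show "sum (weight w S) A \<le> sum (weight w S) (seg S (card A))"
        using a down_set_subset[OF A] sc[OF A] sc[OF down_set_seg[OF S]] by metis
    qed
    show "\<forall>A\<subseteq>box n S. score n adj S A \<le> score n adj S (seg S (card A))" if o: "opt S"
    proof (intro allI impI)
      fix A assume A: "A \<subseteq> box n S"
      obtain B where B: "down_set n S B" "card B = card A" "score n adj S A \<le> score n adj S B"
        using exists_down_set[OF fS A, of adj] line_score_optimal S(1) by blast
      have "score n adj S B \<le> score n adj S (seg S (card B))"
        using o B(1) unfolding sc[OF B(1)] sc[OF down_set_seg[OF S]] opt_def by blast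
      then show "score n adj S A \<le> score n adj S (seg S (card A))" using B by simp
    qed
  qed
  finally show ?thesis .
qed

end

theorem theorem9:
  fixes d :: nat
    and G :: "nat \<Rightarrow> 'a ugraph"
    and ord :: "nat \<Rightarrow> 'a \<Rightarrow> nat"
    and P :: "nat \<Rightarrow> 'a set set"
    and \<pi> :: "nat set \<Rightarrow> (nat \<Rightarrow> 'a set) \<Rightarrow> nat \<Rightarrow> nat"
  assumes "d \<ge> 3"
    and "\<forall>i\<in>{1..d}. simple_graph (G i)"
    and "\<forall>i\<in>{1..d}. isoperimetric (G i)"
    and "\<forall>i\<in>{1..d}. optimal_order (G i) (ord i)"
    and "\<forall>i\<in>{1..d}. isoperimetric_partition (G i) (ord i) (P i)"
    and "\<forall>i\<in>{1..d - 1}. nondecreasing_partition (G i) (P i)"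
    and "regular_domination_collection d G ord P \<pi>"
    and "\<forall>i\<in>{1..d}. \<forall>j\<in>{1..d}. i < j \<longrightarrow>
           optimal_rel (prod_graph {i, j} G) (block_lex_less {i, j} ord P \<pi>)"
  shows "optimal_rel (prod_graph {1..d} G) (block_lex_less {1..d} ord P \<pi>)"
proof -
  interpret dominated_product d G ord P \<pi>
    using assms(2,4-7) by unfold_locales (auto simp: regular_domination_collection_def)
  have pairs: "opt {i, j}" if "i \<in> {1..d}" "j \<in> {1..d}" "i < j" for i j
    using assms(8) that optimal_rel_iff_opt[of "{i, j}"] by simp
  have "opt {1..d}" by (rule opt_of_pairs[OF pairs]) (use assms(1) in simp_all)
  then show ?thesis using optimal_rel_iff_opt[of "{1..d}"] assms(1) by simp
qed

end
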